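(* (1) Let $H$ be a finitely generated subgroup of a finitely generated group $G$. Let $X$ be a non-trivial $H$-almost invariant set in $G$ such that $E=\{gX,gX^*:g\in G\}$ is almost nested and such that, for every $g\in G$, if two of the four sets $X^{( * )}\cap gX^{( * )}$ are small, then at least one of them is empty. Then $G$ splits over the stabilizer $H'$ of $X$, and $H'$ contains $H$ as a subgroup of finite index. Further, one of the $H'$-almost invariant sets $Y$ determined by the splitting is $H$-almost equal to $X$. (2) Let $H_1,\ldots,H_k$ be finitely generated subgroups of a finitely generated group $G$. Let $X_i$, $1\leq i\leq k$, be a non-trivial $H_i$-almost invariant set in $G$ such that $E=\{gX_i,gX_i^*:1\leq i\leq k,\ g\in G\}$ is almost nested. Suppose further that, for any pair of elements $U$ and $V$ of $E$, if two of the four sets $U^{( * )}\cap V^{( * )}$ are small, then at least one of them is empty. Then $G$ can be expressed as the fundamental group of a graph of groups whose $i$-th edge corresponds to a conjugate of a splitting of $G$ over the stabilizer $H_i'$ of $X_i$, and $H_i'$ contains $H_i$ as a subgroup of finite index. Further, for each $i$, one of the $H_i'$-almost invariant sets determined by the $i$-th splitting is $H_i$-almost equal to $X_i$.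
   Context: Almost invariant sets. Two sets are almost equal if their symmetric difference is finite. $G$ acts on the right on the set $H\backslash G$ of cosets $Hg$; $P\subset H\backslash G$ is almost invariant if $Pg$ is almost equal to $P$ for all $g\in G$. For $X\subset G$ write $X^*=G-X$. $X$ is $H$-almost invariant if $hX=X$ for all $h\in H$ and the image $H\backslash X$ of $X$ in $H\backslash G$ is almost invariant; it is non-trivial if $H\backslash X$ and $H\backslash X^*$ are both infinite. A subset of $G$ is $H$-finite if it lies in a finite union of cosets $Hg$; two subsets are $H$-almost equal if their symmetric difference is $H$-finite. If $X$ is $H$-almost invariant, then $gX$ is $gHg^{-1}$-almost invariant. The stabilizer of $X$ is $\{g\in G:gX=X\}$. $U^{( * )}\cap V^{( * )}$ denotes the four sets $U\cap V$, $U^*\cap V$, $U\cap V^*$, $U^*\cap V^*$. If $U$ is $L$-almost invariant and $V$ is $M$-almost invariant (both non-trivial), $U\cap V$ is small if it is $L$-finite; this is equivalent to its being $M$-finite. A collection $E$, closed under complementation, of sets each of which is almost invariant with respect to some subgroup, is almost nested if for any $U,V\in E$ one of the four sets $U^{( * )}\cap V^{( * )}$ is small. Splittings. A splitting of a group $G$ is either (a) proper subgroups $A,B$ of $G$ and a subgroup $H\subset A\cap B$ such that the natural map $A*_HB\to G$ is an isomorphism, or (b) a subgroup $A$ of $G$ and subgroups $H_0,H_1$ of $A$ such that some $t\in G$ conjugates $H_0$ to $H_1$ and the natural map $A*_H\to G$ from the resulting HNN extension (with stable letter mapped to $t$) is an isomorphism; here $H=H_0$. It is called a splitting of $G$ over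 $H$, and $G$ is said to split over $H$. Its conjugate by $g\in G$ is obtained by conjugating all the data by $g$. The $i$-th edge of a graph of groups structure on $G$ corresponds to the splitting of $G$ obtained by collapsing all edges but the $i$-th. Almost invariant sets determined by a splitting over $H$. If $G=A*_HB$, choose transversals $T_A,T_B$ (containing the identity) for the cosets $gH$ of $H$ in $A$ and in $B$; each $g\in G$ is uniquely $a_1b_1a_2\cdots a_nb_nh$ with $h\in H$, $a_i\in T_A$, $b_i\in T_B$, where only $h,a_1,b_n$ may be trivial; let $Z$ be the set of elements with $a_1$ non-trivial. If $G=A*_H$, let $\alpha_1,\alpha_2:H\to A$ be the two inclusions with $t^{-1}\alpha_1(h)t=\alpha_2(h)$ ($H$ being identified with $\alpha_1(H)$), and choose transversals $T_i$ (containing the identity) for the cosets $g\alpha_i(H)$ in $A$; each $g\in G$ is uniquely $a_1t^{\epsilon_1}a_2\cdots a_nt^{\epsilon_n}a_{n+1}$ with $a_{n+1}\in A$, $\epsilon_i=\pm1$, $a_i\in T_1$ if $\epsilon_i=1$, $a_i\in T_2$ if $\epsilon_i=-1$, and $a_i\neq1$ if $\epsilon_{i-1}\neq\epsilon_i$; let $Z$ be the set of elements with $a_1$ trivial and $\epsilon_1=1$. The $H$-almost invariant sets determined by the splitting are $Z$, $Z\cup H$, $Z^*$, $Z^*-H$. *)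

theory Defs
  imports "HOL-Algebra.Generated_Groups" "HOL-Algebra.Group_Action"
begin

section \<open>Almost invariant sets\<close>

definition fin_gen :: "'a monoid \<Rightarrow> 'a set \<Rightarrow> bool" where
  "fin_gen G H \<longleftrightarrow> (\<exists>S. finite S \<and> S \<subseteq> H \<and> generate G S = H)"

definition set_stabilizer :: "'a monoid \<Rightarrow> 'a set \<Rightarrow> 'a set" where
  "set_stabilizer G X = stabilizer G (\<lambda>g Y. g <#\<^bsub>G\<^esub> Y) X"

definition coset_image :: "'a monoid \<Rightarrow> 'a set \<Rightarrow> 'a set \<Rightarrow> 'a set set" where
  "coset_image G H X = (\<lambda>x. H #>\<^bsub>G\<^esub> x) ` X"

definition ai_cosets :: "'a monoid \<Rightarrow> 'a set \<Rightarrow> 'a set set \<Rightarrow> bool" where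
  "ai_cosets G H P \<longleftrightarrow> P \<subseteq> rcosets\<^bsub>G\<^esub> H \<and>
     (\<forall>g\<in>carrier G. finite (sym_diff ((\<lambda>C. C #>\<^bsub>G\<^esub> g) ` P) P))"

definition almost_invariant :: "'a monoid \<Rightarrow> 'a set \<Rightarrow> 'a set \<Rightarrow> bool" where
  "almost_invariant G H X \<longleftrightarrow> subgroup H G \<and> X \<subseteq> carrier G \<and>
     (\<forall>h\<in>H. h <#\<^bsub>G\<^esub> X = X) \<and> ai_cosets G H (coset_image G H X)"

definition nontrivial_ai :: "'a monoid \<Rightarrow> 'a set \<Rightarrow> 'a set \<Rightarrow> bool" where
  "nontrivial_ai G H X \<longleftrightarrow> almost_invariant G H X \<and>
     infinite (coset_image G H X) \<and> infinite (coset_image G H (carrier G - X))"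

definition H_finite :: "'a monoid \<Rightarrow> 'a set \<Rightarrow> 'a set \<Rightarrow> bool" where
  "H_finite G H S \<longleftrightarrow> (\<exists>F. finite F \<and> F \<subseteq> carrier G \<and> S \<subseteq> (\<Union>g\<in>F. H #>\<^bsub>G\<^esub> g))"

definition H_almost_equal :: "'a monoid \<Rightarrow> 'a set \<Rightarrow> 'a set \<Rightarrow> 'a set \<Rightarrow> bool" where
  "H_almost_equal G H X Y \<longleftrightarrow> H_finite G H (sym_diff X Y)"

text \<open>
  Smallness of the intersection of \<open>U\<close> and \<open>V\<close>.  A set may be almost invariant with respect
  to several subgroups.  When \<open>G\<close> is finitely generated, whether the intersection is
  \<open>L\<close>-finite does not depend on the subgroup \<open>L\<close> with respect to which \<open>U\<close> is a non-trivial
  almost invariant set, and is equivalent to its being \<open>M\<close>-finite; so the quantifiers over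
  \<open>L\<close> and \<open>M\<close> below could as well be universal for such sets \<open>U\<close> and \<open>V\<close>.
\<close>
definition small_inter :: "'a monoid \<Rightarrow> 'a set \<Rightarrow> 'a set \<Rightarrow> bool" where
  "small_inter G U V \<longleftrightarrow>
     (\<exists>L M. nontrivial_ai G L U \<and> nontrivial_ai G M V \<and> H_finite G L (U \<inter> V))"

text \<open>
  The four sets \<open>U\<^sup>(\<^sup>*\<^sup>) \<inter> V\<^sup>(\<^sup>*\<^sup>)\<close> are indexed by pairs of Booleans, \<open>False\<close> standing for
  the complement, so that ``two of the four sets'' means two different positions (the sets
  in two different positions may coincide, for instance when both are empty).
\<close>
definition side :: "'a monoid \<Rightarrow> bool \<Rightarrow> 'a set \<Rightarrow> 'a set" where
  "side G b U = (if b then U else carrier G - U)"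

definition corner :: "'a monoid \<Rightarrow> 'a set \<Rightarrow> 'a set \<Rightarrow> bool \<times> bool \<Rightarrow> 'a set" where
  "corner G U V c = side G (fst c) U \<inter> side G (snd c) V"

definition small_corner :: "'a monoid \<Rightarrow> 'a set \<Rightarrow> 'a set \<Rightarrow> bool \<times> bool \<Rightarrow> bool" where
  "small_corner G U V c \<longleftrightarrow> small_inter G (side G (fst c) U) (side G (snd c) V)"

definition almost_nested :: "'a monoid \<Rightarrow> 'a set set \<Rightarrow> bool" where
  "almost_nested G E \<longleftrightarrow> (\<forall>U\<in>E. \<forall>V\<in>E. \<exists>c. small_corner G U V c)"

definition two_small_imp_empty :: "'a monoid \<Rightarrow> 'a set \<Rightarrow> 'a set \<Rightarrow> bool" where
  "two_small_imp_empty G U V \<longleftrightarrow>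
     (\<forall>c d. c \<noteq> d \<and> small_corner G U V c \<and> small_corner G U V d \<longrightarrow>
        corner G U V c = {} \<or> corner G U V d = {})"

definition translates :: "'a monoid \<Rightarrow> 'a set \<Rightarrow> 'a set set" where
  "translates G X = (\<Union>g\<in>carrier G. {g <#\<^bsub>G\<^esub> X, g <#\<^bsub>G\<^esub> (carrier G - X)})"


section \<open>Groups presented by generators and relations\<close>

text \<open>
  Words are lists of letters; \<open>word_cong R\<close> is the congruence on the free monoid of words
  generated by the set \<open>R\<close> of pairs of words.  The resulting quotient is a monoid in
  general; in each use below every letter has an inverse, so that it is a group, namely
  the one with the displayed group presentation.
\<close>
inductive word_cong :: "('l list \<times> 'l list) set \<Rightarrow> 'l list \<Rightarrow> 'l list \<Rightarrow> bool"
  for R where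
  rel: "(u, v) \<in> R \<Longrightarrow> word_cong R (x @ u @ y) (x @ v @ y)"
| refl: "word_cong R u u"
| sym: "word_cong R u v \<Longrightarrow> word_cong R v u"
| trans: "word_cong R u v \<Longrightarrow> word_cong R v w \<Longrightarrow> word_cong R u w"

definition word_class :: "'l set \<Rightarrow> ('l list \<times> 'l list) set \<Rightarrow> 'l list \<Rightarrow> 'l list set" where
  "word_class L R u = {v \<in> lists L. word_cong R u v}"

definition presented_group ::
    "'l set \<Rightarrow> ('l list \<times> 'l list) set \<Rightarrow> 'l list set monoid" where
  "presented_group L R =
     \<lparr>carrier = word_class L R ` lists L,
      mult = (\<lambda>C D. \<Union>u\<in>C. \<Union>v\<in>D. word_class L R (u @ v)),
      one = word_class L R []\<rparr>"

text \<open>The relations that make the letters \<open>c a\<close> multiply as the elements \<open>a\<close> of \<open>K\<close>.\<close>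
definition group_rels :: "('a \<Rightarrow> 'l) \<Rightarrow> 'a monoid \<Rightarrow> ('l list \<times> 'l list) set" where
  "group_rels c K =
     {([c a, c b], [c (a \<otimes>\<^bsub>K\<^esub> b)]) | a b. a \<in> carrier K \<and> b \<in> carrier K} \<union>
     {([c \<one>\<^bsub>K\<^esub>], [])}"

text \<open>
  The map from a presented group to \<open>G\<close> that sends each letter \<open>l\<close> to \<open>f l\<close>
  (it is well defined when \<open>f\<close> respects the relations).
\<close>
definition word_eval :: "'a monoid \<Rightarrow> ('l \<Rightarrow> 'a) \<Rightarrow> 'l list \<Rightarrow> 'a" where
  "word_eval G f w = foldr (\<lambda>l x. f l \<otimes>\<^bsub>G\<^esub> x) w \<one>\<^bsub>G\<^esub>"

definition induced_map :: "'a monoid \<Rightarrow> ('l \<Rightarrow> 'a) \<Rightarrow> 'l list set \<Rightarrow> 'a" where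
  "induced_map G f C = the_elem (word_eval G f ` C)"


section \<open>Splittings\<close>

text \<open>The amalgamated free product of \<open>A\<close> and \<open>B\<close> along \<open>i: H \<rightarrow> A\<close> and \<open>j: H \<rightarrow> B\<close>.\<close>
definition amalgamated_product ::
    "'a monoid \<Rightarrow> 'b monoid \<Rightarrow> 'h set \<Rightarrow> ('h \<Rightarrow> 'a) \<Rightarrow> ('h \<Rightarrow> 'b) \<Rightarrow> ('a + 'b) list set monoid" where
  "amalgamated_product A B H i j =
     presented_group (Inl ` carrier A \<union> Inr ` carrier B)
       (group_rels Inl A \<union> group_rels Inr B \<union> {([Inl (i h)], [Inr (j h)]) | h. h \<in> H})"

text \<open>\<open>Stable True\<close> is the stable letter \<open>t\<close> and \<open>Stable False\<close> its inverse.\<close>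
datatype 'a hnn_letter = Base 'a | Stable bool

text \<open>The HNN extension \<open>\<langle>A, t | t\<inverse> \<alpha>\<^sub>1(h) t = \<alpha>\<^sub>2(h), h \<in> H\<rangle>\<close>.\<close>
definition hnn_extension ::
    "'a monoid \<Rightarrow> 'h set \<Rightarrow> ('h \<Rightarrow> 'a) \<Rightarrow> ('h \<Rightarrow> 'a) \<Rightarrow> 'a hnn_letter list set monoid" where
  "hnn_extension A H \<alpha>\<^sub>1 \<alpha>\<^sub>2 =
     presented_group (Base ` carrier A \<union> range Stable)
       (group_rels Base A \<union>
        {([Stable True, Stable False], []), ([Stable False, Stable True], [])} \<union>
        {([Stable False, Base (\<alpha>\<^sub>1 h), Stable True], [Base (\<alpha>\<^sub>2 h)]) | h. h \<in> H})"

primrec hnn_letter_value :: "'a monoid \<Rightarrow> 'a \<Rightarrow> 'a hnn_letter \<Rightarrow> 'a" where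
  "hnn_letter_value G t (Base a) = a"
| "hnn_letter_value G t (Stable b) = (if b then t else inv\<^bsub>G\<^esub> t)"

text \<open>
  The data of a splitting: \<open>Amalgam A B H\<close>, or \<open>HNN A H\<^sub>0 H\<^sub>1 t\<close>, where \<open>t\<close> is the element
  of \<open>G\<close> that is the image of the stable letter.
\<close>
datatype 'a splitting =
    Amalgam "'a set" "'a set" "'a set"
  | HNN "'a set" "'a set" "'a set" 'a

fun is_splitting :: "'a monoid \<Rightarrow> 'a splitting \<Rightarrow> bool" where
  "is_splitting G (Amalgam A B H) \<longleftrightarrow>
     subgroup A G \<and> A \<noteq> carrier G \<and> subgroup B G \<and> B \<noteq> carrier G \<and>
     subgroup H G \<and> H \<subseteq> A \<inter> B \<and>
     induced_map G (case_sum id id) \<in>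
       iso (amalgamated_product (G\<lparr>carrier := A\<rparr>) (G\<lparr>carrier := B\<rparr>) H id id) G"
| "is_splitting G (HNN A H\<^sub>0 H\<^sub>1 t) \<longleftrightarrow>
     subgroup A G \<and> subgroup H\<^sub>0 G \<and> H\<^sub>0 \<subseteq> A \<and> subgroup H\<^sub>1 G \<and> H\<^sub>1 \<subseteq> A \<and>
     t \<in> carrier G \<and> (\<lambda>h. inv\<^bsub>G\<^esub> t \<otimes>\<^bsub>G\<^esub> h \<otimes>\<^bsub>G\<^esub> t) ` H\<^sub>0 = H\<^sub>1 \<and>
     induced_map G (hnn_letter_value G t) \<in>
       iso (hnn_extension (G\<lparr>carrier := A\<rparr>) H\<^sub>0 id (\<lambda>h. inv\<^bsub>G\<^esub> t \<otimes>\<^bsub>G\<^esub> h \<otimes>\<^bsub>G\<^esub> t)) G"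

fun edge_subgroup :: "'a splitting \<Rightarrow> 'a set" where
  "edge_subgroup (Amalgam A B H) = H"
| "edge_subgroup (HNN A H\<^sub>0 H\<^sub>1 t) = H\<^sub>0"

definition splitting_over :: "'a monoid \<Rightarrow> 'a splitting \<Rightarrow> 'a set \<Rightarrow> bool" where
  "splitting_over G \<sigma> H \<longleftrightarrow> is_splitting G \<sigma> \<and> edge_subgroup \<sigma> = H"

definition conj_by :: "('a, 'm) monoid_scheme \<Rightarrow> 'a \<Rightarrow> 'a \<Rightarrow> 'a" where
  "conj_by G g x = g \<otimes>\<^bsub>G\<^esub> x \<otimes>\<^bsub>G\<^esub> inv\<^bsub>G\<^esub> g"

fun conj_splitting :: "'a monoid \<Rightarrow> 'a \<Rightarrow> 'a splitting \<Rightarrow> 'a splitting" where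
  "conj_splitting G g (Amalgam A B H) =
     Amalgam (conj_by G g ` A) (conj_by G g ` B) (conj_by G g ` H)"
| "conj_splitting G g (HNN A H\<^sub>0 H\<^sub>1 t) =
     HNN (conj_by G g ` A) (conj_by G g ` H\<^sub>0) (conj_by G g ` H\<^sub>1) (conj_by G g t)"


section \<open>The almost invariant sets determined by a splitting\<close>

definition transversal :: "'a monoid \<Rightarrow> 'a set \<Rightarrow> 'a set \<Rightarrow> 'a set \<Rightarrow> bool" where
  "transversal G K H T \<longleftrightarrow> T \<subseteq> K \<and> \<one>\<^bsub>G\<^esub> \<in> T \<and> (\<forall>k\<in>K. \<exists>!x. x \<in> T \<and> x \<in> k <#\<^bsub>G\<^esub> H)"

text \<open>The word \<open>a\<^sub>1 b\<^sub>1 \<dots> a\<^sub>n b\<^sub>n h\<close> (\<open>n \<ge> 1\<close>) is encoded by \<open>[(a\<^sub>1, b\<^sub>1), \<dots>, (a\<^sub>n, b\<^sub>n)]\<close> and \<open>h\<close>.\<close>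
definition amalgam_normal_form ::
    "'a monoid \<Rightarrow> 'a set \<Rightarrow> 'a set \<Rightarrow> 'a set \<Rightarrow> ('a \<times> 'a) list \<Rightarrow> 'a \<Rightarrow> bool" where
  "amalgam_normal_form G T\<^sub>A T\<^sub>B H ps h \<longleftrightarrow>
     ps \<noteq> [] \<and> set ps \<subseteq> T\<^sub>A \<times> T\<^sub>B \<and> h \<in> H \<and>
     (\<forall>i<length ps. (0 < i \<longrightarrow> fst (ps ! i) \<noteq> \<one>\<^bsub>G\<^esub>) \<and>
                    (Suc i < length ps \<longrightarrow> snd (ps ! i) \<noteq> \<one>\<^bsub>G\<^esub>))"

definition amalgam_value :: "'a monoid \<Rightarrow> ('a \<times> 'a) list \<Rightarrow> 'a \<Rightarrow> 'a" where
  "amalgam_value G ps h = foldr (\<lambda>(a, b) x. a \<otimes>\<^bsub>G\<^esub> b \<otimes>\<^bsub>G\<^esub> x) ps h"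

definition amalgam_Z :: "'a monoid \<Rightarrow> 'a set \<Rightarrow> 'a set \<Rightarrow> 'a set \<Rightarrow> 'a set" where
  "amalgam_Z G T\<^sub>A T\<^sub>B H =
     {amalgam_value G ps h | ps h. amalgam_normal_form G T\<^sub>A T\<^sub>B H ps h \<and> fst (hd ps) \<noteq> \<one>\<^bsub>G\<^esub>}"

text \<open>
  The word \<open>a\<^sub>1 t\<^sup>\<epsilon>\<^sub>1 \<dots> a\<^sub>n t\<^sup>\<epsilon>\<^sub>n a'\<close> (\<open>n \<ge> 0\<close>) is encoded by \<open>[(a\<^sub>1, \<epsilon>\<^sub>1), \<dots>, (a\<^sub>n, \<epsilon>\<^sub>n)]\<close> and \<open>a'\<close>,
  an exponent \<open>\<epsilon> = 1\<close> being represented by \<open>True\<close> and \<open>\<epsilon> = -1\<close> by \<open>False\<close>.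
\<close>
definition hnn_normal_form ::
    "'a monoid \<Rightarrow> 'a set \<Rightarrow> 'a set \<Rightarrow> 'a set \<Rightarrow> ('a \<times> bool) list \<Rightarrow> 'a \<Rightarrow> bool" where
  "hnn_normal_form G A T\<^sub>1 T\<^sub>2 ps a' \<longleftrightarrow>
     a' \<in> A \<and> (\<forall>(a, \<epsilon>)\<in>set ps. a \<in> (if \<epsilon> then T\<^sub>1 else T\<^sub>2)) \<and>
     (\<forall>i. Suc i < length ps \<and> snd (ps ! i) \<noteq> snd (ps ! Suc i) \<longrightarrow> fst (ps ! Suc i) \<noteq> \<one>\<^bsub>G\<^esub>)"

definition hnn_value :: "'a monoid \<Rightarrow> 'a \<Rightarrow> ('a \<times> bool) list \<Rightarrow> 'a \<Rightarrow> 'a" where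
  "hnn_value G t ps a' =
     foldr (\<lambda>(a, \<epsilon>) x. a \<otimes>\<^bsub>G\<^esub> (if \<epsilon> then t else inv\<^bsub>G\<^esub> t) \<otimes>\<^bsub>G\<^esub> x) ps a'"

definition hnn_Z :: "'a monoid \<Rightarrow> 'a set \<Rightarrow> 'a set \<Rightarrow> 'a set \<Rightarrow> 'a \<Rightarrow> 'a set" where
  "hnn_Z G A T\<^sub>1 T\<^sub>2 t =
     {hnn_value G t ps a' | ps a'. hnn_normal_form G A T\<^sub>1 T\<^sub>2 ps a' \<and>
        ps \<noteq> [] \<and> fst (hd ps) = \<one>\<^bsub>G\<^esub> \<and> snd (hd ps)}"

definition four_sets :: "'a monoid \<Rightarrow> 'a set \<Rightarrow> 'a set \<Rightarrow> 'a set set" where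
  "four_sets G H Z = {Z, Z \<union> H, carrier G - Z, (carrier G - Z) - H}"

fun determined_sets :: "'a monoid \<Rightarrow> 'a splitting \<Rightarrow> 'a set set" where
  "determined_sets G (Amalgam A B H) =
     (\<Union>{four_sets G H (amalgam_Z G T\<^sub>A T\<^sub>B H) | T\<^sub>A T\<^sub>B.
          transversal G A H T\<^sub>A \<and> transversal G B H T\<^sub>B})"
| "determined_sets G (HNN A H\<^sub>0 H\<^sub>1 t) =
     (\<Union>{four_sets G H\<^sub>0 (hnn_Z G A T\<^sub>1 T\<^sub>2 t) | T\<^sub>1 T\<^sub>2.
          transversal G A H\<^sub>0 T\<^sub>1 \<and> transversal G A H\<^sub>1 T\<^sub>2})"


section \<open>Graphs of groups\<close>

text \<open>
  Each geometric edge \<open>e\<close> is listed once, with a chosen orientation from \<open>src e\<close> to \<open>tgt e\<close>;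
  \<open>inj_src e\<close> and \<open>inj_tgt e\<close> are the injections of its group into the two vertex groups.
\<close>
record ('v, 'e, 'a) gog =
  verts :: "'v set"
  edges :: "'e set"
  src :: "'e \<Rightarrow> 'v"
  tgt :: "'e \<Rightarrow> 'v"
  vgrp :: "'v \<Rightarrow> 'a monoid"
  egrp :: "'e \<Rightarrow> 'a monoid"
  inj_src :: "'e \<Rightarrow> 'a \<Rightarrow> 'a"
  inj_tgt :: "'e \<Rightarrow> 'a \<Rightarrow> 'a"

text \<open>\<open>Edge e True\<close> is the edge \<open>e\<close> with its orientation, \<open>Edge e False\<close> its reverse.\<close>
datatype ('v, 'e, 'a) gog_letter = Vert 'v 'a | Edge 'e bool

definition gog_letters :: "('v, 'e, 'a) gog \<Rightarrow> ('v, 'e, 'a) gog_letter set" where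
  "gog_letters \<G> = {Vert v a | v a. v \<in> verts \<G> \<and> a \<in> carrier (vgrp \<G> v)} \<union>
                   {Edge e b | e b. e \<in> edges \<G>}"

definition gog_rels ::
    "('v, 'e, 'a) gog \<Rightarrow> (('v, 'e, 'a) gog_letter list \<times> ('v, 'e, 'a) gog_letter list) set" where
  "gog_rels \<G> =
     (\<Union>v\<in>verts \<G>. group_rels (Vert v) (vgrp \<G> v)) \<union>
     {([Edge e b, Edge e (\<not> b)], []) | e b. e \<in> edges \<G>} \<union>
     {([Edge e False, Vert (src \<G> e) (inj_src \<G> e h), Edge e True],
       [Vert (tgt \<G> e) (inj_tgt \<G> e h)]) | e h. e \<in> edges \<G> \<and> h \<in> carrier (egrp \<G> e)}"

text \<open>
  Serre's path group \<open>F(\<G>)\<close>: it is generated by all vertex groups and all edges, and the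
  fundamental group at a vertex \<open>v\<close> is its subgroup of the elements represented by words
  \<open>g\<^sub>0 e\<^sub>1 g\<^sub>1 \<dots> e\<^sub>n g\<^sub>n\<close> that run along a closed edge path at \<open>v\<close>.
\<close>
definition gog_class ::
    "('v, 'e, 'a) gog \<Rightarrow> ('v, 'e, 'a) gog_letter list \<Rightarrow> ('v, 'e, 'a) gog_letter list set" where
  "gog_class \<G> = word_class (gog_letters \<G>) (gog_rels \<G>)"

definition path_group ::
    "('v, 'e, 'a) gog \<Rightarrow> ('v, 'e, 'a) gog_letter list set monoid" where
  "path_group \<G> = presented_group (gog_letters \<G>) (gog_rels \<G>)"

text \<open>\<open>gog_path \<G> S v w p\<close>: the word \<open>p\<close> runs from \<open>v\<close> to \<open>w\<close>, using only edges in \<open>S\<close>.\<close>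
inductive gog_path ::
    "('v, 'e, 'a) gog \<Rightarrow> 'e set \<Rightarrow> 'v \<Rightarrow> 'v \<Rightarrow> ('v, 'e, 'a) gog_letter list \<Rightarrow> bool"
  for \<G> S where
  at_vertex: "v \<in> verts \<G> \<Longrightarrow> a \<in> carrier (vgrp \<G> v) \<Longrightarrow> gog_path \<G> S v v [Vert v a]"
| forward: "gog_path \<G> S v (src \<G> e) p \<Longrightarrow> e \<in> S \<Longrightarrow> a \<in> carrier (vgrp \<G> (tgt \<G> e)) \<Longrightarrow>
     gog_path \<G> S v (tgt \<G> e) (p @ [Edge e True, Vert (tgt \<G> e) a])"
| backward: "gog_path \<G> S v (tgt \<G> e) p \<Longrightarrow> e \<in> S \<Longrightarrow> a \<in> carrier (vgrp \<G> (src \<G> e)) \<Longrightarrow>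
     gog_path \<G> S v (src \<G> e) (p @ [Edge e False, Vert (src \<G> e) a])"

definition path_classes ::
    "('v, 'e, 'a) gog \<Rightarrow> 'e set \<Rightarrow> 'v \<Rightarrow> 'v \<Rightarrow> ('v, 'e, 'a) gog_letter list set set" where
  "path_classes \<G> S v w = {gog_class \<G> p | p. gog_path \<G> S v w p}"

definition fundamental_group ::
    "('v, 'e, 'a) gog \<Rightarrow> 'v \<Rightarrow> ('v, 'e, 'a) gog_letter list set monoid" where
  "fundamental_group \<G> v = (path_group \<G>)\<lparr>carrier := path_classes \<G> (edges \<G>) v v\<rparr>"

definition graph_of_groups :: "('v, 'e, 'a) gog \<Rightarrow> bool" where
  "graph_of_groups \<G> \<longleftrightarrow>
     finite (verts \<G>) \<and> verts \<G> \<noteq> {} \<and> finite (edges \<G>) \<and>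
     (\<forall>v\<in>verts \<G>. group (vgrp \<G> v)) \<and>
     (\<forall>e\<in>edges \<G>. src \<G> e \<in> verts \<G> \<and> tgt \<G> e \<in> verts \<G> \<and> group (egrp \<G> e) \<and>
        inj_src \<G> e \<in> hom (egrp \<G> e) (vgrp \<G> (src \<G> e)) \<and>
        inj_on (inj_src \<G> e) (carrier (egrp \<G> e)) \<and>
        inj_tgt \<G> e \<in> hom (egrp \<G> e) (vgrp \<G> (tgt \<G> e)) \<and>
        inj_on (inj_tgt \<G> e) (carrier (egrp \<G> e))) \<and>
     (\<forall>v\<in>verts \<G>. \<forall>w\<in>verts \<G>. path_classes \<G> (edges \<G>) v w \<noteq> {})"

text \<open>
  Let \<open>\<phi>\<close> be an isomorphism from the fundamental group of \<open>\<G>\<close> at \<open>v\<close> to \<open>G\<close>.  Collapsing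
  all edges but \<open>e\<close> leaves a graph of groups with the single edge \<open>e\<close>, whose vertex groups
  are the fundamental groups of the components of \<open>\<G>\<close> without \<open>e\<close>.  If these components are
  distinct (\<open>e\<close> separates) the result is an amalgam; otherwise it is an HNN extension, whose
  stable letter is \<open>e\<close> followed by a path \<open>q\<close> back to its origin that avoids \<open>e\<close>.  The
  groups are located in \<open>G\<close> by means of a path \<open>p\<close> from \<open>v\<close> to the origin of \<open>e\<close>; another
  choice of \<open>p\<close> conjugates all the data by one element of \<open>G\<close>.  Another choice of \<open>q\<close>
  multiplies \<open>t\<close> on the right by an element \<open>a\<close> of \<open>A\<close> and conjugates \<open>H\<^sub>1\<close> by \<open>a\<inverse>\<close>.
\<close>
definition edge_splitting ::
    "('v, 'e, 'a) gog \<Rightarrow> 'v \<Rightarrow> (('v, 'e, 'a) gog_letter list set \<Rightarrow> 'a) \<Rightarrow> 'e \<Rightarrow>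
     'a splitting \<Rightarrow> bool" where
  "edge_splitting \<G> v \<phi> e \<sigma> \<longleftrightarrow>
     (let F = path_group \<G>;
          S = edges \<G> - {e};
          x = src \<G> e;
          y = tgt \<G> e;
          \<e> = gog_class \<G> [Edge e True];
          E\<^sub>0 = {gog_class \<G> [Vert x (inj_src \<G> e h)] | h. h \<in> carrier (egrp \<G> e)};
          E\<^sub>1 = {gog_class \<G> [Vert y (inj_tgt \<G> e h)] | h. h \<in> carrier (egrp \<G> e)}
      in \<exists>p\<in>path_classes \<G> (edges \<G>) v x.
           if path_classes \<G> S y x = {}
           then \<sigma> = Amalgam (\<phi> ` conj_by F p ` path_classes \<G> S x x)
                            (\<phi> ` conj_by F (p \<otimes>\<^bsub>F\<^esub> \<e>) ` path_classes \<G> S y y)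
                            (\<phi> ` conj_by F p ` E\<^sub>0)
           else \<exists>q\<in>path_classes \<G> S y x.
                \<sigma> = HNN (\<phi> ` conj_by F p ` path_classes \<G> S x x)
                        (\<phi> ` conj_by F p ` E\<^sub>0)
                        (\<phi> ` conj_by F (p \<otimes>\<^bsub>F\<^esub> inv\<^bsub>F\<^esub> q) ` E\<^sub>1)
                        (\<phi> (conj_by F p (\<e> \<otimes>\<^bsub>F\<^esub> q))))"

end

theory Submission
  imports Defs
begin

text \<open>
  Write \<open>U \<preceq> V\<close> if \<open>U \<subseteq> V\<close>, or if \<open>U \<inter> V\<^sup>*\<close> is small and \<open>U\<^sup>* \<inter> V\<close> is not.  This makes the translates
  of the given sets and of their complements a nested partially ordered set with involution.
  Its intervals are finite: the finite generation of the subgroups \<open>H\<^sub>i\<close> bounds the small corners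
  uniformly, and only finitely many translates separate two given points of the Cayley graph.
  Such a set is the set of oriented edges of a tree, on which \<open>G\<close> acts; the vertices are the
  consistent orientations \<open>tau e\<close>.  Bass--Serre theory identifies \<open>G\<close> with the fundamental group
  of the quotient graph of groups: a path in it of minimal length lifts to a path without
  backtracking, along which edges decrease strictly, so that it does not close up.  Restricting to one
  orbit of edges collapses all other edges and gives the splittings.  The sets that these determine
  consist of the \<open>g\<close> for which the edge \<open>g X\<close> lies on a given side of \<open>X\<close>, and as the boundary of
  \<open>g X\<close> passes at bounded distance from \<open>g\<close>, such a set is almost equal to \<open>X\<close>.
\<close>

section \<open>Words and presentations\<close>

text \<open>Smallness alone gives a preorder: two sets may be coarsely equal without either
  containing the other, and then nothing would order them. The hypothesis on two small corners turns
  each class of coarsely equal sets into a chain; this makes the order antisymmetric without losing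
  nestedness.

  The tree is never built as a graph. A vertex is the set of the edges that point to it, the
  distance of two vertices is the cardinality of the difference of these sets, and crossing an edge
  changes a single member. Lifting paths and bringing elements into normal form are inductions on
  this number. Collapsing edges means intersecting the vertices with the edges that remain; so a
  path that avoids an edge does not change the trace of its vertex on the orbit of this edge, and
  the groups of a collapsed graph of groups are stabilizers of such traces.

  The sets that belong to a splitting are defined by normal forms. They are identified by ping-pong:
  a letter carries one side of an edge into the other side, so the first letter of a normal form
  decides on which side of the edge the element lies.\<close>

declare in_lists_conv_set [simp del]
declare in_listsD [rule del] in_listsI [rule del]
declare word_cong.trans [trans]

lemma word_cong_context: "word_cong R u v \<Longrightarrow> word_cong R (x @ u @ y) (x @ v @ y)"
proof (induction arbitrary: x y rule: word_cong.induct)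
  case (rel u v x' y')
  then show ?case using word_cong.rel[of u v R "x @ x'" "y' @ y"] by simp
next
  case (trans u v w)
  show ?case by (rule word_cong.trans[OF trans.IH])
qed (auto intro: word_cong.refl word_cong.sym)

lemma word_cong_append:
  assumes "word_cong R u u'" "word_cong R v v'"
  shows "word_cong R (u @ v) (u' @ v')"
  using word_cong.trans[OF word_cong_context[OF assms(1), of "[]" v]] word_cong_context[OF assms(2), of u' "[]"]
  by simp

lemma word_cong_concat_map:
  assumes "\<And>u v. (u, v) \<in> R \<Longrightarrow> word_cong R' (concat (map \<psi> u)) (concat (map \<psi> v))"
  shows "word_cong R u v \<Longrightarrow> word_cong R' (concat (map \<psi> u)) (concat (map \<psi> v))"
proof (induction rule: word_cong.induct)
  case (rel u v x y)
  then show ?case using word_cong_context[OF assms[OF rel]] by simp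
next
  case (trans u v w)
  show ?case by (rule word_cong.trans[OF trans.IH])
qed (auto intro: word_cong.refl word_cong.sym)

text \<open>\<open>word_cong\<close> is not restricted to words over \<open>L\<close>; by
  \<open>rel_lists\<close> a word congruent to a word over \<open>L\<close> is again one.
  \<open>letter_inverse\<close> turns the quotient monoid into a group; the inverse of a letter may
  be any word.\<close>

locale presentation = group G for G :: "'a monoid" (structure) +
  fixes L :: "'l set" and R :: "('l list \<times> 'l list) set" and f :: "'l \<Rightarrow> 'a"
  assumes letter_closed: "l \<in> L \<Longrightarrow> f l \<in> carrier G"
    and rel_lists: "(u, v) \<in> R \<Longrightarrow> u \<in> lists L \<and> v \<in> lists L"
    and rel_eval: "(u, v) \<in> R \<Longrightarrow> word_eval G f u = word_eval G f v"
    and letter_inverse: "l \<in> L \<Longrightarrow> \<exists>w\<in>lists L. word_cong R (l # w) [] \<and> word_cong R (w @ [l]) []"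
begin

lemma eval_closed: "w \<in> lists L \<Longrightarrow> word_eval G f w \<in> carrier G"
  by (induction w) (auto simp: word_eval_def letter_closed)

lemma eval_Nil: "word_eval G f [] = \<one>"
  by (simp add: word_eval_def)

lemma eval_Cons: "word_eval G f (l # w) = f l \<otimes> word_eval G f w"
  by (simp add: word_eval_def)

lemma eval_append:
  "u \<in> lists L \<Longrightarrow> v \<in> lists L \<Longrightarrow> word_eval G f (u @ v) = word_eval G f u \<otimes> word_eval G f v"
  by (induction u) (auto simp: eval_Nil eval_Cons letter_closed eval_closed m_assoc)

text \<open>The two claims go together: transitivity passes through arbitrary words, so invariance
  of the value has to know that the intermediate words stay over \<open>L\<close>.\<close>

lemma cong_lists_eval:
  "word_cong R u v \<Longrightarrow>
    (u \<in> lists L \<longleftrightarrow> v \<in> lists L) \<and> (u \<in> lists L \<longrightarrow> word_eval G f u = word_eval G f v)"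
proof (induction rule: word_cong.induct)
  case (rel u v x y)
  then show ?case using rel_lists[OF rel] rel_eval[OF rel] by (auto simp: eval_append)
qed auto

lemma word_inverse:
  "w \<in> lists L \<Longrightarrow> \<exists>w'\<in>lists L. word_cong R (w @ w') [] \<and> word_cong R (w' @ w) []"
proof (induction w)
  case Nil
  show ?case by (intro bexI[of _ "[]"]) (simp_all add: word_cong.refl)
next
  case (Cons l w)
  then obtain w' where w': "w' \<in> lists L" "word_cong R (w @ w') []" "word_cong R (w' @ w) []"
    by auto
  from Cons.prems obtain m where m: "m \<in> lists L" "word_cong R (l # m) []" "word_cong R (m @ [l]) []"
    using letter_inverse[of l] by auto
  have "word_cong R ((l # w) @ (w' @ m)) []"
    using word_cong.trans[OF word_cong_context[OF w'(2), of "[l]" m]] m(2) by simp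
  moreover have "word_cong R ((w' @ m) @ (l # w)) []"
    using word_cong.trans[OF word_cong_context[OF m(3), of w' w]] w'(3) by simp
  ultimately show ?case using w'(1) m(1) by (intro bexI[of _ "w' @ m"]) auto
qed

lemma mem_class: "u \<in> lists L \<Longrightarrow> u \<in> word_class L R u"
  by (auto simp: word_class_def word_cong.refl)

lemma class_eq_iff:
  "u \<in> lists L \<Longrightarrow> v \<in> lists L \<Longrightarrow> word_class L R u = word_class L R v \<longleftrightarrow> word_cong R u v"
proof
  assume "u \<in> lists L" "v \<in> lists L" "word_class L R u = word_class L R v"
  then show "word_cong R u v" using mem_class[of v] by (auto simp: word_class_def)
next
  assume "word_cong R u v"
  then show "word_class L R u = word_class L R v"
    using word_cong.trans[of R u v] word_cong.trans[OF word_cong.sym, of R u v]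
    by (auto simp: word_class_def)
qed

abbreviation P where "P \<equiv> presented_group L R"

lemma class_closed: "w \<in> lists L \<Longrightarrow> word_class L R w \<in> carrier P"
  by (simp add: presented_group_def)

lemma carrier_classE:
  assumes "C \<in> carrier P"
  obtains w where "w \<in> lists L" "C = word_class L R w"
  using assms by (auto simp: presented_group_def)

lemma class_mult:
  assumes "u \<in> lists L" "v \<in> lists L"
  shows "word_class L R u \<otimes>\<^bsub>P\<^esub> word_class L R v = word_class L R (u @ v)"
proof -
  have "word_class L R (u' @ v') = word_class L R (u @ v)"
    if "u' \<in> word_class L R u" "v' \<in> word_class L R v" for u' v'
    using that assms class_eq_iff[of "u' @ v'" "u @ v"]
    by (simp add: word_class_def word_cong_append word_cong.sym)
  then have "(\<Union>u'\<in>word_class L R u. \<Union>v'\<in>word_class L R v. word_class L R (u' @ v'))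
      = word_class L R (u @ v)"
    using mem_class assms by blast
  then show ?thesis by (simp add: presented_group_def)
qed

lemma class_one: "\<one>\<^bsub>P\<^esub> = word_class L R []"
  by (simp add: presented_group_def)

lemma presented_group_group: "group P"
proof (rule groupI)
  show "\<one>\<^bsub>P\<^esub> \<in> carrier P" by (simp add: class_one class_closed)
next
  fix x y assume "x \<in> carrier P" "y \<in> carrier P"
  then show "x \<otimes>\<^bsub>P\<^esub> y \<in> carrier P"
    by (auto elim!: carrier_classE simp: class_mult class_closed)
next
  fix x y z assume "x \<in> carrier P" "y \<in> carrier P" "z \<in> carrier P"
  then show "x \<otimes>\<^bsub>P\<^esub> y \<otimes>\<^bsub>P\<^esub> z = x \<otimes>\<^bsub>P\<^esub> (y \<otimes>\<^bsub>P\<^esub> z)"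
    by (auto elim!: carrier_classE simp: class_mult)
next
  fix x assume "x \<in> carrier P"
  then show "\<one>\<^bsub>P\<^esub> \<otimes>\<^bsub>P\<^esub> x = x"
    by (auto elim!: carrier_classE simp: class_mult class_one)
next
  fix x assume "x \<in> carrier P"
  then obtain w where w: "w \<in> lists L" "x = word_class L R w" by (rule carrier_classE)
  then obtain w' where "w' \<in> lists L" "word_cong R (w' @ w) []" using word_inverse by blast
  then show "\<exists>y\<in>carrier P. y \<otimes>\<^bsub>P\<^esub> x = \<one>\<^bsub>P\<^esub>"
    using w by (intro bexI[of _ "word_class L R w'"]) (simp_all add: class_mult class_one class_closed class_eq_iff)
qed

lemma induced_map_class:
  assumes "w \<in> lists L"
  shows "induced_map G f (word_class L R w) = word_eval G f w"
proof -
  have "word_eval G f v = word_eval G f w" if "v \<in> word_class L R w" for v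
    using that cong_lists_eval[of w v] assms by (simp add: word_class_def)
  then have "word_eval G f ` word_class L R w = {word_eval G f w}"
    using mem_class[OF assms] by blast
  then show ?thesis by (simp add: induced_map_def)
qed

lemma induced_map_hom: "induced_map G f \<in> hom P G"
  by (rule homI) (auto elim!: carrier_classE simp: induced_map_class eval_closed class_mult eval_append)

lemma induced_map_iso:
  assumes surj: "\<And>g. g \<in> carrier G \<Longrightarrow> \<exists>w\<in>lists L. word_eval G f w = g"
    and inj: "\<And>w. w \<in> lists L \<Longrightarrow> word_eval G f w = \<one> \<Longrightarrow> word_cong R w []"
  shows "induced_map G f \<in> iso P G"
proof -
  interpret P: group P by (rule presented_group_group)
  interpret group_hom P G "induced_map G f"
    using induced_map_hom by unfold_locales
  have "x = \<one>\<^bsub>P\<^esub>" if x: "x \<in> carrier P" "induced_map G f x = \<one>" for x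
  proof -
    obtain w where w: "w \<in> lists L" "x = word_class L R w" using x(1) by (rule carrier_classE)
    then have "word_cong R w []" using x(2) inj by (simp add: induced_map_class)
    then show ?thesis using w class_eq_iff[of w "[]"] by (simp add: class_one)
  qed
  then have "inj_on (induced_map G f) (carrier P)"
    by (intro inj_on_one_iff[THEN iffD2]) auto
  moreover have "induced_map G f ` carrier P = carrier G"
  proof
    show "carrier G \<subseteq> induced_map G f ` carrier P"
    proof
      fix g assume "g \<in> carrier G"
      from surj[OF this] obtain w where "w \<in> lists L" "word_eval G f w = g" by blast
      then show "g \<in> induced_map G f ` carrier P"
        using class_closed[of w] induced_map_class[of w] by (intro image_eqI[of _ _ "word_class L R w"]) simp_all
    qed
  qed auto
  ultimately show ?thesis using induced_map_hom by (auto simp: iso_def bij_betw_def)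
qed

end

lemma word_cong_group_rels_mult:
  assumes "group_rels c K \<subseteq> R" "a \<in> carrier K" "b \<in> carrier K"
  shows "word_cong R (x @ [c a, c b] @ y) (x @ [c (a \<otimes>\<^bsub>K\<^esub> b)] @ y)"
  using assms by (intro word_cong.rel) (auto simp: group_rels_def)

lemma word_cong_group_rels_one:
  assumes "group_rels c K \<subseteq> R"
  shows "word_cong R (x @ [c \<one>\<^bsub>K\<^esub>] @ y) (x @ y)"
  using assms word_cong.rel[of "[c \<one>\<^bsub>K\<^esub>]" "[]" R x y] by (auto simp: group_rels_def)

lemma group_rels_inverse:
  assumes "group K" "group_rels c K \<subseteq> R" "a \<in> carrier K"
  shows "word_cong R [c a, c (inv\<^bsub>K\<^esub> a)] []" "word_cong R [c (inv\<^bsub>K\<^esub> a), c a] []"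
proof -
  interpret K: group K by fact
  show "word_cong R [c a, c (inv\<^bsub>K\<^esub> a)] []"
    using word_cong.trans[OF word_cong_group_rels_mult[OF assms(2,3), of "inv\<^bsub>K\<^esub> a" "[]" "[]"]]
      word_cong_group_rels_one[OF assms(2), of "[]" "[]"] assms(3)
    by simp
  show "word_cong R [c (inv\<^bsub>K\<^esub> a), c a] []"
    using word_cong.trans[OF word_cong_group_rels_mult[OF assms(2) K.inv_closed[OF assms(3)] assms(3), of "[]" "[]"]]
      word_cong_group_rels_one[OF assms(2), of "[]" "[]"] assms(3)
    by simp
qed

section \<open>Nested posets with involution\<close>

text \<open>Dunwoody's description of the oriented edges of a tree. By \<open>nested\<close> and
  \<open>excl\<close> exactly one of the four comparisons holds unless \<open>e\<close> is
  \<open>f\<close> or \<open>st f\<close>; \<open>interval\<close> makes distances in the tree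
  finite.\<close>

locale treeset =
  fixes E :: "'e set" and le :: "'e \<Rightarrow> 'e \<Rightarrow> bool" (infix "\<preceq>" 50) and st :: "'e \<Rightarrow> 'e"
  assumes st_in: "e \<in> E \<Longrightarrow> st e \<in> E"
    and st_st: "e \<in> E \<Longrightarrow> st (st e) = e"
    and refl: "e \<in> E \<Longrightarrow> e \<preceq> e"
    and antisym: "\<lbrakk>e \<in> E; f \<in> E; e \<preceq> f; f \<preceq> e\<rbrakk> \<Longrightarrow> e = f"
    and trans: "\<lbrakk>e \<in> E; f \<in> E; g \<in> E; e \<preceq> f; f \<preceq> g\<rbrakk> \<Longrightarrow> e \<preceq> g"
    and st_mono: "\<lbrakk>e \<in> E; f \<in> E; e \<preceq> f\<rbrakk> \<Longrightarrow> st f \<preceq> st e"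
    and nested: "\<lbrakk>e \<in> E; f \<in> E\<rbrakk> \<Longrightarrow> e \<preceq> f \<or> e \<preceq> st f \<or> st e \<preceq> f \<or> st e \<preceq> st f"
    and excl: "\<lbrakk>e \<in> E; f \<in> E; e \<preceq> f\<rbrakk> \<Longrightarrow> \<not> e \<preceq> st f"
    and interval: "\<lbrakk>e \<in> E; g \<in> E\<rbrakk> \<Longrightarrow> finite {f \<in> E. e \<preceq> f \<and> f \<preceq> g}"
begin

lemma st_le_iff: "\<lbrakk>e \<in> E; f \<in> E\<rbrakk> \<Longrightarrow> st e \<preceq> st f \<longleftrightarrow> f \<preceq> e"
  using st_mono[of f e] st_mono[of "st e" "st f"] st_in st_st by auto

lemma st_le_swap: "\<lbrakk>e \<in> E; f \<in> E\<rbrakk> \<Longrightarrow> st e \<preceq> f \<longleftrightarrow> st f \<preceq> e"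
  using st_le_iff[of e "st f"] st_in st_st by auto

lemma le_st_swap: "\<lbrakk>e \<in> E; f \<in> E\<rbrakk> \<Longrightarrow> e \<preceq> st f \<longleftrightarrow> f \<preceq> st e"
  using st_le_iff[of "st e" f] st_in st_st by auto

lemma st_eq_iff: "\<lbrakk>e \<in> E; f \<in> E\<rbrakk> \<Longrightarrow> st e = st f \<longleftrightarrow> e = f"
  using st_st by metis

lemma not_le_st: "e \<in> E \<Longrightarrow> \<not> e \<preceq> st e" "e \<in> E \<Longrightarrow> \<not> st e \<preceq> e"
  using excl[of e e] excl[of "st e" "st e"] refl st_in st_st by auto

lemma st_neq: "e \<in> E \<Longrightarrow> st e \<noteq> e"
  using not_le_st refl by metis

text \<open>
  Elements are oriented edges of a tree, \<open>e \<preceq> f\<close> meaning that the half tree that \<open>e\<close> points to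
  lies in the one that \<open>f\<close> points to.  \<open>tau e\<close> is the terminal vertex of \<open>e\<close>, represented by the
  set of all edges that point towards it.
\<close>
definition tau :: "'e \<Rightarrow> 'e set" where
  "tau e = {f \<in> E. e \<preceq> f \<or> (st e \<preceq> f \<and> f \<noteq> st e)}"

lemma tau_sub: "tau e \<subseteq> E"
  by (auto simp: tau_def)

lemma tau_mem: "e \<in> E \<Longrightarrow> e \<in> tau e"
  by (simp add: tau_def refl)

text \<open>A vertex orients every edge once. Two memberships would contradict \<open>excl\<close>
  or antisymmetry; the clause \<open>f \<noteq> st e\<close> in \<open>tau\<close> settles the edge
  \<open>e\<close> itself.\<close>

lemma tau_xor:
  assumes "e \<in> E" "f \<in> E"
  shows "st f \<in> tau e \<longleftrightarrow> f \<notin> tau e"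
proof
  show "f \<notin> tau e" if "st f \<in> tau e"
  proof
    assume "f \<in> tau e"
    with that consider "e \<preceq> f" "e \<preceq> st f" | "e \<preceq> f" "st e \<preceq> st f" "st f \<noteq> st e"
      | "st e \<preceq> f" "f \<noteq> st e" "e \<preceq> st f" | "st e \<preceq> f" "st e \<preceq> st f"
      by (auto simp: tau_def)
    then show False
    proof cases
      case 1 then show ?thesis using excl assms by blast
    next
      case 2 then show ?thesis using antisym[of e f] assms by (auto simp: st_le_iff)
    next
      case 3
      then have "f \<preceq> st e" using le_st_swap assms by blast
      then show ?thesis using 3 antisym[of f "st e"] assms st_in by auto
    next
      case 4 then show ?thesis using excl[of "st e" f] assms st_in by blast
    qed
  qed
  show "st f \<in> tau e" if "f \<notin> tau e"
  proof -
    have "\<not> e \<preceq> f" "st e \<preceq> f \<Longrightarrow> f = st e" using that assms by (auto simp: tau_def)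
    then consider "e \<preceq> st f" | "f = st e" | "st e \<preceq> st f" "st f \<noteq> st e"
      using nested[OF assms] st_eq_iff[OF assms(2,1)] refl[of e] assms by blast
    then show ?thesis using assms st_in st_st refl by cases (auto simp: tau_def)
  qed
qed

lemma tau_up:
  assumes "e \<in> E" "f \<in> tau e" "g \<in> E" "f \<preceq> g"
  shows "g \<in> tau e"
proof -
  have f: "f \<in> E" using assms(2) tau_sub by blast
  from assms(2) consider "e \<preceq> f" | "st e \<preceq> f" "f \<noteq> st e" by (auto simp: tau_def)
  then show ?thesis
  proof cases
    case 1 then show ?thesis using trans[of e f g] f assms by (simp add: tau_def)
  next
    case 2
    then have "st e \<preceq> g" "g \<noteq> st e" using trans[of "st e" f g] antisym[of f "st e"] f assms st_in by auto
    then show ?thesis using assms by (simp add: tau_def)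
  qed
qed

lemma tau_min:
  assumes "e \<in> E" "f \<in> tau e" "f \<preceq> e"
  shows "f = e"
proof -
  have f: "f \<in> E" using assms(2) tau_sub by blast
  have "\<not> st e \<preceq> f" using trans[of "st e" f e] not_le_st[of e] f assms st_in by blast
  then show ?thesis using assms antisym f by (auto simp: tau_def)
qed

text \<open>Each of the two sets contains exactly one of every pair \<open>g\<close>,
  \<open>st g\<close>, so neither can be enlarged.\<close>

lemma tau_subset_eq:
  assumes "e \<in> E" "f \<in> E" "tau e \<subseteq> tau f"
  shows "tau e = tau f"
  using assms tau_xor tau_sub by blast

text \<open>A minimal element of an orientation is an edge that ends at this vertex. For
  \<open>g\<close> in \<open>tau e\<close>, \<open>f \<preceq> st g\<close> fails because
  \<open>tau e\<close> is closed upwards and does not contain \<open>st g\<close>, and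
  \<open>g \<preceq> f\<close> forces \<open>g = f\<close>; nestedness leaves the comparisons that
  define \<open>tau f\<close>.\<close>

lemma tau_eqI:
  assumes "e \<in> E" "f \<in> tau e" "\<And>g. g \<in> tau e \<Longrightarrow> g \<preceq> f \<Longrightarrow> g = f"
  shows "tau f = tau e"
proof -
  have f: "f \<in> E" using assms(2) tau_sub by blast
  have "g \<in> tau f" if g: "g \<in> tau e" for g
  proof -
    have gE: "g \<in> E" using g tau_sub by blast
    have "\<not> f \<preceq> st g" using tau_up[of e f "st g"] tau_xor[of e g] assms g gE st_in by blast
    moreover have "st f \<noteq> g" using tau_xor[of e f] assms f g by auto
    ultimately show ?thesis
      using nested[OF f gE] assms(3)[OF g] st_le_iff[OF f gE] gE refl by (auto simp: tau_def)
  qed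
  then show ?thesis using tau_subset_eq[of e f] assms f by auto
qed

lemma tau_st: "e \<in> E \<Longrightarrow> tau (st e) = insert (st e) (tau e - {e})"
  using st_neq refl st_in st_st not_le_st by (auto simp: tau_def)

text \<open>Two edges entering the same vertex point at each other. So a path that enters a vertex
  along \<open>e\<close> and leaves it along \<open>st f\<close> without backtracking has shrinking
  half trees: \<open>st f \<preceq> e\<close>, and the two differ.\<close>

lemma tau_min_pair:
  assumes "e \<in> E" "f \<in> E" "tau e = tau f" "e \<noteq> f"
  shows "st e \<preceq> f" "st e \<noteq> f"
proof -
  have "f \<in> tau e" using tau_mem assms by simp
  moreover have "\<not> e \<preceq> f" using tau_min[of f e] tau_mem[of e] assms by auto
  ultimately show "st e \<preceq> f" "st e \<noteq> f" by (auto simp: tau_def)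
qed

text \<open>An edge that points to the first vertex and away from the second lies in one of four
  intervals. The cardinality of this difference is the distance of the two vertices, the induction
  measure of all that follows.\<close>

lemma finite_tau_diff:
  assumes "e \<in> E" "f \<in> E"
  shows "finite (tau e - tau f)"
proof -
  let ?I = "\<lambda>a b. {g \<in> E. a \<preceq> g \<and> g \<preceq> b}"
  have "tau e - tau f \<subseteq> ?I e (st f) \<union> ?I e f \<union> ?I (st e) (st f) \<union> ?I (st e) f"
  proof
    fix g assume g: "g \<in> tau e - tau f"
    then have gE: "g \<in> E" using tau_sub by blast
    with g have "st g \<in> tau f" using tau_xor[of f g] assms by blast
    then have "f \<preceq> st g \<or> st f \<preceq> st g" by (auto simp: tau_def)
    then have "g \<preceq> st f \<or> g \<preceq> f" using le_st_swap[OF assms(2) gE] st_le_iff[OF assms(2) gE] by blast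
    then show "g \<in> ?I e (st f) \<union> ?I e f \<union> ?I (st e) (st f) \<union> ?I (st e) f"
      using g gE by (auto simp: tau_def)
  qed
  then show ?thesis using interval assms st_in by (meson finite_UnI finite_subset)
qed

text \<open>\<open>g\<close> is the reverse of the first edge on the way from \<open>tau e\<close>
  to \<open>tau f\<close>. A minimal element of the finite difference is minimal in all of
  \<open>tau e\<close>, because \<open>tau f\<close> is closed upwards; hence it ends at
  \<open>tau e\<close>.\<close>

lemma tau_diff_min:
  assumes "e \<in> E" "f \<in> E" "tau e \<noteq> tau f"
  obtains g where "g \<in> tau e" "g \<notin> tau f" "tau g = tau e"
proof -
  let ?D = "tau e - tau f"
  have "?D \<noteq> {}" using assms tau_subset_eq by blast
  moreover have "asymp_on ?D (\<lambda>x y. x \<preceq> y \<and> x \<noteq> y)"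
    using antisym tau_sub by (unfold asymp_on_def) blast
  moreover have "transp_on ?D (\<lambda>x y. x \<preceq> y \<and> x \<noteq> y)"
    using trans antisym tau_sub by (unfold transp_on_def) blast
  ultimately obtain g where g: "g \<in> ?D" "\<forall>h\<in>?D. h \<noteq> g \<longrightarrow> \<not> (h \<preceq> g \<and> h \<noteq> g)"
    using Finite_Set.bex_min_element[OF finite_tau_diff[OF assms(1,2)], of "\<lambda>x y. x \<preceq> y \<and> x \<noteq> y"] by blast
  have "h = g" if "h \<in> tau e" "h \<preceq> g" for h
    using g that tau_up[of f h g] assms(2) tau_sub[of e] by blast
  then have "tau g = tau e" using tau_eqI[of e g] g assms by blast
  with g that show thesis by blast
qed

text \<open>Passing to the other end of \<open>g\<close> is one step towards \<open>tau f\<close>: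
  of the edges in the difference only \<open>g\<close> itself is turned round.\<close>

lemma card_tau_flip:
  assumes "g \<in> E" "f \<in> E" "g \<notin> tau f"
  shows "Suc (card (tau (st g) - tau f)) = card (tau g - tau f)"
proof -
  have "st g \<in> tau f" using assms tau_xor by blast
  then have "tau (st g) - tau f = (tau g - tau f) - {g}" using tau_st assms by auto
  then show ?thesis using card_Suc_Diff1[of "tau g - tau f" g] finite_tau_diff assms tau_mem by auto
qed

lemma subset_treeset:
  assumes "F \<subseteq> E" "\<And>e. e \<in> F \<Longrightarrow> st e \<in> F"
  shows "treeset F le st"
proof
  show "finite {f \<in> F. e \<preceq> f \<and> f \<preceq> g}" if "e \<in> F" "g \<in> F" for e g
    using that assms(1) by (intro finite_subset[OF _ interval[of e g]]) auto
  show "e \<preceq> f \<or> e \<preceq> st f \<or> st e \<preceq> f \<or> st e \<preceq> st f" if "e \<in> F" "f \<in> F" for e f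
    using nested that assms(1) by blast
  show "\<not> e \<preceq> st f" if "e \<in> F" "f \<in> F" "e \<preceq> f" for e f
    using excl that assms(1) by blast
  show "e \<preceq> g" if "e \<in> F" "f \<in> F" "g \<in> F" "e \<preceq> f" "f \<preceq> g" for e f g
    using trans[of e f g] that assms(1) by blast
  show "e = f" if "e \<in> F" "f \<in> F" "e \<preceq> f" "f \<preceq> e" for e f
    using antisym[of e f] that assms(1) by blast
qed (use assms st_st refl st_mono in \<open>simp_all add: subset_iff\<close>)

end

section \<open>Group actions on trees without inversions\<close>

locale tree_action = group G + treeset E le st
  for G :: "'a monoid" (structure) and E :: "'e set" and le (infix "\<preceq>" 50) and st +
  fixes act :: "'a \<Rightarrow> 'e \<Rightarrow> 'e"
  assumes act_in: "\<lbrakk>g \<in> carrier G; e \<in> E\<rbrakk> \<Longrightarrow> act g e \<in> E"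
    and act_one: "e \<in> E \<Longrightarrow> act \<one> e = e"
    and act_mult: "\<lbrakk>g \<in> carrier G; h \<in> carrier G; e \<in> E\<rbrakk> \<Longrightarrow> act (g \<otimes> h) e = act g (act h e)"
    and act_le: "\<lbrakk>g \<in> carrier G; e \<in> E; f \<in> E; e \<preceq> f\<rbrakk> \<Longrightarrow> act g e \<preceq> act g f"
    and act_st: "\<lbrakk>g \<in> carrier G; e \<in> E\<rbrakk> \<Longrightarrow> act g (st e) = st (act g e)"
    and no_inversion: "\<lbrakk>g \<in> carrier G; e \<in> E\<rbrakk> \<Longrightarrow> act g e \<noteq> st e"
begin

lemma act_inv: "\<lbrakk>g \<in> carrier G; e \<in> E\<rbrakk> \<Longrightarrow> act (inv g) (act g e) = e"
  "\<lbrakk>g \<in> carrier G; e \<in> E\<rbrakk> \<Longrightarrow> act g (act (inv g) e) = e"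
  using act_mult[of "inv g" g e] act_mult[of g "inv g" e] act_one by auto

lemma act_le_iff: "\<lbrakk>g \<in> carrier G; e \<in> E; f \<in> E\<rbrakk> \<Longrightarrow> act g e \<preceq> act g f \<longleftrightarrow> e \<preceq> f"
  using act_le[of g e f] act_le[of "inv g" "act g e" "act g f"] act_in act_inv by auto

lemma act_eq_iff: "\<lbrakk>g \<in> carrier G; e \<in> E; f \<in> E\<rbrakk> \<Longrightarrow> act g e = act g f \<longleftrightarrow> e = f"
  using act_inv by metis

lemma act_eq_move: "\<lbrakk>g \<in> carrier G; e \<in> E; f \<in> E\<rbrakk> \<Longrightarrow> act g e = f \<longleftrightarrow> e = act (inv g) f"
  using act_inv by metis

definition vact :: "'a \<Rightarrow> 'e set \<Rightarrow> 'e set" where "vact g v = act g ` v"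

lemma vact_mult: "\<lbrakk>g \<in> carrier G; h \<in> carrier G; v \<subseteq> E\<rbrakk> \<Longrightarrow> vact (g \<otimes> h) v = vact g (vact h v)"
  unfolding vact_def image_image using act_mult by (intro image_cong) auto

lemma vact_one: "v \<subseteq> E \<Longrightarrow> vact \<one> v = v"
  unfolding vact_def using act_one by (force simp: image_iff)

lemma vact_sub: "\<lbrakk>g \<in> carrier G; v \<subseteq> E\<rbrakk> \<Longrightarrow> vact g v \<subseteq> E"
  unfolding vact_def using act_in by auto

lemma vact_inv: "\<lbrakk>g \<in> carrier G; v \<subseteq> E\<rbrakk> \<Longrightarrow> vact (inv g) (vact g v) = v"
  "\<lbrakk>g \<in> carrier G; v \<subseteq> E\<rbrakk> \<Longrightarrow> vact g (vact (inv g) v) = v"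
  using vact_mult[of "inv g" g v] vact_mult[of g "inv g" v] vact_one by auto

lemma vact_eq_move: "\<lbrakk>g \<in> carrier G; v \<subseteq> E; w \<subseteq> E\<rbrakk> \<Longrightarrow> vact g v = w \<longleftrightarrow> v = vact (inv g) w"
  using vact_inv by metis

lemma mem_vact: "\<lbrakk>g \<in> carrier G; v \<subseteq> E; e \<in> E\<rbrakk> \<Longrightarrow> e \<in> vact g v \<longleftrightarrow> act (inv g) e \<in> v"
  unfolding vact_def using act_inv by (force simp: image_iff)

lemma act_mem_vact: "\<lbrakk>g \<in> carrier G; v \<subseteq> E; e \<in> E\<rbrakk> \<Longrightarrow> act g e \<in> vact g v \<longleftrightarrow> e \<in> v"
  using mem_vact[of g v "act g e"] act_in act_inv by simp

lemma vact_diff: "\<lbrakk>g \<in> carrier G; v \<subseteq> E; w \<subseteq> E\<rbrakk> \<Longrightarrow> vact g (v - w) = vact g v - vact g w"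
  unfolding vact_def by (rule inj_on_image_set_diff[of _ E]) (auto simp: inj_on_def act_eq_iff)

lemma vact_Int: "\<lbrakk>g \<in> carrier G; v \<subseteq> E; w \<subseteq> E\<rbrakk> \<Longrightarrow> vact g (v \<inter> w) = vact g v \<inter> vact g w"
  unfolding vact_def by (rule inj_on_image_Int[of _ E]) (auto simp: inj_on_def act_eq_iff)

lemma card_vact: "\<lbrakk>g \<in> carrier G; v \<subseteq> E\<rbrakk> \<Longrightarrow> card (vact g v) = card v"
  unfolding vact_def by (rule card_image) (auto simp: inj_on_def act_eq_iff subset_iff)

lemma vact_tau:
  assumes "g \<in> carrier G" "e \<in> E"
  shows "vact g (tau e) = tau (act g e)"
proof -
  have "f \<in> vact g (tau e) \<longleftrightarrow> f \<in> tau (act g e)" if f: "f \<in> E" for f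
  proof -
    have i: "inv g \<in> carrier G" "act (inv g) f \<in> E" using assms f act_in by auto
    have "e \<preceq> act (inv g) f \<longleftrightarrow> act g e \<preceq> f" "st e \<preceq> act (inv g) f \<longleftrightarrow> st (act g e) \<preceq> f"
      "act (inv g) f = st e \<longleftrightarrow> f = st (act g e)"
      using act_le_iff[OF assms(1) assms(2) i(2)] act_le_iff[OF assms(1) st_in[OF assms(2)] i(2)]
        act_inv(2)[OF assms(1) f] act_st[OF assms] act_inv(1)[OF assms(1) st_in[OF assms(2)]]
      by auto
    then show ?thesis using mem_vact[OF assms(1) tau_sub f] f i by (simp add: tau_def)
  qed
  then show ?thesis using vact_sub[OF assms(1) tau_sub] tau_sub by blast
qed

definition estab :: "'e \<Rightarrow> 'a set" where "estab e = {g \<in> carrier G. act g e = e}"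

definition vstab :: "'e set \<Rightarrow> 'a set" where "vstab v = {g \<in> carrier G. vact g v = v}"

lemma estab_subgroup: "e \<in> E \<Longrightarrow> subgroup (estab e) G"
  by (rule subgroupI) (auto simp: estab_def act_one act_mult act_eq_move dest: sym intro!: exI[of _ \<one>])

lemma vstab_subgroup: "v \<subseteq> E \<Longrightarrow> subgroup (vstab v) G"
  by (rule subgroupI) (auto simp: vstab_def vact_one vact_mult vact_eq_move dest: sym intro!: exI[of _ \<one>])

lemma estab_sub_vstab: "e \<in> E \<Longrightarrow> estab e \<subseteq> vstab (tau e)"
  by (auto simp: estab_def vstab_def vact_tau)

lemma estab_st: "e \<in> E \<Longrightarrow> estab (st e) = estab e"
  by (auto simp: estab_def act_st st_eq_iff act_in)

lemma mem_estab_act: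
  assumes "g \<in> carrier G" "e \<in> E" "h \<in> carrier G"
  shows "h \<in> estab (act g e) \<longleftrightarrow> inv g \<otimes> h \<otimes> g \<in> estab e"
  using assms act_mult[of "inv g \<otimes> h" g e] act_mult[of "inv g" h "act g e"] act_in
    act_eq_move[of "inv g" "act h (act g e)" e]
  by (auto simp: estab_def)

lemma mem_vstab_vact:
  assumes "g \<in> carrier G" "v \<subseteq> E" "h \<in> carrier G"
  shows "h \<in> vstab (vact g v) \<longleftrightarrow> inv g \<otimes> h \<otimes> g \<in> vstab v"
  using assms vact_mult[of "inv g \<otimes> h" g v] vact_mult[of "inv g" h "vact g v"] vact_sub[of g v]
    vact_sub[of h "vact g v"] vact_eq_move[of "inv g" "vact h (vact g v)" v]
  by (auto simp: vstab_def)

lemma subset_action: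
  assumes "F \<subseteq> E" "\<And>e. e \<in> F \<Longrightarrow> st e \<in> F" "\<And>g e. g \<in> carrier G \<Longrightarrow> e \<in> F \<Longrightarrow> act g e \<in> F"
  shows "tree_action G F le st act"
proof -
  interpret F: treeset F le st using subset_treeset assms by blast
  show ?thesis
    by unfold_locales (use assms act_one act_mult act_le act_st no_inversion in \<open>simp_all add: subset_iff\<close>)
qed

end

section \<open>Groups acting on trees as fundamental groups of graphs of groups\<close>

text \<open>
  \<open>rep v\<close> and \<open>ed i\<close> are chosen representatives of the orbits of vertices and of (unoriented)
  edges.  The edge \<open>ed i\<close> runs from \<open>rep (s0 i)\<close> to the translate of \<open>rep (s1 i)\<close> by \<open>t i\<close>.
\<close>
locale tree_quotient = tree_action G E le st act
  for G :: "'a monoid" (structure) and E :: "'e set" and le (infix "\<preceq>" 50) and st and act +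
  fixes V :: "nat set" and rep :: "nat \<Rightarrow> 'e set" and I :: "nat set" and ed :: "nat \<Rightarrow> 'e"
    and s0 s1 :: "nat \<Rightarrow> nat" and t :: "nat \<Rightarrow> 'a"
  assumes finite_V: "finite V" and V_nonempty: "V \<noteq> {}" and finite_I: "finite I"
    and rep_vertex: "v \<in> V \<Longrightarrow> rep v \<in> tau ` E"
    and rep_unique: "\<lbrakk>v \<in> V; w \<in> V; g \<in> carrier G; rep v = vact g (rep w)\<rbrakk> \<Longrightarrow> v = w"
    and ed_in: "i \<in> I \<Longrightarrow> ed i \<in> E"
    and s_in: "i \<in> I \<Longrightarrow> s0 i \<in> V \<and> s1 i \<in> V"
    and t_in: "i \<in> I \<Longrightarrow> t i \<in> carrier G"
    and ed_source: "i \<in> I \<Longrightarrow> tau (st (ed i)) = rep (s0 i)"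
    and ed_target: "i \<in> I \<Longrightarrow> tau (ed i) = vact (t i) (rep (s1 i))"
    and ed_exists: "e \<in> E \<Longrightarrow> \<exists>i\<in>I. \<exists>g\<in>carrier G. e = act g (ed i) \<or> e = act g (st (ed i))"
    and ed_unique: "\<lbrakk>i \<in> I; j \<in> I; g \<in> carrier G; act g (ed i) = ed j \<or> act g (ed i) = st (ed j)\<rbrakk> \<Longrightarrow> i = j"
begin

text \<open>The edge \<open>ed i\<close> starts exactly at \<open>rep (s0 i)\<close>, so its
  stabilizer is included there as it is. It ends at the translate of \<open>rep (s1 i)\<close> by
  \<open>t i\<close>, so at the target the inclusion has to be conjugated back.\<close>

definition gg :: "(nat, nat, 'a) gog" where
  "gg = \<lparr>verts = V, edges = I, src = s0, tgt = s1,
     vgrp = (\<lambda>v. G\<lparr>carrier := vstab (rep v)\<rparr>), egrp = (\<lambda>i. G\<lparr>carrier := estab (ed i)\<rparr>),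
     inj_src = (\<lambda>i h. h), inj_tgt = (\<lambda>i h. inv (t i) \<otimes> h \<otimes> t i)\<rparr>"

definition val :: "(nat, nat, 'a) gog_letter \<Rightarrow> 'a" where
  "val l = (case l of Vert v a \<Rightarrow> a | Edge i b \<Rightarrow> if b then t i else inv (t i))"

lemma val_simps [simp]: "val (Vert v a) = a" "val (Edge i b) = (if b then t i else inv (t i))"
  by (simp_all add: val_def)

definition sv :: "nat \<Rightarrow> bool \<Rightarrow> nat" where "sv i b = (if b then s0 i else s1 i)"

text \<open>The edge that is traversed by the letter \<open>Edge i b\<close>, starting at \<open>rep (sv i b)\<close>.\<close>
definition D :: "nat \<Rightarrow> bool \<Rightarrow> 'e" where
  "D i b = (if b then ed i else act (inv (t i)) (st (ed i)))"

abbreviation L where "L \<equiv> gog_letters gg"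
abbreviation R where "R \<equiv> gog_rels gg"
abbreviation W where "W \<equiv> word_eval G val"

lemma rep_sub: "v \<in> V \<Longrightarrow> rep v \<subseteq> E"
  using rep_vertex tau_sub by blast

lemma sv_in: "i \<in> I \<Longrightarrow> sv i b \<in> V"
  by (simp add: sv_def s_in)

lemma val_Edge_in: "i \<in> I \<Longrightarrow> val (Edge i b) \<in> carrier G"
  by (simp add: t_in)

lemma D_in: "i \<in> I \<Longrightarrow> D i b \<in> E"
  by (simp add: D_def ed_in st_in act_in t_in)

lemma tau_st_D: "i \<in> I \<Longrightarrow> tau (st (D i b)) = rep (sv i b)"
  by (simp add: D_def sv_def ed_source ed_in st_in act_st[symmetric] t_in st_st
      vact_tau[symmetric] ed_target vact_inv rep_sub s_in)

lemma tau_D: "i \<in> I \<Longrightarrow> tau (D i b) = vact (val (Edge i b)) (rep (sv i (\<not> b)))"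
  by (simp add: D_def sv_def ed_source ed_in st_in act_st[symmetric] t_in st_st
      vact_tau[symmetric] ed_target vact_inv rep_sub s_in)

lemma D_reverse: "i \<in> I \<Longrightarrow> D i (\<not> b) = act (inv (val (Edge i b))) (st (D i b))"
  by (simp add: D_def ed_in st_in act_st[symmetric] t_in st_st act_inv act_in)

lemma gg_simps [simp]: "verts gg = V" "edges gg = I" "src gg = s0" "tgt gg = s1"
  "vgrp gg v = G\<lparr>carrier := vstab (rep v)\<rparr>" "egrp gg i = G\<lparr>carrier := estab (ed i)\<rparr>"
  "inj_src gg i h = h" "inj_tgt gg i h = inv (t i) \<otimes> h \<otimes> t i"
  by (simp_all add: gg_def)

lemma Vert_in_L: "Vert v a \<in> L \<longleftrightarrow> v \<in> V \<and> a \<in> vstab (rep v)"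
  by (auto simp: gog_letters_def)

lemma Edge_in_L: "Edge i b \<in> L \<longleftrightarrow> i \<in> I"
  by (auto simp: gog_letters_def)

lemma vstab_closed: "a \<in> vstab v \<Longrightarrow> a \<in> carrier G"
  by (simp add: vstab_def)

lemma estab_closed: "a \<in> estab e \<Longrightarrow> a \<in> carrier G"
  by (simp add: estab_def)

lemma rep_subgroup: "v \<in> V \<Longrightarrow> subgroup (vstab (rep v)) G"
  using vstab_subgroup rep_sub by blast

lemma estab_source:
  assumes "i \<in> I" "h \<in> estab (ed i)"
  shows "h \<in> vstab (rep (s0 i))"
  using estab_sub_vstab[of "st (ed i)"] estab_st assms ed_in st_in ed_source by auto

lemma estab_target:
  assumes "i \<in> I" "h \<in> estab (ed i)"
  shows "inv (t i) \<otimes> h \<otimes> t i \<in> vstab (rep (s1 i))"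
  using estab_sub_vstab[of "ed i"] assms ed_in ed_target[of i] estab_closed t_in rep_sub s_in
    mem_vstab_vact[of "t i" "rep (s1 i)" h] by auto

lemma gog_relsE:
  assumes "(x, y) \<in> R"
  obtains
    (mult) v a b where "v \<in> V" "a \<in> vstab (rep v)" "b \<in> vstab (rep v)"
      "x = [Vert v a, Vert v b]" "y = [Vert v (a \<otimes> b)]"
  | (one) v where "v \<in> V" "x = [Vert v \<one>]" "y = []"
  | (edge) i b where "i \<in> I" "x = [Edge i b, Edge i (\<not> b)]" "y = []"
  | (conj) i h where "i \<in> I" "h \<in> estab (ed i)" "x = [Edge i False, Vert (s0 i) h, Edge i True]"
      "y = [Vert (s1 i) (inv (t i) \<otimes> h \<otimes> t i)]"
  using assms by (auto simp: gog_rels_def group_rels_def)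

lemma conj_rel:
  assumes "i \<in> I" "h \<in> estab (ed i)"
  shows "([Edge i False, Vert (s0 i) h, Edge i True], [Vert (s1 i) (inv (t i) \<otimes> h \<otimes> t i)]) \<in> R"
  unfolding gog_rels_def using assms by auto

lemma Vert_rels: "v \<in> V \<Longrightarrow> group_rels (Vert v) (G\<lparr>carrier := vstab (rep v)\<rparr>) \<subseteq> R"
  unfolding gog_rels_def by auto

lemma Vert_mult_cong:
  assumes "v \<in> V" "a \<in> vstab (rep v)" "b \<in> vstab (rep v)"
  shows "word_cong R (x @ [Vert v a, Vert v b] @ y) (x @ [Vert v (a \<otimes> b)] @ y)"
  using word_cong_group_rels_mult[OF Vert_rels[OF assms(1)]] assms by simp

lemma Vert_one_cong:
  assumes "v \<in> V"
  shows "word_cong R (x @ [Vert v \<one>] @ y) (x @ y)"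
  using word_cong_group_rels_one[OF Vert_rels[OF assms(1)]] assms by simp

lemma Edge_cong:
  assumes "i \<in> I"
  shows "word_cong R (x @ [Edge i b, Edge i (\<not> b)] @ y) (x @ y)"
proof -
  have "([Edge i b, Edge i (\<not> b)], []) \<in> R" unfolding gog_rels_def using assms by auto
  from word_cong.rel[OF this] show ?thesis by simp
qed

sublocale pres: presentation G L R val
proof
  fix l assume "l \<in> L"
  then show "val l \<in> carrier G" by (cases l) (auto simp: Vert_in_L Edge_in_L vstab_closed t_in)
next
  fix x y assume "(x, y) \<in> R"
  then show "x \<in> lists L \<and> y \<in> lists L"
  proof (cases rule: gog_relsE)
    case (mult v a b)
    then show ?thesis using subgroup.m_closed[OF rep_subgroup] by (simp add: Vert_in_L)
  next
    case (one v)
    then show ?thesis using subgroup.one_closed[OF rep_subgroup] by (simp add: Vert_in_L)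
  next
    case (conj i h)
    then show ?thesis by (simp add: Vert_in_L Edge_in_L s_in estab_source estab_target)
  qed (simp add: Edge_in_L)
next
  fix x y assume "(x, y) \<in> R"
  then show "W x = W y"
  proof (cases rule: gog_relsE)
    case (conj i h)
    then show ?thesis using estab_closed t_in by (simp add: word_eval_def m_assoc)
  qed (use vstab_closed t_in in \<open>auto simp: word_eval_def\<close>)
next
  fix l assume l: "l \<in> L"
  show "\<exists>w\<in>lists L. word_cong R (l # w) [] \<and> word_cong R (w @ [l]) []"
  proof (cases l)
    case (Vert v a)
    then have v: "v \<in> V" "a \<in> vstab (rep v)" using l Vert_in_L by auto
    interpret S: subgroup "vstab (rep v)" G using rep_subgroup v by blast
    have *: "inv\<^bsub>G\<lparr>carrier := vstab (rep v)\<rparr>\<^esub> a = inv a"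
      using m_inv_consistent[OF rep_subgroup] v by auto
    show ?thesis
      using group_rels_inverse[OF subgroup_imp_group[OF rep_subgroup[OF v(1)]] Vert_rels[OF v(1)], of a]
        v * S.m_inv_closed[OF v(2)]
      by (intro bexI[of _ "[Vert v (inv a)]"]) (simp_all add: Vert Vert_in_L)
  next
    case (Edge i b)
    then have i: "i \<in> I" using l Edge_in_L by auto
    show ?thesis
      using Edge_cong[OF i, of "[]" b "[]"] Edge_cong[OF i, of "[]" "\<not> b" "[]"] i
      by (intro bexI[of _ "[Edge i (\<not> b)]"]) (simp_all add: Edge Edge_in_L)
  qed
qed

text \<open>Crossing an edge, applying an element that fixes it and coming back amounts to a vertex
  element. For \<open>b\<close> false this is a defining relation; for \<open>b\<close> true it
  follows by cancelling edge letters around that relation.\<close>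

lemma estab_D_end:
  assumes "i \<in> I" "a \<in> estab (D i (\<not> b))"
  shows "val (Edge i b) \<otimes> a \<otimes> inv (val (Edge i b)) \<in> vstab (rep (sv i b))"
    "word_cong R [Edge i b, Vert (sv i (\<not> b)) a, Edge i (\<not> b)]
       [Vert (sv i b) (val (Edge i b) \<otimes> a \<otimes> inv (val (Edge i b)))]"
proof -
  have "val (Edge i b) \<otimes> a \<otimes> inv (val (Edge i b)) \<in> vstab (rep (sv i b)) \<and>
    word_cong R [Edge i b, Vert (sv i (\<not> b)) a, Edge i (\<not> b)]
       [Vert (sv i b) (val (Edge i b) \<otimes> a \<otimes> inv (val (Edge i b)))]"
  proof (cases b)
    case False
    have a: "a \<in> estab (ed i)" using assms False by (simp add: D_def)
    from word_cong.rel[OF conj_rel[OF assms(1) a], of "[]" "[]"] show ?thesis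
      using False estab_target[OF assms(1) a] t_in assms by (simp add: sv_def)
  next
    case True
    have ac: "a \<in> carrier G" using assms estab_closed by blast
    define h where "h = t i \<otimes> a \<otimes> inv (t i)"
    have ti: "t i \<in> carrier G" using t_in assms by auto
    have h: "h \<in> estab (ed i)"
      using assms True mem_estab_act[of "inv (t i)" "st (ed i)" a] ti ed_in[OF assms(1)] ac
      by (simp add: D_def h_def st_in estab_st)
    have ah: "a = inv (t i) \<otimes> h \<otimes> t i"
      using ac ti by (simp add: h_def m_assoc inv_solve_left)
    from word_cong.sym[OF word_cong.rel[OF conj_rel[OF assms(1) h], of "[Edge i True]" "[Edge i False]"]]
    have "word_cong R [Edge i True, Vert (s1 i) a, Edge i False]
      [Edge i True, Edge i False, Vert (s0 i) h, Edge i True, Edge i False]"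
      by (simp add: ah)
    also have "word_cong R [Edge i True, Edge i False, Vert (s0 i) h, Edge i True, Edge i False]
       [Vert (s0 i) h, Edge i True, Edge i False]"
      using Edge_cong[OF assms(1), of "[]" True] by simp
    also have "word_cong R [Vert (s0 i) h, Edge i True, Edge i False] [Vert (s0 i) h]"
      using Edge_cong[OF assms(1), of "[Vert (s0 i) h]" True "[]"] by simp
    finally show ?thesis using True estab_source[OF assms(1) h] by (simp add: sv_def h_def)
  qed
  then show "val (Edge i b) \<otimes> a \<otimes> inv (val (Edge i b)) \<in> vstab (rep (sv i b))"
    "word_cong R [Edge i b, Vert (sv i (\<not> b)) a, Edge i (\<not> b)]
       [Vert (sv i b) (val (Edge i b) \<otimes> a \<otimes> inv (val (Edge i b)))]"
    by blast+
qed

section \<open>Paths in the graph of groups and their lifts to the tree\<close>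

abbreviation path where "path \<equiv> gog_path gg"

lemma path_step:
  assumes "path S v (sv i b) p" "i \<in> S" "a \<in> vstab (rep (sv i (\<not> b)))"
  shows "path S v (sv i (\<not> b)) (p @ [Edge i b, Vert (sv i (\<not> b)) a])"
  using assms gog_path.forward[of gg S v i p a] gog_path.backward[of gg S v i p a]
  by (cases b) (auto simp: sv_def)

lemma path_induct [consumes 1, case_names base step]:
  assumes "path S v w p"
    and "\<And>v a. \<lbrakk>v \<in> V; a \<in> vstab (rep v)\<rbrakk> \<Longrightarrow> Q v v [Vert v a]"
    and "\<And>v p i b a. \<lbrakk>path S v (sv i b) p; Q v (sv i b) p; i \<in> S; a \<in> vstab (rep (sv i (\<not> b)))\<rbrakk>
      \<Longrightarrow> Q v (sv i (\<not> b)) (p @ [Edge i b, Vert (sv i (\<not> b)) a])"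
  shows "Q v w p"
  using assms(1)
proof (induction rule: gog_path.induct)
  case (at_vertex v a)
  then show ?case using assms(2) by simp
next
  case (forward v e p a)
  then show ?case using assms(3)[of v e True p a] by (simp add: sv_def)
next
  case (backward v e p a)
  then show ?case using assms(3)[of v e False p a] by (simp add: sv_def)
qed

context
  fixes S assumes S: "S \<subseteq> I"
begin

lemma path_lists: "path S v w p \<Longrightarrow> v \<in> V \<and> w \<in> V \<and> p \<in> lists L"
  by (induction rule: path_induct) (use S in \<open>auto simp: Vert_in_L Edge_in_L sv_in subset_iff\<close>)

lemma path_W_closed: "path S v w p \<Longrightarrow> W p \<in> carrier G"
  using path_lists pres.eval_closed by blast

lemma W_step:
  assumes "path S v (sv i b) p" "i \<in> S" "a \<in> vstab (rep (sv i (\<not> b)))"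
  shows "W (p @ [Edge i b, Vert (sv i (\<not> b)) a]) = W p \<otimes> val (Edge i b) \<otimes> a"
proof -
  have i: "i \<in> I" using assms(2) S by blast
  have "[Edge i b, Vert (sv i (\<not> b)) a] \<in> lists L" using i assms(3) by (simp add: Vert_in_L Edge_in_L sv_in)
  moreover have "W [Edge i b, Vert (sv i (\<not> b)) a] = val (Edge i b) \<otimes> a"
    using vstab_closed[OF assms(3)] by (simp add: word_eval_def)
  ultimately show ?thesis
    using pres.eval_append[of p] path_lists[OF assms(1)] path_W_closed[OF assms(1)] vstab_closed[OF assms(3)]
      val_Edge_in[OF i, of b] m_assoc by auto
qed

text \<open>The lift of a path: after the prefix \<open>p\<close> it stands at the translate by
  \<open>W p\<close> of a representative vertex, and the next edge letter crosses
  \<open>act (W p) (D i b)\<close>. The vertex letter \<open>a\<close> does not change the vertex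
  reached.\<close>

lemma vact_W_step:
  assumes "path S v (sv i b) p" "i \<in> S" "a \<in> vstab (rep (sv i (\<not> b)))"
  shows "vact (W (p @ [Edge i b, Vert (sv i (\<not> b)) a])) (rep (sv i (\<not> b))) = tau (act (W p) (D i b))"
    "vact (W p) (rep (sv i b)) = tau (st (act (W p) (D i b)))"
proof -
  have i: "i \<in> I" using assms(2) S by blast
  note c = path_W_closed[OF assms(1)] vstab_closed[OF assms(3)] val_Edge_in[OF i, of b] rep_sub[OF sv_in[OF i, of "\<not> b"]]
  have "vact (W p \<otimes> val (Edge i b) \<otimes> a) (rep (sv i (\<not> b))) = vact (W p) (vact (val (Edge i b)) (vact a (rep (sv i (\<not> b)))))"
    using c vact_sub by (simp only: vact_mult m_closed)
  also have "\<dots> = vact (W p) (tau (D i b))" using assms(3) tau_D[OF i, of b] by (simp add: vstab_def)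
  finally show "vact (W (p @ [Edge i b, Vert (sv i (\<not> b)) a])) (rep (sv i (\<not> b))) = tau (act (W p) (D i b))"
    unfolding W_step[OF assms] using vact_tau c D_in[OF i] by simp
  show "vact (W p) (rep (sv i b)) = tau (st (act (W p) (D i b)))"
    using vact_tau[of "W p" "st (D i b)"] c D_in[OF i] tau_st_D[OF i, of b] act_st st_in by simp
qed

text \<open>Used to absorb a further vertex element into the final letter, so that the word keeps
  the alternating form of a path.\<close>

lemma path_last:
  "path S v w p \<Longrightarrow> \<exists>q a. p = q @ [Vert w a] \<and> a \<in> vstab (rep w) \<and> (\<forall>c\<in>vstab (rep w). path S v w (q @ [Vert w c]))"
proof (induction rule: path_induct)
  case (base v a)
  then show ?case using gog_path.at_vertex[of v gg] by (intro exI[of _ "[]"]) auto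
next
  case (step v p i b a)
  then show ?case using path_step[OF step.hyps(1,2)] by (intro exI[of _ "p @ [Edge i b]"]) auto
qed

lemma path_concat:
  assumes "path S v w p" "path S w u q"
  shows "\<exists>r. path S v u r \<and> word_cong R r (p @ q)"
  using assms(2,1)
proof (induction rule: path_induct)
  case (base w a)
  from path_last[OF base(3)] obtain q c where q: "p = q @ [Vert w c]" "c \<in> vstab (rep w)"
    "\<And>c. c \<in> vstab (rep w) \<Longrightarrow> path S v w (q @ [Vert w c])" by blast
  have "c \<otimes> a \<in> vstab (rep w)" using base q rep_subgroup subgroup.m_closed by metis
  moreover have "word_cong R (q @ [Vert w (c \<otimes> a)]) (p @ [Vert w a])"
    using Vert_mult_cong[OF base(1) q(2) base(2), of q "[]", THEN word_cong.sym] q(1) by simp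
  ultimately show ?case using q(3) by blast
next
  case (step w q i b a)
  then obtain r where "path S v (sv i b) r" "word_cong R r (p @ q)" by blast
  then show ?case using path_step[of S v i b r a] step.hyps word_cong_append[OF _ word_cong.refl, of R r "p @ q" "[Edge i b, Vert (sv i (\<not> b)) a]"]
    by auto
qed

end

section \<open>Paths that use only a given set of edges\<close>

definition ES :: "nat set \<Rightarrow> 'e set" where
  "ES S = {act g (ed i) | g i. g \<in> carrier G \<and> i \<in> S} \<union> {act g (st (ed i)) | g i. g \<in> carrier G \<and> i \<in> S}"

lemma ES_I: "ES I = E"
proof
  show "ES I \<subseteq> E" by (auto simp: ES_def ed_in st_in act_in)
  show "E \<subseteq> ES I" using ed_exists unfolding ES_def by blast
qed

lemma ES_iff_D:
  assumes "S \<subseteq> I"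
  shows "f \<in> ES S \<longleftrightarrow> (\<exists>g\<in>carrier G. \<exists>i\<in>S. \<exists>b. f = act g (D i b))"
proof
  assume "f \<in> ES S"
  then obtain g i where gi: "g \<in> carrier G" "i \<in> S" "f = act g (ed i) \<or> f = act g (st (ed i))"
    by (auto simp: ES_def)
  have i: "i \<in> I" using gi assms by blast
  have "act g (st (ed i)) = act (g \<otimes> t i) (D i False)"
    using gi t_in[OF i] ed_in[OF i] st_in by (simp add: D_def act_mult act_in act_inv)
  then show "\<exists>g\<in>carrier G. \<exists>i\<in>S. \<exists>b. f = act g (D i b)"
    using gi t_in[OF i] by (metis D_def m_closed)
next
  assume "\<exists>g\<in>carrier G. \<exists>i\<in>S. \<exists>b. f = act g (D i b)"
  then obtain g i b where gi: "g \<in> carrier G" "i \<in> S" "f = act g (D i b)" by blast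
  have i: "i \<in> I" using gi assms by blast
  then show "f \<in> ES S"
  proof (cases b)
    case True
    then show ?thesis using gi unfolding ES_def D_def by auto
  next
    case False
    then have "f = act (g \<otimes> inv (t i)) (st (ed i))" "g \<otimes> inv (t i) \<in> carrier G"
      using gi act_mult[of g "inv (t i)" "st (ed i)"] t_in[OF i] ed_in[OF i] st_in by (simp_all add: D_def)
    then show ?thesis using gi unfolding ES_def by blast
  qed
qed

lemma ES_sub: "S \<subseteq> I \<Longrightarrow> ES S \<subseteq> E"
  by (auto simp: ES_def ed_in st_in act_in)

lemma ES_st: "\<lbrakk>S \<subseteq> I; f \<in> ES S\<rbrakk> \<Longrightarrow> st f \<in> ES S"
  by (auto simp: ES_def ed_in st_in act_st[symmetric] st_st subset_iff)

text \<open>Equality of two vertices once the edges in \<open>ES S\<close> have been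
  collapsed.\<close>

definition agree :: "nat set \<Rightarrow> 'e set \<Rightarrow> 'e set \<Rightarrow> bool" where
  "agree S v w \<longleftrightarrow> v - ES S = w - ES S"

lemma agree_flip: "\<lbrakk>S \<subseteq> I; f \<in> ES S\<rbrakk> \<Longrightarrow> agree S (tau (st f)) (tau f)"
  using tau_st[of f] ES_sub[of S] ES_st[of S f] tau_mem[of f] by (auto simp: agree_def)

lemma path_agree:
  assumes "S \<subseteq> I" "path S v w p"
  shows "agree S (vact (W p) (rep w)) (rep v)"
  using assms(2)
proof (induction rule: path_induct)
  case (base v a)
  then show ?case by (simp add: agree_def vstab_def word_eval_def)
next
  case (step v p i b a)
  have "act (W p) (D i b) \<in> ES S"
    using step.hyps ES_iff_D[OF assms(1)] path_W_closed[OF assms(1)] by blast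
  from agree_flip[OF assms(1) this] step.IH show ?case
    using vact_W_step[OF assms(1) step.hyps] by (simp add: agree_def)
qed

lemma rep_tauE:
  assumes "v \<in> V" "g \<in> carrier G"
  obtains e where "e \<in> E" "vact g (rep v) = tau e"
proof -
  obtain e where "e \<in> E" "rep v = tau e" using rep_vertex[OF assms(1)] by blast
  then show thesis using that[of "act g e"] vact_tau[OF assms(2)] act_in[OF assms(2)] by simp
qed

text \<open>Induction on the distance of the end vertex from \<open>rep v\<close>. The edge
  \<open>f\<close> enters the end vertex and points away from \<open>rep v\<close>; it is crossed
  last, and the induction hypothesis leads to its other end. Since the two vertices agree outside
  \<open>ES S\<close>, the edge \<open>f\<close>, on which they differ, is an allowed one.\<close>

lemma path_exists:
  assumes "S \<subseteq> I" "v \<in> V" "w \<in> V" "g \<in> carrier G" "agree S (vact g (rep w)) (rep v)"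
  shows "\<exists>p. path S v w p \<and> W p = g"
  using assms(3-5)
proof (induction "card (vact g (rep w) - rep v)" arbitrary: w g)
  case 0
  obtain e where e: "e \<in> E" "vact g (rep w) = tau e" using rep_tauE 0 by blast
  obtain e' where e': "e' \<in> E" "rep v = tau e'" using rep_vertex[OF assms(2)] by blast
  have eq: "vact g (rep w) = rep v"
    using 0(1) finite_tau_diff[OF e(1) e'(1)] tau_subset_eq[OF e(1) e'(1)] e e' by auto
  then have "v = w" using rep_unique[OF assms(2) 0(2,3)] by simp
  then have "g \<in> vstab (rep v)" using eq 0 by (simp add: vstab_def)
  then show ?case using gog_path.at_vertex[of v gg g S] assms(2) \<open>v = w\<close> 0(3)
    by (intro exI[of _ "[Vert v g]"]) (simp add: word_eval_def)
next
  case (Suc n)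
  obtain e where e: "e \<in> E" "vact g (rep w) = tau e" using rep_tauE Suc.prems by blast
  obtain e' where e': "e' \<in> E" "rep v = tau e'" using rep_vertex[OF assms(2)] by blast
  have "tau e \<noteq> tau e'" using Suc.hyps(2) e e' by auto
  then obtain f where f: "f \<in> tau e" "f \<notin> tau e'" "tau f = tau e" using tau_diff_min e e' by metis
  have "f \<in> ES S" using f Suc.prems(3) e e' by (auto simp: agree_def)
  then obtain c i b where c: "c \<in> carrier G" "i \<in> S" "f = act c (D i b)" using ES_iff_D[OF assms(1)] by blast
  have i: "i \<in> I" using c assms(1) by blast
  define x where "x = val (Edge i b)"
  have x: "x \<in> carrier G" using val_Edge_in[OF i] by (simp add: x_def)
  note sub = rep_sub[OF sv_in[OF i]] rep_sub[OF Suc.prems(1)]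
  have "tau f = vact (c \<otimes> x) (rep (sv i (\<not> b)))"
    using c x D_in[OF i] vact_tau[of c "D i b"] tau_D[OF i, of b] sub by (simp add: vact_mult x_def[symmetric] del: val_simps)
  then have eq: "rep w = vact (inv g \<otimes> (c \<otimes> x)) (rep (sv i (\<not> b)))"
    using f(3) e(2) vact_mult[of "inv g" "c \<otimes> x" "rep (sv i (\<not> b))"] vact_inv(1)[OF Suc.prems(2) sub(2)] Suc.prems(2) c x sub by simp
  have w: "w = sv i (\<not> b)"
    using rep_unique[OF Suc.prems(1) sv_in[OF i] _ eq] Suc.prems(2) c x by simp
  \<comment> \<open>\<open>c \<otimes> x\<close> leads to the same vertex as \<open>g\<close>; what
    is missing is an element of the vertex group, the last letter of the path.\<close>
  define a where "a = inv (inv g \<otimes> (c \<otimes> x))"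
  have ga: "inv g \<otimes> (c \<otimes> x) \<in> carrier G" using Suc.prems(2) c x by simp
  have aw: "a \<in> vstab (rep w)"
    using eq vact_eq_move[OF ga sub(2) sub(2)] w ga by (auto simp: vstab_def a_def)
  have g: "g = c \<otimes> x \<otimes> a"
    using Suc.prems(2) c x by (simp add: a_def inv_mult_group m_assoc) (simp add: m_assoc[symmetric])
  have fE: "f \<in> E" using f tau_sub by blast
  have tsf: "tau (st f) = vact c (rep (sv i b))"
    using c D_in[OF i] tau_st_D[OF i, of b] act_st vact_tau[of c "st (D i b)"] st_in by simp
  have "n = card (vact c (rep (sv i b)) - rep v)"
    using card_tau_flip[OF fE e'(1) f(2)] tsf Suc.hyps(2) e e' f(3) by simp
  moreover have "agree S (vact c (rep (sv i b))) (rep v)"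
    using agree_flip[OF assms(1) \<open>f \<in> ES S\<close>] Suc.prems(3) tsf e f(3) by (simp add: agree_def)
  ultimately obtain p where p: "path S v (sv i b) p" "W p = c"
    using Suc.hyps(1)[of c "sv i b"] sv_in[OF i] c(1) by blast
  show ?case
    using path_step[OF p(1) c(2), of a] W_step[OF assms(1) p(1) c(2), of a] aw w p(2) g by (auto simp: x_def)
qed

section \<open>Minimal paths and the isomorphism with the fundamental group\<close>

definition minimal_path :: "nat \<Rightarrow> nat \<Rightarrow> (nat, nat, 'a) gog_letter list \<Rightarrow> bool" where
  "minimal_path v w p \<longleftrightarrow> path I v w p \<and> (\<forall>q. path I v w q \<longrightarrow> word_cong R q p \<longrightarrow> length p \<le> length q)"

text \<open>
  A path that crosses an edge and crosses it back at once can be shortened.  So the edges crossed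
  by a path of minimal length decrease strictly with respect to \<open>\<preceq>\<close>, and the path is not closed.
\<close>
lemma minimal_path_last:
  assumes "path I v w p" "minimal_path v w p"
  shows "(w = v \<and> (\<exists>a. p = [Vert v a])) \<or>
    (\<exists>p' i b a. p = p' @ [Edge i b, Vert w a] \<and> w = sv i (\<not> b) \<and> i \<in> I \<and> a \<in> vstab (rep w) \<and>
       path I v (sv i b) p' \<and> st (act (W p') (D i b)) \<in> rep v)"
  using assms
proof (induction rule: path_induct)
  case (base v a)
  then show ?case by blast
next
  case (step v p j c a')
  note wc = path_W_closed[OF subset_refl step.hyps(1)]
  have j: "j \<in> I" by (rule step.hyps)
  have vV: "v \<in> V" using path_lists[OF subset_refl step.hyps(1)] by blast
  define f' where "f' = act (W p) (D j c)"
  have f'E: "f' \<in> E" using f'_def wc D_in[OF j] act_in by blast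
  have tf': "vact (W p) (rep (sv j c)) = tau (st f')"
    using vact_W_step(2)[OF subset_refl step.hyps] f'_def by simp
  obtain e0 where e0: "e0 \<in> E" "rep v = tau e0" using rep_vertex[OF vV] by blast
  have "minimal_path v (sv j c) p"
    unfolding minimal_path_def
  proof (intro conjI allI impI)
    fix q assume q: "path I v (sv j c) q" "word_cong R q p"
    from path_step[OF q(1) step.hyps(2,3)] word_cong_append[OF q(2) word_cong.refl] step.prems
    show "length p \<le> length q" by (fastforce simp: minimal_path_def)
  qed (rule step.hyps)
  \<comment> \<open>The invariant of the induction: the edge crossed last points away from the
    origin \<open>rep v\<close>.\<close>
  from step.IH[OF this] have "st f' \<in> rep v"
  proof (elim disjE exE conjE)
    fix a assume "sv j c = v" "p = [Vert v a]"
    then have "vact (W p) (rep (sv j c)) = rep v"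
      using path_last[OF subset_refl step.hyps(1)] by (auto simp: word_eval_def vstab_def)
    then show ?thesis using tf' tau_mem[OF st_in[OF f'E]] by simp
  next
    fix p' i b a
    assume p: "p = p' @ [Edge i b, Vert (sv j c) a]" "sv j c = sv i (\<not> b)" "i \<in> I" "a \<in> vstab (rep (sv j c))"
      "path I v (sv i b) p'" "st (act (W p') (D i b)) \<in> rep v"
    define f where "f = act (W p') (D i b)"
    define x where "x = val (Edge i b)"
    have x: "x \<in> carrier G" using val_Edge_in[OF p(3)] by (simp add: x_def)
    have a: "a \<in> vstab (rep (sv i (\<not> b)))" "a \<in> carrier G" using p vstab_closed by auto
    note wc' = path_W_closed[OF subset_refl p(5)]
    have fE: "f \<in> E" using f_def wc' D_in[OF p(3)] act_in by blast
    have "tau f = tau (st f')"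
      using vact_W_step(1)[OF subset_refl p(5,3) a(1)] tf' p(1,2) f_def by simp
    show ?thesis
    proof (cases "f = st f'")
      \<comment> \<open>No backtracking: \<open>f\<close> and \<open>st f'\<close> are different
        edges into the same vertex, so \<open>st f \<preceq> st f'\<close>, and \<open>rep v\<close>
        is closed upwards.\<close>
      case False
      then have "st f \<preceq> st f'" using tau_min_pair(1)[OF fE st_in[OF f'E]] \<open>tau f = tau (st f')\<close> by blast
      then show ?thesis using tau_up[OF e0(1), of "st f" "st f'"] p(6) e0(2) f_def st_in[OF f'E] by simp
    next
      \<comment> \<open>Backtracking: the next edge is the last one reversed. Representatives being
        unique, its index is the same; without inversions, its direction is opposite. Hence
        \<open>a\<close> fixes the edge, and the two crossings with \<open>a\<close> between them
        reduce to a vertex letter, against minimality.\<close>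
      case True
      have Wp: "W p = W p' \<otimes> x \<otimes> a" using W_step[OF subset_refl p(5,3) a(1)] p(1,2) x_def by simp
      have "act (W p') (D i b) = act (W p') (st (act x (act a (D j c))))"
        using True unfolding f_def f'_def Wp
        using wc' x a(2) D_in[OF j] by (simp add: act_mult act_in act_st)
      then have "D i b = st (act x (act a (D j c)))"
        using act_eq_iff wc' x a(2) D_in[OF j] D_in[OF p(3)] act_in st_in by simp
      then have "st (D i b) = act x (act a (D j c))" using x a(2) D_in[OF j] act_in st_st by simp
      then have rev: "act a (D j c) = D i (\<not> b)"
        using D_reverse[OF p(3), of b] act_inv(1)[OF x, of "act a (D j c)"] a(2) D_in[OF j] act_in
        by (simp add: x_def[symmetric] del: val_simps)
      have ij: "i = j"
      proof -
        have "act a (D j c) \<in> ES {j}" "D i (\<not> b) \<in> ES {i}"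
          using ES_iff_D[of "{j}"] ES_iff_D[of "{i}"] j p(3) a(2) act_one[OF D_in[OF p(3), of "\<not> b"], symmetric] one_closed
          by blast+
        then obtain g h where gh: "g \<in> carrier G" "h \<in> carrier G"
          "act a (D j c) = act g (ed j) \<or> act a (D j c) = act g (st (ed j))"
          "act a (D j c) = act h (ed i) \<or> act a (D j c) = act h (st (ed i))"
          unfolding rev by (auto simp: ES_def)
        then have "act g (ed j) = act h (ed i) \<or> act g (ed j) = st (act h (ed i))"
          using ed_in[OF j] ed_in[OF p(3)] act_st act_in st_st by metis
        then have "act (inv h \<otimes> g) (ed j) = ed i \<or> act (inv h \<otimes> g) (ed j) = st (ed i)"
          using ed_in[OF j] ed_in[OF p(3)] gh(1,2) act_mult[of "inv h" g "ed j"] act_inv(1)[of h "ed i"]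
            act_inv(1)[of h "st (ed i)"] act_st[of h "ed i"] st_in by auto
        then show ?thesis using ed_unique[OF j p(3), of "inv h \<otimes> g"] gh by simp
      qed
      have cb: "c = (\<not> b)"
      proof (rule ccontr)
        assume "c \<noteq> (\<not> b)"
        then have "st (D i b) = act (x \<otimes> a) (D i b)"
          using \<open>st (D i b) = act x (act a (D j c))\<close> ij act_mult x a(2) D_in[OF j] by simp
        then show False using no_inversion[of "x \<otimes> a" "D i b"] x a(2) D_in[OF p(3)] by simp
      qed
      have ae: "a \<in> estab (D i (\<not> b))" using rev ij cb a(2) by (simp add: estab_def)
      note swap = estab_D_end[OF p(3) ae]
      from path_last[OF subset_refl p(5)] obtain q y where q: "p' = q @ [Vert (sv i b) y]" "y \<in> vstab (rep (sv i b))"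
        "\<And>y. y \<in> vstab (rep (sv i b)) \<Longrightarrow> path I v (sv i b) (q @ [Vert (sv i b) y])" by blast
      let ?z = "x \<otimes> a \<otimes> inv x"
      have z: "?z \<in> vstab (rep (sv i b))" using swap(1) x_def by simp
      have a': "a' \<in> vstab (rep (sv i b))" using step.hyps(3) ij cb by simp
      note S = rep_subgroup[OF sv_in[OF p(3)], of b]
      note svV = sv_in[OF p(3), of b]
      have eq: "sv i b = sv j (\<not> c)" using ij cb by simp
      have yz: "y \<otimes> ?z \<in> vstab (rep (sv i b))" using subgroup.m_closed[OF S] q(2) z by blast
      let ?w = "p @ [Edge j c, Vert (sv j (\<not> c)) a']"
      have w: "?w = (q @ [Vert (sv i b) y]) @ [Edge i b, Vert (sv i (\<not> b)) a, Edge i (\<not> b)] @ [Vert (sv i b) a']"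
        using p(1,2) q(1) ij cb by simp
      have "word_cong R ((q @ [Vert (sv i b) y]) @ [Edge i b, Vert (sv i (\<not> b)) a, Edge i (\<not> b)] @ [Vert (sv i b) a'])
          ((q @ [Vert (sv i b) y]) @ [Vert (sv i b) ?z] @ [Vert (sv i b) a'])"
        unfolding x_def by (rule word_cong_context[OF swap(2)])
      moreover have "word_cong R (q @ [Vert (sv i b) y, Vert (sv i b) ?z] @ [Vert (sv i b) a'])
          (q @ [Vert (sv i b) (y \<otimes> ?z)] @ [Vert (sv i b) a'])"
        by (rule Vert_mult_cong[OF svV q(2) z])
      moreover have "word_cong R (q @ [Vert (sv i b) (y \<otimes> ?z), Vert (sv i b) a'] @ [])
          (q @ [Vert (sv i b) (y \<otimes> ?z \<otimes> a')] @ [])"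
        by (rule Vert_mult_cong[OF svV yz a'])
      ultimately have "word_cong R ?w (q @ [Vert (sv i b) (y \<otimes> ?z \<otimes> a')])"
        unfolding w by (simp only: append.simps append_assoc append_Nil2) (rule word_cong.trans, assumption, rule word_cong.trans)
      moreover have "path I v (sv i b) (q @ [Vert (sv i b) (y \<otimes> ?z \<otimes> a')])"
        using q(3) subgroup.m_closed[OF S yz a'] by blast
      ultimately have "length ?w \<le> length (q @ [Vert (sv i b) (y \<otimes> ?z \<otimes> a')])"
        using step.prems word_cong.sym unfolding minimal_path_def eq by blast
      then show ?thesis using p(1) q(1) by simp
    qed
  qed
  then show ?case using step.hyps f'_def by blast
qed

text \<open>If a shortest congruent path still crossed an edge, the last one would point to the end
  of the lift and away from \<open>rep v\<close>; but here the lift ends at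
  \<open>rep v\<close>.\<close>

lemma closed_path_trivial:
  assumes "path I v v p" "W p \<in> vstab (rep v)"
  shows "word_cong R p [Vert v (W p)]"
proof -
  define q where "q = arg_min length (\<lambda>q. path I v v q \<and> word_cong R q p)"
  have q: "path I v v q" "word_cong R q p" and
    min: "\<And>r. path I v v r \<Longrightarrow> word_cong R r p \<Longrightarrow> length q \<le> length r"
    using arg_min_nat_lemma[of "\<lambda>q. path I v v q \<and> word_cong R q p" p length] assms(1) word_cong.refl
    unfolding q_def by auto
  have "minimal_path v v q"
    using q min word_cong.trans by (fastforce simp: minimal_path_def)
  have Wq: "W q = W p" using pres.cong_lists_eval[OF q(2)] path_lists[OF subset_refl q(1)] by blast
  from minimal_path_last[OF q(1) \<open>minimal_path v v q\<close>] show ?thesis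
  proof (elim disjE exE conjE)
    fix a assume a: "q = [Vert v a]"
    then have "a \<in> carrier G" using path_lists[OF subset_refl q(1)] Vert_in_L vstab_closed by auto
    then have "W q = a" using a by (simp add: word_eval_def)
    then show ?thesis using a Wq q(2) word_cong.sym by metis
  next
    fix p' i b a
    assume *: "q = p' @ [Edge i b, Vert v a]" "v = sv i (\<not> b)" "i \<in> I" "a \<in> vstab (rep v)"
      "path I v (sv i b) p'" "st (act (W p') (D i b)) \<in> rep v"
    have f: "act (W p') (D i b) \<in> E" using path_W_closed[OF subset_refl *(5)] D_in[OF *(3)] act_in by blast
    have "tau (act (W p') (D i b)) = vact (W q) (rep v)"
      using vact_W_step(1)[OF subset_refl *(5,3)] * by metis
    also have "\<dots> = rep v" using assms(2) Wq by (simp add: vstab_def)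
    finally show ?thesis using tau_xor[OF f f] tau_mem[OF f] *(6) by simp
  qed
qed

lemma agree_I: "\<lbrakk>v \<subseteq> E; w \<subseteq> E\<rbrakk> \<Longrightarrow> agree I v w"
  by (auto simp: agree_def ES_I)

text \<open>Applied to all edges, where \<open>agree\<close> is no condition, and to all edges but
  one, where it locates the groups of the collapsed graph inside \<open>G\<close>.\<close>

lemma path_class_image:
  assumes "S \<subseteq> I" "v \<in> V" "w \<in> V"
  shows "induced_map G val ` path_classes gg S v w = {g \<in> carrier G. agree S (vact g (rep w)) (rep v)}"
proof -
  have "induced_map G val (gog_class gg p) = W p" if "path S v w p" for p
    using pres.induced_map_class path_lists[OF assms(1) that] by (simp add: gog_class_def)
  then show ?thesis
    using path_exists[OF assms] path_agree[OF assms(1)] path_W_closed[OF assms(1)]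
    by (force simp: path_classes_def)
qed

lemma path_classes_carrier:
  assumes "S \<subseteq> I"
  shows "path_classes gg S v w \<subseteq> carrier (path_group gg)"
  using path_lists[OF assms] pres.class_closed by (auto simp: path_classes_def path_group_def gog_class_def)

lemma induced_map_fundamental_group_iso:
  assumes "v \<in> V"
  shows "induced_map G val \<in> iso (fundamental_group gg v) G"
proof -
  interpret P: group "path_group gg" unfolding path_group_def by (rule pres.presented_group_group)
  have hom: "induced_map G val \<in> hom (path_group gg) G"
    unfolding path_group_def by (rule pres.induced_map_hom)
  have sub: "path_classes gg I v v \<subseteq> carrier (path_group gg)" by (rule path_classes_carrier) simp
  have one: "\<one> \<in> vstab (rep v)" using rep_subgroup[OF assms] subgroup.one_closed by blast
  have inj: "gog_class gg p = gog_class gg q" if pq: "path I v v p" "path I v v q" "W p = W q" for p q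
  proof -
    \<comment> \<open>A closed path \<open>q'\<close> of inverse value cancels both \<open>p\<close>
      and \<open>q\<close>; this reduces injectivity to closed paths of value one.\<close>
    have "inv (W p) \<in> carrier G" using path_W_closed[OF subset_refl pq(1)] by simp
    then obtain q' where q': "path I v v q'" "W q' = inv (W p)"
      using path_exists[OF subset_refl assms assms] agree_I vact_sub rep_sub[OF assms] by metis
    have triv: "gog_class gg r \<otimes>\<^bsub>path_group gg\<^esub> gog_class gg q' = \<one>\<^bsub>path_group gg\<^esub>"
      if r: "path I v v r" "W r = W p" for r
    proof -
      obtain s where s: "path I v v s" "word_cong R s (r @ q')"
        using path_concat[OF subset_refl r(1) q'(1)] by blast
      note l = path_lists[OF subset_refl r(1)] path_lists[OF subset_refl q'(1)] path_lists[OF subset_refl s(1)]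
      have "W s = \<one>"
        using pres.cong_lists_eval[OF s(2)] pres.eval_append l r(2) q'(2) path_W_closed[OF subset_refl r(1)] by simp
      then have "word_cong R s [Vert v \<one>]" using closed_path_trivial[OF s(1)] one by simp
      then have "word_cong R s []" using Vert_one_cong[OF assms, of "[]" "[]"] word_cong.trans by fastforce
      then have "word_cong R (r @ q') []" using s(2) word_cong.sym word_cong.trans by metis
      then show ?thesis
        using l pres.class_mult[of r q'] pres.class_eq_iff[of "r @ q'" "[]"]
        by (simp add: path_group_def gog_class_def pres.class_one)
    qed
    from triv[of p] triv[of q] pq have "gog_class gg p \<otimes>\<^bsub>path_group gg\<^esub> gog_class gg q' = gog_class gg q \<otimes>\<^bsub>path_group gg\<^esub> gog_class gg q'"
      by simp
    moreover have "gog_class gg p \<in> carrier (path_group gg)" "gog_class gg q \<in> carrier (path_group gg)"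
      "gog_class gg q' \<in> carrier (path_group gg)"
      using sub pq(1,2) q'(1) by (auto simp: path_classes_def)
    ultimately show ?thesis by simp
  qed
  have val: "induced_map G val (gog_class gg p) = W p" if "path I v v p" for p
    using pres.induced_map_class path_lists[OF subset_refl that] by (simp add: gog_class_def)
  have "inj_on (induced_map G val) (path_classes gg I v v)"
  proof (rule inj_onI)
    fix C C' assume "C \<in> path_classes gg I v v" "C' \<in> path_classes gg I v v"
    then obtain p q where pq: "path I v v p" "path I v v q" and C: "C = gog_class gg p" "C' = gog_class gg q"
      by (auto simp: path_classes_def)
    assume "induced_map G val C = induced_map G val C'"
    then have "W p = W q" unfolding C val[OF pq(1)] val[OF pq(2)] .
    then show "C = C'" unfolding C by (rule inj[OF pq])
  qed
  moreover have "induced_map G val ` path_classes gg I v v = carrier G"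
    using path_class_image[OF subset_refl assms assms] agree_I vact_sub rep_sub[OF assms] by auto
  moreover have "induced_map G val \<in> hom (fundamental_group gg v) G"
  proof (rule homI)
    fix x y assume "x \<in> carrier (fundamental_group gg v)" "y \<in> carrier (fundamental_group gg v)"
    then have "x \<in> carrier (path_group gg)" "y \<in> carrier (path_group gg)"
      using sub by (auto simp: fundamental_group_def)
    then show "induced_map G val x \<in> carrier G"
      "induced_map G val (x \<otimes>\<^bsub>fundamental_group gg v\<^esub> y) = induced_map G val x \<otimes> induced_map G val y"
      using hom_in_carrier[OF hom] hom_mult[OF hom] by (simp_all add: fundamental_group_def)
  qed
  ultimately show ?thesis by (simp add: iso_def bij_betw_def fundamental_group_def)
qed

lemma graph_of_groups_gg: "graph_of_groups gg"
proof -
  have inj: "inj_on (\<lambda>h. inv (t i) \<otimes> h \<otimes> t i) (estab (ed i))" if "i \<in> I" for i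
    using t_in[OF that] estab_closed by (intro inj_onI) simp
  have hom: "(\<lambda>h. inv (t i) \<otimes> h \<otimes> t i) \<in> hom (G\<lparr>carrier := estab (ed i)\<rparr>) (G\<lparr>carrier := vstab (rep (s1 i))\<rparr>)"
    if i: "i \<in> I" for i
  proof (rule homI)
    fix x y assume "x \<in> carrier (G\<lparr>carrier := estab (ed i)\<rparr>)" "y \<in> carrier (G\<lparr>carrier := estab (ed i)\<rparr>)"
    then have "x \<in> carrier G" "y \<in> carrier G" using estab_closed by auto
    then show "inv (t i) \<otimes> (x \<otimes>\<^bsub>G\<lparr>carrier := estab (ed i)\<rparr>\<^esub> y) \<otimes> t i =
      inv (t i) \<otimes> x \<otimes> t i \<otimes>\<^bsub>G\<lparr>carrier := vstab (rep (s1 i))\<rparr>\<^esub> (inv (t i) \<otimes> y \<otimes> t i)"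
      using t_in[OF i] by (simp add: m_assoc) (simp add: m_assoc[symmetric])
  qed (use estab_target i in auto)
  have "path_classes gg I v w \<noteq> {}" if "v \<in> V" "w \<in> V" for v w
  proof -
    have "\<one> \<in> induced_map G val ` path_classes gg I v w"
      using path_class_image[OF subset_refl that] agree_I vact_sub rep_sub that by simp
    then show ?thesis by blast
  qed
  moreover have "(\<lambda>h. h) \<in> hom (G\<lparr>carrier := estab (ed i)\<rparr>) (G\<lparr>carrier := vstab (rep (s0 i))\<rparr>)" if "i \<in> I" for i
    using estab_source[OF that] by (auto simp: hom_def)
  ultimately show ?thesis
    unfolding graph_of_groups_def
    using finite_V V_nonempty finite_I s_in inj hom rep_subgroup estab_subgroup[OF ed_in] subgroup_imp_group
    by (simp add: gg_def)
qed

end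

section \<open>Trees with one orbit of edges\<close>

context tree_quotient
begin

text \<open>Injectivity is carried over from paths. A word of value one lifts to a closed path of
  value one, which is congruent to the trivial vertex letter, and translating letter by letter along
  \<psi> turns this into a congruence for \<open>R'\<close>.\<close>

lemma translate_iso:
  assumes "presentation G L' R' f'" and v: "v \<in> V"
    and letters: "\<And>l. l \<in> L \<Longrightarrow> \<psi> l \<in> lists L' \<and> word_eval G f' (\<psi> l) = val l"
    and rels: "\<And>p q. (p, q) \<in> R \<Longrightarrow> word_cong R' (concat (map \<psi> p)) (concat (map \<psi> q))"
    and lift: "\<And>w. w \<in> lists L' \<Longrightarrow> \<exists>p. path I v v p \<and> word_cong R' (concat (map \<psi> p)) w"
    and one: "word_cong R' (\<psi> (Vert v \<one>)) []"
  shows "induced_map G f' \<in> iso (presented_group L' R') G"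
proof -
  interpret P': presentation G L' R' f' by fact
  have ev: "concat (map \<psi> p) \<in> lists L' \<and> word_eval G f' (concat (map \<psi> p)) = W p" if "p \<in> lists L" for p
    using that
    by (induction p) (simp_all add: P'.eval_append letters P'.eval_Nil pres.eval_Nil pres.eval_Cons)
  show ?thesis
  proof (rule P'.induced_map_iso)
    fix g assume "g \<in> carrier G"
    then obtain p where "path I v v p" "W p = g"
      using path_exists[OF subset_refl v v] agree_I vact_sub rep_sub[OF v] by metis
    then show "\<exists>w\<in>lists L'. word_eval G f' w = g" using ev path_lists[OF subset_refl] by metis
  next
    fix w assume w: "w \<in> lists L'" "word_eval G f' w = \<one>"
    then obtain p where p: "path I v v p" "word_cong R' (concat (map \<psi> p)) w" using lift by blast
    have "W p = \<one>" using ev[of p] path_lists[OF subset_refl p(1)] P'.cong_lists_eval[OF p(2)] w by simp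
    moreover have "\<one> \<in> vstab (rep v)" using rep_subgroup[OF v] subgroup.one_closed by blast
    ultimately have "word_cong R p [Vert v \<one>]" using closed_path_trivial[OF p(1)] by simp
    then have "word_cong R' (concat (map \<psi> p)) (concat (map \<psi> [Vert v \<one>]))"
      by (rule word_cong_concat_map[rotated]) (rule rels)
    then have "word_cong R' (concat (map \<psi> p)) []" using one word_cong.trans by fastforce
    then show "word_cong R' w []" using p(2) word_cong.trans word_cong.sym by metis
  qed
qed

end

section \<open>Cosets and transversals\<close>

lemma (in group) mem_lcoset:
  assumes "x \<in> carrier G" "k \<in> carrier G" "K \<subseteq> carrier G"
  shows "x \<in> k <# K \<longleftrightarrow> inv k \<otimes> x \<in> K"
proof
  assume "x \<in> k <# K"
  then obtain h where "h \<in> K" "x = k \<otimes> h" by (auto simp: l_coset_def)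
  then show "inv k \<otimes> x \<in> K" using assms by (auto simp: m_assoc[symmetric] subset_iff)
next
  assume "inv k \<otimes> x \<in> K"
  then have "k \<otimes> (inv k \<otimes> x) \<in> k <# K" by (auto simp: l_coset_def)
  then show "x \<in> k <# K" using assms by (simp add: m_assoc[symmetric])
qed

lemma (in tree_action) transversal_exists:
  assumes "subgroup K G" "subgroup H G" "H \<subseteq> K"
  shows "\<exists>T. transversal G K H T"
proof -
  interpret K: subgroup K G by fact
  interpret H: subgroup H G by fact
  \<comment> \<open>The choice prefers the identity, because a transversal has to contain
    it.\<close>
  define r where "r C = (if \<one> \<in> C then \<one> else SOME z. z \<in> C)" for C
  have rC: "r C \<in> C" if "C \<noteq> {}" for C using that by (auto simp: r_def intro: someI)
  have self: "k \<in> k <# H" if "k \<in> K" for k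
    using that by (simp add: mem_lcoset K.subset[THEN subsetD] H.subset)
  have sub: "k <# H \<subseteq> K" if "k \<in> K" for k
    using that assms(3) by (auto simp: l_coset_def)
  have eq: "k <# H = k' <# H" if "k \<in> K" "k' \<in> K" "z \<in> k <# H" "z \<in> k' <# H" for k k' z
  proof -
    have c: "k \<in> carrier G" "k' \<in> carrier G" using that K.subset by auto
    show ?thesis
      using l_repr_independence[OF that(3) c(1) assms(2)] l_repr_independence[OF that(4) c(2) assms(2)] by simp
  qed
  have rin: "r (k <# H) \<in> k <# H" "r (k <# H) \<in> K" if "k \<in> K" for k
    using rC[of "k <# H"] self[OF that] sub[OF that] by auto
  let ?T = "(\<lambda>k. r (k <# H)) ` K"
  have "\<one> \<in> ?T"
    using self[OF K.one_closed] by (intro image_eqI[of _ _ \<one>]) (auto simp: r_def)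
  moreover have "\<exists>!x. x \<in> ?T \<and> x \<in> k <# H" if k: "k \<in> K" for k
  proof (rule ex1I)
    show "r (k <# H) \<in> ?T \<and> r (k <# H) \<in> k <# H" using rin k by auto
    fix x assume "x \<in> ?T \<and> x \<in> k <# H"
    then obtain k' where "k' \<in> K" "x = r (k' <# H)" "x \<in> k <# H" by auto
    then show "x = r (k <# H)" using rin[of k'] eq[OF k, of k' x] by auto
  qed
  ultimately have "transversal G K H ?T" using rin by (auto simp: transversal_def)
  then show ?thesis by blast
qed

lemma (in tree_action) transversal_pick:
  assumes "transversal G K H T" "subgroup K G" "subgroup H G" "k \<in> K"
  obtains a where "a \<in> T" "a \<in> K" "a \<in> carrier G" "inv k \<otimes> a \<in> H"
proof -
  obtain a where a: "a \<in> T" "a \<in> k <# H" using assms by (auto simp: transversal_def)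
  moreover have "a \<in> K" using a assms by (auto simp: transversal_def)
  ultimately show thesis
    using that mem_lcoset[of a k H] assms(4) subgroup.subset[OF assms(2)] subgroup.subset[OF assms(3)] by auto
qed

lemma (in tree_action) transversal_one:
  assumes "transversal G K H T" "subgroup K G" "subgroup H G" "a \<in> T" "a \<in> H"
  shows "a = \<one>"
proof -
  have H: "\<one> <# H = H" using lcos_mult_one subgroup.subset assms(3) by blast
  have "\<exists>!x. x \<in> T \<and> x \<in> \<one> <# H" "\<one> \<in> T"
    using assms subgroup.one_closed[OF assms(2)] by (auto simp: transversal_def)
  then show ?thesis using assms H subgroup.one_closed[OF assms(3)] by auto
qed

section \<open>The two sides of an edge\<close>

locale one_edge = tree_action G E le st act
  for G :: "'a monoid" (structure) and E :: "'e set" and le (infix "\<preceq>" 50) and st and act +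
  fixes e :: 'e
  assumes e_in: "e \<in> E"
    and one_orbit: "f \<in> E \<Longrightarrow> \<exists>g\<in>carrier G. f = act g e \<or> f = act g (st e)"
begin

definition x where "x = tau (st e)"
definition y where "y = tau e"
definition H where "H = estab e"

text \<open>\<open>Dpos\<close>: the origin of \<open>act g e\<close> lies in the half tree that
  \<open>e\<close> points to. \<open>Dneg\<close>: the end of \<open>act g e\<close> lies in the
  other half tree. The set Z of the splitting will be \<open>Dneg\<close> for an amalgam and
  \<open>Dpos\<close> for an HNN extension.\<close>

definition Dpos where "Dpos = {g \<in> carrier G. e \<in> vact g x}"
definition Dneg where "Dneg = {g \<in> carrier G. st e \<in> vact g y}"

lemma st_e_in: "st e \<in> E"
  by (simp add: e_in st_in)

lemma xy_sub: "x \<subseteq> E" "y \<subseteq> E"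
  by (simp_all add: x_def y_def tau_sub)

lemma H_subgroup: "subgroup H G"
  by (simp add: H_def estab_subgroup e_in)

lemma H_sub: "H \<subseteq> vstab x" "H \<subseteq> vstab y"
  using estab_sub_vstab[OF e_in] estab_sub_vstab[OF st_e_in] by (simp_all add: H_def x_def y_def estab_st e_in)

lemma vstab_xy_subgroup: "subgroup (vstab x) G" "subgroup (vstab y) G"
  by (simp_all add: vstab_subgroup xy_sub)

lemma vact_x: "g \<in> carrier G \<Longrightarrow> vact g x = tau (st (act g e))"
  by (simp add: x_def vact_tau st_e_in act_st e_in)

lemma vact_y: "g \<in> carrier G \<Longrightarrow> vact g y = tau (act g e)"
  by (simp add: y_def vact_tau e_in)

lemma Dpos_iff:
  assumes "g \<in> carrier G"
  shows "g \<in> Dpos \<longleftrightarrow> (act g e \<preceq> e \<and> act g e \<noteq> e) \<or> st (act g e) \<preceq> e"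
proof -
  have "act g e \<in> E" using act_in e_in assms by blast
  then have "e \<in> tau (st (act g e)) \<longleftrightarrow> st (act g e) \<preceq> e \<or> (act g e \<preceq> e \<and> e \<noteq> act g e)"
    using e_in st_st st_in by (simp add: tau_def)
  then show ?thesis using vact_x[OF assms] assms by (auto simp: Dpos_def)
qed

lemma not_Dpos_iff: "g \<in> carrier G \<Longrightarrow> g \<notin> Dpos \<longleftrightarrow> st e \<in> vact g x"
  using vact_x[of g] tau_xor[of "st (act g e)" e] act_in e_in st_in by (auto simp: Dpos_def)

lemma not_Dneg_iff: "g \<in> carrier G \<Longrightarrow> g \<notin> Dneg \<longleftrightarrow> e \<in> vact g y"
  using vact_y[of g] tau_xor[of "act g e" e] act_in e_in st_in by (auto simp: Dneg_def)

text \<open>The two ends of \<open>act g e\<close> orient all other edges alike. So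
  \<open>Dneg\<close> and the complement of \<open>Dpos\<close> can differ at \<open>g\<close> only
  if \<open>st e\<close> is \<open>act g e\<close> or \<open>st (act g e)\<close>; the first would
  be an inversion, the second means \<open>g \<in> H\<close>.\<close>

lemma side_cases:
  assumes g: "g \<in> carrier G"
  shows "g \<in> Dneg \<longleftrightarrow> g \<notin> Dpos \<and> g \<notin> H"
proof -
  have f: "act g e \<in> E" using act_in e_in g by blast
  have eq: "vact g x = insert (st (act g e)) (vact g y - {act g e})"
    using vact_x[OF g] vact_y[OF g] tau_st[OF f] by simp
  have "act g e \<noteq> st e" using no_inversion[OF g e_in] .
  moreover have "st e = st (act g e) \<longleftrightarrow> g \<in> H"
    using st_eq_iff[OF e_in f] g by (auto simp: H_def estab_def)
  moreover have "st (act g e) \<notin> vact g y" using tau_xor[OF f f] tau_mem[OF f] vact_y[OF g] by simp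
  ultimately show ?thesis
    using not_Dpos_iff[OF g] g eq unfolding Dneg_def by auto
qed

lemma complement_Dneg: "carrier G - Dneg - H = Dpos"
proof -
  have "Dpos \<inter> H = {}"
    using not_Dpos_iff H_sub tau_mem[OF st_e_in] by (auto simp: vstab_def x_def)
  then show ?thesis using side_cases by (auto simp: Dpos_def)
qed

lemma Dpos_H_disjoint: "h \<in> H \<Longrightarrow> h \<notin> Dpos \<and> h \<notin> Dneg"
  using complement_Dneg side_cases subgroup.subset[OF H_subgroup] by auto

text \<open>A vertex on the initial side of \<open>m\<close> lies on the terminal side of every
  other edge that enters the same vertex as \<open>m\<close>. This is the geometric half of the
  ping-pong arguments below.\<close>

lemma separate:
  assumes "m \<in> E" "n \<in> E" "tau m = tau n" "m \<noteq> n" "f \<in> E" "st m \<in> tau f"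
  shows "n \<in> tau f"
  using tau_min_pair[OF assms(1-4)] tau_up[OF assms(5,6,2)] by blast

end

section \<open>Amalgams: the two ends of the edge lie in different orbits\<close>

locale amalgam_edge = one_edge +
  assumes no_swap: "g \<in> carrier G \<Longrightarrow> vact g x \<noteq> y"
    and Dpos_nonempty: "Dpos \<noteq> {}" and Dneg_nonempty: "Dneg \<noteq> {}"
begin

text \<open>Both ends of \<open>e\<close> are representatives themselves, so the connecting element
  is the identity. The labels 0 and 2 merely have to be different.\<close>

lemma amalgam_quotient:
  "tree_quotient G E le st act {0, 2} (\<lambda>v. if v = 0 then x else y) {0} (\<lambda>_. e) (\<lambda>_. 0) (\<lambda>_. 2) (\<lambda>_. \<one>)"
proof unfold_locales
  fix v w :: nat and g
  assume *: "v \<in> {0, 2}" "w \<in> {0, 2}" and g: "g \<in> carrier G"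
    and eq: "(if v = 0 then x else y) = vact g (if w = 0 then x else y)"
  show "v = w"
  proof (rule ccontr)
    assume "v \<noteq> w"
    then have "x = vact g y \<or> y = vact g x" using * eq by auto
    then show False using no_swap[of "inv g"] no_swap[of g] vact_inv(1)[OF g xy_sub(2)] g by auto
  qed
qed (use e_in st_e_in one_orbit xy_sub in \<open>auto simp: x_def y_def vact_one split: if_splits\<close>)

lemma amalgam_iso:
  "induced_map G (case_sum id id) \<in>
     iso (amalgamated_product (G\<lparr>carrier := vstab x\<rparr>) (G\<lparr>carrier := vstab y\<rparr>) H id id) G"
proof -
  interpret Q: tree_quotient G E le st act "{0, 2}" "\<lambda>v. if v = 0 then x else y" "{0}" "\<lambda>_. e" "\<lambda>_. 0" "\<lambda>_. 2" "\<lambda>_. \<one>"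
    by (rule amalgam_quotient)
  let ?A = "vstab x" and ?B = "vstab y"
  let ?L = "Inl ` ?A \<union> Inr ` ?B :: ('a + 'a) set"
  let ?R = "group_rels Inl (G\<lparr>carrier := ?A\<rparr>) \<union> group_rels Inr (G\<lparr>carrier := ?B\<rparr>) \<union>
    {([Inl (id h)], [Inr (id h)]) | h. h \<in> H} :: (('a + 'a) list \<times> ('a + 'a) list) set"
  note A = vstab_xy_subgroup(1) and B = vstab_xy_subgroup(2)
  interpret A: subgroup ?A G by (rule A)
  interpret B: subgroup ?B G by (rule B)
  have RA: "group_rels Inl (G\<lparr>carrier := ?A\<rparr>) \<subseteq> ?R" and RB: "group_rels Inr (G\<lparr>carrier := ?B\<rparr>) \<subseteq> ?R" by auto
  have pres: "presentation G ?L ?R (case_sum id id)"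
  proof
    fix l assume l: "l \<in> ?L"
    show "\<exists>w\<in>lists ?L. word_cong ?R (l # w) [] \<and> word_cong ?R (w @ [l]) []"
    proof (cases l)
      case (Inl a)
      then have a: "a \<in> ?A" using l by auto
      then show ?thesis
        using group_rels_inverse[OF subgroup_imp_group[OF A] RA, of a] Inl m_inv_consistent[OF A a]
        by (intro bexI[of _ "[Inl (inv a)]"]) auto
    next
      case (Inr a)
      then have a: "a \<in> ?B" using l by auto
      then show ?thesis
        using group_rels_inverse[OF subgroup_imp_group[OF B] RB, of a] Inr m_inv_consistent[OF B a]
        by (intro bexI[of _ "[Inr (inv a)]"]) auto
    qed
  qed (use H_sub in \<open>auto simp: group_rels_def word_eval_def\<close>)
  \<comment> \<open>Edge letters have value one and are erased; the conjugation relation then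
    becomes the identification of the two copies of \<open>H\<close>.\<close>
  let ?\<psi> = "\<lambda>l :: (nat, nat, 'a) gog_letter.
    case l of Vert v a \<Rightarrow> if v = 0 then [Inl a] else [Inr a] | Edge i b \<Rightarrow> ([] :: ('a + 'a) list)"
  have one: "word_cong ?R [Inl \<one>] []" "word_cong ?R [Inr \<one>] []"
    using word_cong_group_rels_one[OF RA, of "[]" "[]"] word_cong_group_rels_one[OF RB, of "[]" "[]"] by simp_all
  have "induced_map G (case_sum id id) \<in> iso (presented_group ?L ?R) G"
  proof (rule Q.translate_iso[OF pres, of 0 ?\<psi>])
    fix l assume "l \<in> Q.L"
    then show "?\<psi> l \<in> lists ?L \<and> word_eval G (case_sum id id) (?\<psi> l) = Q.val l"
      by (cases l) (auto simp: Q.Vert_in_L word_eval_def)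
  next
    fix p q assume "(p, q) \<in> Q.R"
    then show "word_cong ?R (concat (map ?\<psi> p)) (concat (map ?\<psi> q))"
    proof (cases rule: Q.gog_relsE)
      case (mult v a b)
      then show ?thesis
        using word_cong_group_rels_mult[OF RA, of a b "[]" "[]"] word_cong_group_rels_mult[OF RB, of a b "[]" "[]"]
        by (auto split: if_splits)
    next
      case (one v)
      then show ?thesis using \<open>word_cong ?R [Inl \<one>] []\<close> \<open>word_cong ?R [Inr \<one>] []\<close> by auto
    next
      case (edge i b)
      then show ?thesis by (simp add: word_cong.refl)
    next
      case (conj i h)
      then have "([Inl h], [Inr h]) \<in> ?R" "h \<in> carrier G"
        by (auto simp: H_def estab_def)
      then show ?thesis using conj word_cong.rel[of "[Inl h]" "[Inr h]" ?R "[]" "[]"] by simp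
    qed
  next
    fix w :: "('a + 'a) list" assume "w \<in> lists ?L"
    then show "\<exists>p. Q.path {0} 0 0 p \<and> word_cong ?R (concat (map ?\<psi> p)) w"
    proof (induction w rule: rev_induct)
      case Nil
      have "Q.path {0} 0 0 [Vert 0 \<one>]" by (rule gog_path.at_vertex) simp_all
      then show ?case using one by (intro exI[of _ "[Vert 0 \<one>]"]) simp
    next
      case (snoc l w)
      then obtain p where p: "Q.path {0} 0 0 p" "word_cong ?R (concat (map ?\<psi> p)) w" by auto
      show ?case
      proof (cases l)
        case (Inl a)
        then have a: "a \<in> ?A" using snoc.prems by auto
        obtain q c where q: "p = q @ [Vert 0 c]" "c \<in> ?A" "\<And>c. c \<in> ?A \<Longrightarrow> Q.path {0} 0 0 (q @ [Vert 0 c])"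
          using Q.path_last[OF subset_refl p(1)] by auto
        have "word_cong ?R (concat (map ?\<psi> q) @ [Inl (c \<otimes> a)]) (concat (map ?\<psi> q) @ [Inl c, Inl a])"
          using word_cong.sym[OF word_cong_group_rels_mult[OF RA, of c a "concat (map ?\<psi> q)" "[]"]] q(2) a by simp
        also have "word_cong ?R (concat (map ?\<psi> q) @ [Inl c, Inl a]) (w @ [Inl a])"
          using word_cong_context[OF p(2), of "[]" "[Inl a]"] q(1) by simp
        finally show ?thesis using q(3)[OF A.m_closed[OF q(2) a]] Inl
          by (intro exI[of _ "q @ [Vert 0 (c \<otimes> a)]"]) simp
      next
        case (Inr b)
        then have b: "b \<in> ?B" using snoc.prems by auto
        \<comment> \<open>A letter of the second factor is realized by a detour across the edge and
          back.\<close>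
        have p1: "Q.path {0} 0 2 (p @ [Edge 0 True, Vert 2 b])"
          using Q.path_step[of "{0}" 0 0 True p b] p(1) b by (simp add: Q.sv_def)
        have p2: "Q.path {0} 0 0 ((p @ [Edge 0 True, Vert 2 b]) @ [Edge 0 False, Vert 0 \<one>])"
          using Q.path_step[of "{0}" 0 0 False "p @ [Edge 0 True, Vert 2 b]" \<one>] p1 by (simp add: Q.sv_def)
        have "word_cong ?R (concat (map ?\<psi> p) @ [Inr b] @ [Inl \<one>]) (w @ [Inr b] @ [])"
          by (rule word_cong_append[OF p(2) word_cong_append[OF word_cong.refl one(1)]])
        then show ?thesis using p2 Inr by (intro exI[of _ "(p @ [Edge 0 True, Vert 2 b]) @ [Edge 0 False, Vert 0 \<one>]"]) simp
      qed
    qed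
  qed (use one in simp_all)
  then show ?thesis by (simp add: amalgamated_product_def)
qed

text \<open>The factors are proper: a vertex fixed by all of \<open>G\<close> has no translate on
  the far side of the edge, so \<open>Dpos\<close> or \<open>Dneg\<close> would be empty.\<close>

lemma amalgam_is_splitting: "is_splitting G (Amalgam (vstab x) (vstab y) H)"
proof -
  have "vstab x \<noteq> carrier G"
  proof
    assume "vstab x = carrier G"
    then have "g \<notin> Dpos" if "g \<in> carrier G" for g
      using that not_Dpos_iff[OF that] tau_mem[OF st_e_in] by (auto simp: vstab_def x_def)
    then show False using Dpos_nonempty by (auto simp: Dpos_def)
  qed
  moreover have "vstab y \<noteq> carrier G"
  proof
    assume "vstab y = carrier G"
    then have "g \<notin> Dneg" if "g \<in> carrier G" for g
      using that not_Dneg_iff[OF that] tau_mem[OF e_in] by (auto simp: vstab_def y_def)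
    then show False using Dneg_nonempty by (auto simp: Dneg_def)
  qed
  ultimately show ?thesis
    using vstab_xy_subgroup H_subgroup H_sub amalgam_iso by simp
qed

text \<open>Ping-pong at the origin of \<open>e\<close>: \<open>act a e\<close> and \<open>e\<close>
  are different edges with this origin, so what lies beyond \<open>act a e\<close> lies behind
  \<open>e\<close>.\<close>

lemma mult_A_Dneg:
  assumes "a \<in> vstab x" "a \<notin> H" "g \<in> carrier G" "g \<notin> Dneg"
  shows "a \<otimes> g \<in> Dneg"
proof -
  have a: "a \<in> carrier G" using assms by (simp add: vstab_def)
  have ae: "act a e \<in> E" using a e_in act_in by blast
  have ag: "vact (a \<otimes> g) y = tau (act (a \<otimes> g) e)" "act (a \<otimes> g) e \<in> E" using vact_y act_in e_in a assms by simp_all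
  have "act a e \<in> vact (a \<otimes> g) y"
    using not_Dneg_iff assms a e_in xy_sub vact_sub by (simp add: vact_mult act_mem_vact)
  moreover have "tau (st (act a e)) = tau (st e)" using vact_x[OF a] assms by (simp add: vstab_def x_def)
  moreover have "st (act a e) \<noteq> st e" using st_eq_iff[OF ae e_in] assms a by (simp add: H_def estab_def)
  ultimately have "st e \<in> vact (a \<otimes> g) y"
    using separate[of "st (act a e)" "st e" "act (a \<otimes> g) e"] ag st_st[OF ae] st_in[OF ae] st_e_in by simp
  then show ?thesis using a assms by (simp add: Dneg_def)
qed

lemma mult_B_Dpos:
  assumes "b \<in> vstab y" "b \<notin> H" "g \<in> carrier G" "g \<notin> Dpos"
  shows "b \<otimes> g \<in> Dpos"
proof -
  have b: "b \<in> carrier G" using assms by (simp add: vstab_def)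
  have be: "act b e \<in> E" using b e_in act_in by blast
  have bg: "vact (b \<otimes> g) x = tau (st (act (b \<otimes> g) e))" "st (act (b \<otimes> g) e) \<in> E"
    using vact_x act_in e_in st_in b assms by simp_all
  have "act b (st e) \<in> vact (b \<otimes> g) x"
    using not_Dpos_iff assms b st_e_in xy_sub vact_sub by (simp add: vact_mult act_mem_vact)
  then have "st (act b e) \<in> vact (b \<otimes> g) x" using act_st[OF b e_in] by simp
  moreover have "tau (act b e) = tau e" using vact_y[OF b] assms by (simp add: vstab_def y_def)
  moreover have "act b e \<noteq> e" using assms b by (simp add: H_def estab_def)
  ultimately have "e \<in> vact (b \<otimes> g) x"
    using separate[of "act b e" e "st (act (b \<otimes> g) e)"] bg be e_in by simp
  then show ?thesis using b assms by (simp add: Dpos_def)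
qed

lemma card_flip_y:
  assumes "g \<in> carrier G" "f \<in> tau d" "f \<notin> vact g x" "d \<in> E"
  shows "Suc (card (tau (st f) - vact g x)) = card (tau f - vact g x)"
proof -
  have "f \<in> E" using assms tau_sub by blast
  then show ?thesis
    using card_tau_flip[of f "st (act g e)"] assms vact_x st_in act_in e_in by simp
qed

context
  fixes T\<^sub>A T\<^sub>B
  assumes TA: "transversal G (vstab x) H T\<^sub>A" and TB: "transversal G (vstab y) H T\<^sub>B"
begin

lemma T_sub: "a \<in> T\<^sub>A \<Longrightarrow> a \<in> vstab x \<and> a \<in> carrier G" "b \<in> T\<^sub>B \<Longrightarrow> b \<in> vstab y \<and> b \<in> carrier G"
  using TA TB by (auto simp: transversal_def vstab_def)

lemma T_H: "a \<in> T\<^sub>A \<Longrightarrow> a \<noteq> \<one> \<Longrightarrow> a \<notin> H" "b \<in> T\<^sub>B \<Longrightarrow> b \<noteq> \<one> \<Longrightarrow> b \<notin> H"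
  using transversal_one[OF TA vstab_xy_subgroup(1) H_subgroup] transversal_one[OF TB vstab_xy_subgroup(2) H_subgroup] by blast+

abbreviation nf where "nf \<equiv> amalgam_normal_form G T\<^sub>A T\<^sub>B H"

lemma nf_Cons:
  "nf ((a, b) # ps) h \<longleftrightarrow> a \<in> T\<^sub>A \<and> b \<in> T\<^sub>B \<and> h \<in> H \<and>
     (ps \<noteq> [] \<longrightarrow> b \<noteq> \<one> \<and> fst (hd ps) \<noteq> \<one> \<and> nf ps h)"
proof (cases ps)
  case (Cons p ps')
  then show ?thesis
    by (auto simp: amalgam_normal_form_def All_less_Suc2 nth_Cons' split: if_splits)
qed (auto simp: amalgam_normal_form_def)

lemma amalgam_value_Cons: "amalgam_value G ((a, b) # ps) h = a \<otimes> b \<otimes> amalgam_value G ps h"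
  by (simp add: amalgam_value_def)

text \<open>Read from the right, each nontrivial letter carries the element to the other side by
  ping-pong, so the leftmost nontrivial letter decides the side. If the first pair is trivial, the
  word is only an element of \<open>H\<close>.\<close>

lemma nf_side:
  "nf ps h \<Longrightarrow> amalgam_value G ps h \<in> carrier G \<and>
    (fst (hd ps) \<noteq> \<one> \<longrightarrow> amalgam_value G ps h \<in> Dneg) \<and>
    (fst (hd ps) = \<one> \<longrightarrow> (if snd (hd ps) = \<one> then amalgam_value G ps h \<in> H else amalgam_value G ps h \<in> Dpos))"
proof (induction ps)
  case Nil
  then show ?case by (simp add: amalgam_normal_form_def)
next
  case (Cons p ps)
  obtain a b where p: "p = (a, b)" by force
  with Cons.prems have ab: "a \<in> T\<^sub>A" "b \<in> T\<^sub>B" "h \<in> H" and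
    rest: "ps \<noteq> [] \<Longrightarrow> b \<noteq> \<one> \<and> fst (hd ps) \<noteq> \<one> \<and> nf ps h" by (simp_all add: nf_Cons)
  note c = T_sub(1)[OF ab(1)] T_sub(2)[OF ab(2)]
  define r where "r = amalgam_value G ps h"
  have hc: "h \<in> carrier G" using ab(3) subgroup.subset[OF H_subgroup] by blast
  have r: "r \<in> carrier G" "r \<notin> Dpos" "b = \<one> \<Longrightarrow> r \<in> H"
  proof -
    have "r \<in> carrier G \<and> (r \<in> H \<or> r \<in> Dneg) \<and> (b = \<one> \<longrightarrow> r \<in> H)"
    proof (cases "ps = []")
      case True
      then show ?thesis using ab(3) hc by (simp add: r_def amalgam_value_def)
    next
      case False
      then show ?thesis using Cons.IH rest by (simp add: r_def)
    qed
    then show "r \<in> carrier G" "r \<notin> Dpos" "b = \<one> \<Longrightarrow> r \<in> H" using side_cases Dpos_H_disjoint by auto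
  qed
  have br: "if b = \<one> then b \<otimes> r \<in> H else b \<otimes> r \<in> Dpos"
    using r mult_B_Dpos[of b r] c T_H(2)[OF ab(2)] by simp
  have brc: "b \<otimes> r \<in> carrier G" using c r by simp
  have brn: "b \<otimes> r \<notin> Dneg" using br side_cases[OF brc] by (auto split: if_splits)
  have v: "amalgam_value G (p # ps) h = a \<otimes> (b \<otimes> r)"
    using p c r by (simp add: amalgam_value_Cons r_def[symmetric] m_assoc)
  show ?case
  proof (cases "a = \<one>")
    case True
    then show ?thesis using v p br brc by (cases "b = \<one>") simp_all
  next
    case False
    then show ?thesis using v p mult_A_Dneg[OF _ T_H(1)[OF ab(1) False] brc brn] c brc by simp
  qed
qed

text \<open>Induction on the sum of the distances of \<open>vact g x\<close> from both ends of
  \<open>e\<close>. The first edge on the way to \<open>vact g x\<close> is a translate of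
  \<open>e\<close> or \<open>st e\<close>, and its coset representative is split off. The sum is
  needed because the letters alternate: removing a letter from the first factor keeps the distance
  from \<open>x\<close> and lowers that from \<open>y\<close> by two, and conversely for the second
  factor.\<close>

lemma nf_exists:
  "g \<in> carrier G \<Longrightarrow> \<exists>ps h. nf ps h \<and> amalgam_value G ps h = g"
proof (induction "card (x - vact g x) + card (y - vact g x)" arbitrary: g rule: less_induct)
  case less
  note g = less.prems
  have one: "\<one> \<in> T\<^sub>A" "\<one> \<in> T\<^sub>B" using TA TB by (auto simp: transversal_def)
  have gE: "act g e \<in> E" using g act_in e_in by blast
  have Hc: "h \<in> carrier G" if "h \<in> H" for h using that subgroup.subset[OF H_subgroup] by blast
  \<comment> \<open>Distances are invariant under \<open>a\<close>, so those after removal of the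
    letter can be measured from a translated base vertex.\<close>
  have move: "card (v - vact (inv a \<otimes> g) x) = card (vact a v - vact g x)" if "a \<in> carrier G" "v \<subseteq> E" for a v
  proof -
    have "vact a (v - vact (inv a \<otimes> g) x) = vact a v - vact g x"
      using that g xy_sub vact_sub by (simp add: vact_diff vact_mult vact_inv)
    moreover have "v - vact (inv a \<otimes> g) x \<subseteq> E" using that by blast
    ultimately show ?thesis using card_vact[of a "v - vact (inv a \<otimes> g) x"] that by simp
  qed
  consider "g \<in> H" | "vact g x = x" | "g \<in> Dneg" "vact g x \<noteq> x" | "g \<in> Dpos"
    using side_cases[OF g] by blast
  then show ?case
  proof cases
    case 1
    then show ?thesis using one Hc by (intro exI[of _ "[(\<one>, \<one>)]"] exI[of _ g]) (simp add: nf_Cons amalgam_value_def)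
  next
    case 2
    then have "g \<in> vstab x" using g by (simp add: vstab_def)
    then obtain a where a: "a \<in> T\<^sub>A" "a \<in> carrier G" "inv g \<otimes> a \<in> H"
      using transversal_pick[OF TA vstab_xy_subgroup(1) H_subgroup] by metis
    have "inv a \<otimes> g = inv (inv g \<otimes> a)" using a g by (simp add: inv_mult_group)
    then have "inv a \<otimes> g \<in> H" using a(3) subgroup.m_inv_closed[OF H_subgroup] by simp
    then show ?thesis using one a g
      by (intro exI[of _ "[(a, \<one>)]"] exI[of _ "inv a \<otimes> g"]) (simp add: nf_Cons amalgam_value_def m_assoc[symmetric])
  next
    case 3
    then have "tau (st e) \<noteq> tau (st (act g e))" using vact_x[OF g] by (auto simp: x_def)
    then obtain f where f: "f \<in> x" "f \<notin> vact g x" "tau f = x"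
      using tau_diff_min[OF st_e_in st_in[OF gE]] vact_x[OF g] unfolding x_def by metis
    have fE: "f \<in> E" using f xy_sub by blast
    obtain c where c: "c \<in> carrier G" "f = act c e \<or> f = act c (st e)" using one_orbit[OF fE] by blast
    have "f \<noteq> act c e" using no_swap[of "inv c"] c f vact_y[of c] vact_inv(1)[of c y] xy_sub by auto
    then have fc: "f = act c (st e)" using c by blast
    then have "c \<in> vstab x" using f(3) vact_tau[OF c(1) st_e_in] c by (simp add: vstab_def x_def)
    then obtain a where a: "a \<in> T\<^sub>A" "a \<in> vstab x" "a \<in> carrier G" "inv c \<otimes> a \<in> H"
      using transversal_pick[OF TA vstab_xy_subgroup(1) H_subgroup] by metis
    have "act (inv c \<otimes> a) (st e) = st e" using a(4) act_st[of "inv c \<otimes> a" e] e_in by (simp add: H_def estab_def)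
    then have fa: "f = act a (st e)"
      using act_mult[of "inv c" a "st e"] act_eq_move[of "inv c" "act a (st e)" "st e"] a c st_e_in act_in fc by auto
    define g' where "g' = inv a \<otimes> g"
    have g': "g' \<in> carrier G" using a g by (simp add: g'_def)
    have "st e \<notin> vact g' x"
      using f(2) fa act_mem_vact[of a "vact g' x" "st e"] vact_sub[OF g' xy_sub(1)] st_e_in a
      by (simp add: g'_def vact_mult vact_inv g xy_sub vact_sub)
    then have g'pos: "g' \<in> Dpos" using not_Dpos_iff[OF g'] by blast
    have "card (x - vact g' x) = card (x - vact g x)" using move[of a x] a xy_sub by (simp add: g'_def vstab_def)
    moreover have "vact a y = tau (st f)" using vact_y[OF a(3)] fa act_st[of a "st e"] a st_e_in st_st e_in by simp
    then have "Suc (card (y - vact g' x)) = card (x - vact g x)"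
      using move[of a y] a xy_sub card_flip_y[OF g, of f "st e"] f st_e_in by (simp add: g'_def x_def)
    moreover have "e \<notin> vact g x" using 3 side_cases[OF g] g by (simp add: Dpos_def)
    then have "Suc (card (x - vact g x)) = card (y - vact g x)"
      using card_flip_y[OF g, of e e] e_in tau_mem by (simp add: x_def y_def)
    ultimately obtain ps h where ps: "nf ps h" "amalgam_value G ps h = g'"
      using less.hyps[OF _ g'] by force
    \<comment> \<open>As \<open>g'\<close> lies in \<open>Dpos\<close>, the first entry of its
      normal form is trivial and can be replaced by the new letter \<open>a\<close>.\<close>
    from nf_side[OF ps(1)] ps(2) g'pos have hd1: "fst (hd ps) = \<one>" using side_cases[OF g'] by auto
    obtain b1 ps' where ps': "ps = (\<one>, b1) # ps'"
      using ps(1) hd1 by (cases ps) (auto simp: amalgam_normal_form_def)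
    have "nf ((a, b1) # ps') h" using ps(1) ps' a by (simp add: nf_Cons)
    moreover have "amalgam_value G ((a, b1) # ps') h = a \<otimes> g'"
    proof -
      have b1: "b1 \<in> carrier G" using ps(1) ps' T_sub by (simp add: nf_Cons)
      have "amalgam_value G ps' h \<in> carrier G"
        using ps(1) ps' nf_side[of ps' h] Hc by (cases "ps' = []") (auto simp: nf_Cons amalgam_value_def)
      then show ?thesis using ps(2) ps' a b1 by (auto simp: amalgam_value_Cons m_assoc)
    qed
    moreover have "a \<otimes> g' = g" using a g by (simp add: g'_def m_assoc[symmetric])
    ultimately show ?thesis by blast
  next
    case 4
    then have ex: "e \<in> vact g x" by (simp add: Dpos_def)
    have "tau e \<noteq> tau (st (act g e))" using vact_x[OF g] no_swap[OF g] by (auto simp: y_def)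
    then obtain f where f: "f \<in> y" "f \<notin> vact g x" "tau f = y"
      using tau_diff_min[OF e_in st_in[OF gE]] vact_x[OF g] unfolding y_def by metis
    have fE: "f \<in> E" using f xy_sub by blast
    obtain c where c: "c \<in> carrier G" "f = act c e \<or> f = act c (st e)" using one_orbit[OF fE] by blast
    have "f \<noteq> act c (st e)" using no_swap[of c] c f vact_tau[OF c(1) st_e_in] by (auto simp: x_def)
    then have fc: "f = act c e" using c by blast
    then have "c \<in> vstab y" using f(3) vact_tau[OF c(1) e_in] c by (simp add: vstab_def y_def)
    then obtain b where b: "b \<in> T\<^sub>B" "b \<in> vstab y" "b \<in> carrier G" "inv c \<otimes> b \<in> H"
      using transversal_pick[OF TB vstab_xy_subgroup(2) H_subgroup] by metis
    have "act (inv c \<otimes> b) e = e" using b(4) by (simp add: H_def estab_def)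
    then have fb: "f = act b e"
      using act_mult[of "inv c" b e] act_eq_move[of "inv c" "act b e" e] b c e_in act_in fc by auto
    define g' where "g' = inv b \<otimes> g"
    have g': "g' \<in> carrier G" using b g by (simp add: g'_def)
    have "e \<notin> vact g' x"
      using f(2) fb act_mem_vact[of b "vact g' x" e] vact_sub[OF g' xy_sub(1)] e_in b
      by (simp add: g'_def vact_mult vact_inv g xy_sub vact_sub)
    then have g'npos: "g' \<notin> Dpos" by (simp add: Dpos_def)
    have "card (y - vact g' x) = card (y - vact g x)" using move[of b y] b xy_sub by (simp add: g'_def vstab_def)
    moreover have "vact b x = tau (st f)" using vact_x[OF b(3)] fb by simp
    then have "Suc (card (x - vact g' x)) = card (y - vact g x)"
      using move[of b x] b xy_sub card_flip_y[OF g, of f e] f e_in by (simp add: g'_def y_def)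
    moreover have "st e \<notin> vact g x" using 4 not_Dpos_iff[OF g] by blast
    then have "Suc (card (y - vact g x)) = card (x - vact g x)"
      using card_flip_y[OF g, of "st e" "st e"] st_e_in tau_mem st_st[OF e_in] by (simp add: x_def y_def)
    ultimately obtain ps h where ps: "nf ps h" "amalgam_value G ps h = g'"
      using less.hyps[OF _ g'] by force
    have bg: "b \<otimes> g' = g" using b g by (simp add: g'_def m_assoc[symmetric])
    have b1: "b \<noteq> \<one>" using bg g'npos 4 g' by auto
    show ?thesis
    proof (cases "g' \<in> H")
      case True
      then show ?thesis using one b bg
        by (intro exI[of _ "[(\<one>, b)]"] exI[of _ g']) (simp add: nf_Cons amalgam_value_def)
    next
      case False
      then have "fst (hd ps) \<noteq> \<one>" using nf_side[OF ps(1)] ps(2) g'npos by (auto split: if_splits)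
      then have "nf ((\<one>, b) # ps) h"
        using ps(1) one b b1 by (simp add: nf_Cons) (simp add: amalgam_normal_form_def)
      then show ?thesis using ps(2) bg b by (intro exI[of _ "(\<one>, b) # ps"] exI[of _ h]) (simp add: amalgam_value_Cons)
    qed
  qed
qed

lemma amalgam_Z_eq: "amalgam_Z G T\<^sub>A T\<^sub>B H = Dneg"
proof
  show "amalgam_Z G T\<^sub>A T\<^sub>B H \<subseteq> Dneg" using nf_side by (auto simp: amalgam_Z_def)
  show "Dneg \<subseteq> amalgam_Z G T\<^sub>A T\<^sub>B H"
  proof
    fix g assume g: "g \<in> Dneg"
    then have gc: "g \<in> carrier G" by (simp add: Dneg_def)
    then obtain ps h where ps: "nf ps h" "amalgam_value G ps h = g" using nf_exists by blast
    have "fst (hd ps) \<noteq> \<one>" using nf_side[OF ps(1)] ps(2) g side_cases[OF gc] by (auto split: if_splits)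
    then show "g \<in> amalgam_Z G T\<^sub>A T\<^sub>B H" using ps by (auto simp: amalgam_Z_def)
  qed
qed

end

lemma amalgam_determined: "Dpos \<in> determined_sets G (Amalgam (vstab x) (vstab y) H)"
proof -
  obtain T\<^sub>A T\<^sub>B where T: "transversal G (vstab x) H T\<^sub>A" "transversal G (vstab y) H T\<^sub>B"
    using transversal_exists vstab_xy_subgroup H_subgroup H_sub by metis
  have "Dpos \<in> four_sets G H (amalgam_Z G T\<^sub>A T\<^sub>B H)"
    unfolding amalgam_Z_eq[OF T] using complement_Dneg by (simp add: four_sets_def)
  then show ?thesis using T by auto
qed

end

section \<open>HNN extensions: the two ends of the edge lie in one orbit\<close>

locale hnn_edge = one_edge G E le st act e
  for G :: "'a monoid" (structure) and E :: "'e set" and le (infix "\<preceq>" 50) and st and act and e +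
  fixes s :: 'a
  assumes s_in: "s \<in> carrier G" and s_swap: "vact s x = y"
begin

definition H1 where "H1 = (\<lambda>h. inv s \<otimes> h \<otimes> s) ` H"

text \<open>The two orbits of edges that end at \<open>x\<close>, and the letters that cross them in reverse.\<close>
definition m :: "bool \<Rightarrow> 'e" where "m b = (if b then st e else act (inv s) e)"
definition sg :: "bool \<Rightarrow> 'a" where "sg b = (if b then s else inv s)"

lemma sg_in: "sg b \<in> carrier G"
  by (simp add: sg_def s_in)

lemma m_in: "m b \<in> E"
  by (simp add: m_def st_e_in act_in s_in e_in)

lemma tau_m: "tau (m b) = x"
proof (cases b)
  case True then show ?thesis by (simp add: m_def x_def)
next
  case False
  then show ?thesis using vact_inv(1)[OF s_in xy_sub(1)] vact_y[of "inv s"] s_in s_swap by (simp add: m_def)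
qed

lemma sg_m: "act (sg b) (m (\<not> b)) = st (m b)" "act (sg b) (st (m (\<not> b))) = m b"
proof -
  show "act (sg b) (m (\<not> b)) = st (m b)"
    by (simp add: sg_def m_def s_in e_in act_inv act_st st_st)
  then show "act (sg b) (st (m (\<not> b))) = m b"
    using act_st[OF sg_in m_in] st_st[OF m_in] by simp
qed

text \<open>\<open>sg b\<close> carries \<open>m (\<not> b)\<close> to the reverse of
  \<open>m b\<close>, so a common orbit would produce an inversion.\<close>

lemma m_not_orbit: "g \<in> carrier G \<Longrightarrow> act g (m b) \<noteq> m (\<not> b)"
proof
  assume g: "g \<in> carrier G" "act g (m b) = m (\<not> b)"
  then have "act (sg b \<otimes> g) (m b) = st (m b)" using sg_m(1) by (simp add: act_mult sg_in m_in)
  then show False using no_inversion[of "sg b \<otimes> g" "m b"] g sg_in m_in by simp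
qed

lemma H_closed: "h \<in> H \<Longrightarrow> h \<in> carrier G"
  by (simp add: H_def estab_def)

lemma estab_m: "estab (m b) = (if b then H else H1)"
proof (cases b)
  case True then show ?thesis by (simp add: m_def H_def estab_st e_in)
next
  case False
  have "h \<in> estab (act (inv s) e) \<longleftrightarrow> h \<in> H1" for h
  proof
    assume h: "h \<in> estab (act (inv s) e)"
    then have hc: "h \<in> carrier G" by (simp add: estab_def)
    then have "s \<otimes> h \<otimes> inv s \<in> H" using mem_estab_act[of "inv s" e h] h s_in e_in by (simp add: H_def)
    moreover have "h = inv s \<otimes> (s \<otimes> h \<otimes> inv s) \<otimes> s"
      using hc s_in by (simp add: m_assoc inv_solve_left)
    ultimately show "h \<in> H1" unfolding H1_def by blast
  next
    assume "h \<in> H1"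
    then obtain k where k: "k \<in> H" "h = inv s \<otimes> k \<otimes> s" by (auto simp: H1_def)
    then have kc: "k \<in> carrier G" using H_closed by blast
    have "s \<otimes> h \<otimes> inv s = k" using k kc s_in by (simp add: m_assoc) (simp add: m_assoc[symmetric])
    then show "h \<in> estab (act (inv s) e)"
      using mem_estab_act[of "inv s" e h] k kc s_in e_in by (simp add: H_def)
  qed
  then show ?thesis using False by (auto simp: m_def)
qed

lemma H1_subgroup: "subgroup H1 G"
  using estab_subgroup[OF m_in[of False]] estab_m[of False] by simp

lemma H1_sub: "H1 \<subseteq> vstab x"
  using estab_sub_vstab[OF m_in[of False]] estab_m[of False] tau_m by simp

lemma hnn_quotient:
  "tree_quotient G E le st act {0} (\<lambda>_. x) {0} (\<lambda>_. e) (\<lambda>_. 0) (\<lambda>_. 0) (\<lambda>_. s)"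
  by unfold_locales (use e_in st_e_in one_orbit s_in s_swap in \<open>auto simp: x_def y_def\<close>)

lemma hnn_iso:
  "induced_map G (hnn_letter_value G s) \<in>
     iso (hnn_extension (G\<lparr>carrier := vstab x\<rparr>) H id (\<lambda>h. inv s \<otimes> h \<otimes> s)) G"
proof -
  interpret Q: tree_quotient G E le st act "{0}" "\<lambda>_. x" "{0}" "\<lambda>_. e" "\<lambda>_. 0" "\<lambda>_. 0" "\<lambda>_. s"
    by (rule hnn_quotient)
  let ?A = "vstab x"
  let ?L = "Base ` ?A \<union> range Stable :: 'a hnn_letter set"
  let ?R = "group_rels Base (G\<lparr>carrier := ?A\<rparr>) \<union>
        {([Stable True, Stable False], []), ([Stable False, Stable True], [])} \<union>
        {([Stable False, Base (id h), Stable True], [Base (inv s \<otimes> h \<otimes> s)]) | h. h \<in> H}"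
  note A = vstab_xy_subgroup(1)
  interpret A: subgroup ?A G by (rule A)
  have RA: "group_rels Base (G\<lparr>carrier := ?A\<rparr>) \<subseteq> ?R" by auto
  have st: "word_cong ?R [Stable b, Stable (\<not> b)] []" for b
    using word_cong.rel[of "[Stable b, Stable (\<not> b)]" "[]" ?R "[]" "[]"] by (cases b) auto
  have H1x: "inv s \<otimes> h \<otimes> s \<in> ?A" if "h \<in> H" for h using H1_sub that by (auto simp: H1_def)
  have pres: "presentation G ?L ?R (hnn_letter_value G s)"
  proof
    fix l assume l: "l \<in> ?L"
    show "\<exists>w\<in>lists ?L. word_cong ?R (l # w) [] \<and> word_cong ?R (w @ [l]) []"
    proof (cases l)
      case (Base a)
      then have a: "a \<in> ?A" using l by auto
      then show ?thesis
        using group_rels_inverse[OF subgroup_imp_group[OF A] RA, of a] Base m_inv_consistent[OF A a]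
        by (intro bexI[of _ "[Base (inv a)]"]) auto
    next
      case (Stable b)
      then show ?thesis using st[of b] st[of "\<not> b"] by (intro bexI[of _ "[Stable (\<not> b)]"]) auto
    qed
  next
    fix u v assume uv: "(u, v) \<in> ?R"
    then show "u \<in> lists ?L \<and> v \<in> lists ?L"
      using H_sub H1x by (auto simp: group_rels_def)
    have "h \<in> carrier G" if "h \<in> H" for h using H_closed that .
    with uv show "word_eval G (hnn_letter_value G s) u = word_eval G (hnn_letter_value G s) v"
      using s_in by (auto simp: group_rels_def word_eval_def m_assoc)
  qed (use s_in in auto)
  let ?\<psi> = "\<lambda>l :: (nat, nat, 'a) gog_letter. case l of Vert v a \<Rightarrow> [Base a] | Edge i b \<Rightarrow> [Stable b]"
  have one: "word_cong ?R [Base \<one>] []"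
    using word_cong_group_rels_one[OF RA, of "[]" "[]"] by simp
  have "induced_map G (hnn_letter_value G s) \<in> iso (presented_group ?L ?R) G"
  proof (rule Q.translate_iso[OF pres, of 0 ?\<psi>])
    fix l assume "l \<in> Q.L"
    then show "?\<psi> l \<in> lists ?L \<and> word_eval G (hnn_letter_value G s) (?\<psi> l) = Q.val l"
      using s_in by (cases l) (auto simp: Q.Vert_in_L word_eval_def)
  next
    fix p q assume "(p, q) \<in> Q.R"
    then show "word_cong ?R (concat (map ?\<psi> p)) (concat (map ?\<psi> q))"
    proof (cases rule: Q.gog_relsE)
      case (mult v a b)
      then show ?thesis
        using word_cong_group_rels_mult[OF RA, of a b "[]" "[]"] by simp
    next
      case (one v)
      then show ?thesis using \<open>word_cong ?R [Base \<one>] []\<close> by auto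
    next
      case (edge i b)
      then show ?thesis using st[of b] by simp
    next
      case (conj i h)
      then have "h \<in> H" by (simp add: H_def)
      then have "([Stable False, Base h, Stable True], [Base (inv s \<otimes> h \<otimes> s)]) \<in> ?R" by auto
      from word_cong.rel[OF this, of "[]" "[]"] show ?thesis using conj by simp
    qed
  next
    fix w :: "'a hnn_letter list" assume "w \<in> lists ?L"
    then show "\<exists>p. Q.path {0} 0 0 p \<and> word_cong ?R (concat (map ?\<psi> p)) w"
    proof (induction w rule: rev_induct)
      case Nil
      have "Q.path {0} 0 0 [Vert 0 \<one>]" by (rule gog_path.at_vertex) simp_all
      then show ?case using one by (intro exI[of _ "[Vert 0 \<one>]"]) simp
    next
      case (snoc l w)
      then obtain p where p: "Q.path {0} 0 0 p" "word_cong ?R (concat (map ?\<psi> p)) w" by auto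
      show ?case
      proof (cases l)
        case (Base a)
        then have a: "a \<in> ?A" using snoc.prems by auto
        obtain q c where q: "p = q @ [Vert 0 c]" "c \<in> ?A" "\<And>c. c \<in> ?A \<Longrightarrow> Q.path {0} 0 0 (q @ [Vert 0 c])"
          using Q.path_last[OF subset_refl p(1)] by auto
        have "word_cong ?R (concat (map ?\<psi> q) @ [Base (c \<otimes> a)]) (concat (map ?\<psi> q) @ [Base c, Base a])"
          using word_cong.sym[OF word_cong_group_rels_mult[OF RA, of c a "concat (map ?\<psi> q)" "[]"]] q(2) a by simp
        also have "word_cong ?R (concat (map ?\<psi> q) @ [Base c, Base a]) (w @ [Base a])"
          using word_cong_context[OF p(2), of "[]" "[Base a]"] q(1) by simp
        finally show ?thesis using q(3)[OF A.m_closed[OF q(2) a]] Base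
          by (intro exI[of _ "q @ [Vert 0 (c \<otimes> a)]"]) simp
      next
        case (Stable b)
        have p1: "Q.path {0} 0 0 (p @ [Edge 0 b, Vert 0 \<one>])"
          using Q.path_step[of "{0}" 0 0 b p \<one>] p(1) by (simp add: Q.sv_def)
        have "word_cong ?R (concat (map ?\<psi> p) @ [Stable b] @ [Base \<one>]) (w @ [Stable b] @ [])"
          by (rule word_cong_append[OF p(2) word_cong_append[OF word_cong.refl one]])
        then show ?thesis using p1 Stable by (intro exI[of _ "p @ [Edge 0 b, Vert 0 \<one>]"]) simp
      qed
    qed
  qed (use one in simp_all)
  then show ?thesis by (simp add: hnn_extension_def)
qed

lemma hnn_is_splitting: "is_splitting G (HNN (vstab x) H H1 s)"
  using vstab_xy_subgroup H_subgroup H_sub H1_subgroup H1_sub s_in hnn_iso by (simp add: H1_def)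

text \<open>The analogue of \<open>Dpos\<close> for either kind of edge at \<open>x\<close>, as a
  normal form may involve the stable letter or its inverse.\<close>

definition U :: "bool \<Rightarrow> 'a set" where "U b = {g \<in> carrier G. st (m b) \<in> vact g x}"

lemma U_True: "U True = Dpos"
  by (simp add: U_def Dpos_def m_def st_st e_in)

lemma vact_x_tau: "g \<in> carrier G \<Longrightarrow> \<exists>d\<in>E. vact g x = tau d"
  using vact_x act_in e_in st_in by metis

lemma not_U_iff: "g \<in> carrier G \<Longrightarrow> g \<notin> U b \<longleftrightarrow> m b \<in> vact g x"
  using vact_x_tau[of g] tau_xor m_in unfolding U_def by blast

lemma sg_mult_U:
  assumes "r \<in> carrier G" "r \<notin> U (\<not> b)"
  shows "sg b \<otimes> r \<in> U b"
proof -
  have "m (\<not> b) \<in> vact r x" using assms not_U_iff by blast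
  then have "act (sg b) (m (\<not> b)) \<in> vact (sg b \<otimes> r) x"
    using assms sg_in m_in xy_sub vact_sub by (simp add: vact_mult act_mem_vact)
  then show ?thesis using assms sg_in sg_m by (simp add: U_def)
qed

text \<open>Ping-pong at \<open>x\<close>: no vertex lies behind two different edges that enter
  \<open>x\<close>, here \<open>act a (m b)\<close> and \<open>m c\<close>. For
  \<open>c = (\<not> b)\<close> these are even in different orbits, so \<open>a\<close> may be
  trivial.\<close>

lemma U_separate:
  assumes "a \<in> vstab x" "q \<in> U b" "a \<notin> estab (m b) \<or> c = (\<not> b)"
  shows "a \<otimes> q \<notin> U c"
proof -
  have a: "a \<in> carrier G" "q \<in> carrier G" using assms by (auto simp: vstab_def U_def)
  obtain d where d: "d \<in> E" "vact (a \<otimes> q) x = tau d" using vact_x_tau a by blast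
  have am: "act a (m b) \<in> E" using a m_in act_in by blast
  have "act a (st (m b)) \<in> vact (a \<otimes> q) x"
    using assms a m_in st_in xy_sub vact_sub by (simp add: vact_mult act_mem_vact U_def)
  then have "st (act a (m b)) \<in> tau d" using d a m_in act_st by simp
  moreover have "tau (act a (m b)) = tau (m c)"
    using vact_tau[OF a(1) m_in] tau_m assms(1) by (simp add: vstab_def)
  moreover have "act a (m b) \<noteq> m c"
  proof (cases "c = (\<not> b)")
    case True
    then show ?thesis using m_not_orbit a by blast
  next
    case False
    then show ?thesis using assms a by (simp add: estab_def)
  qed
  ultimately have "m c \<in> tau d" using separate[OF am m_in _ _ d(1)] by blast
  then show ?thesis using not_U_iff[of "a \<otimes> q" c] a d by simp
qed

context
  fixes T\<^sub>1 T\<^sub>2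
  assumes T1: "transversal G (vstab x) H T\<^sub>1" and T2: "transversal G (vstab x) H1 T\<^sub>2"
begin

definition T where "T b = (if b then T\<^sub>1 else T\<^sub>2)"

lemma T_trans: "transversal G (vstab x) (estab (m b)) (T b)"
  using T1 T2 by (simp add: T_def estab_m)

lemma T_sub: "a \<in> T b \<Longrightarrow> a \<in> vstab x \<and> a \<in> carrier G"
  using T_trans[of b] by (auto simp: transversal_def vstab_def)

lemma T_estab: "a \<in> T b \<Longrightarrow> a \<noteq> \<one> \<Longrightarrow> a \<notin> estab (m b)"
  using transversal_one[OF T_trans vstab_xy_subgroup(1) estab_subgroup[OF m_in]] by blast

abbreviation nf where "nf \<equiv> hnn_normal_form G (vstab x) T\<^sub>1 T\<^sub>2"

lemma nf_Nil: "nf [] g \<longleftrightarrow> g \<in> vstab x"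
  by (simp add: hnn_normal_form_def)

lemma nf_Cons:
  "nf ((a, b) # ps) g \<longleftrightarrow> a \<in> T b \<and> nf ps g \<and>
     (ps \<noteq> [] \<and> snd (hd ps) \<noteq> b \<longrightarrow> fst (hd ps) \<noteq> \<one>)"
proof (cases ps)
  case Nil
  then show ?thesis by (auto simp: hnn_normal_form_def T_def)
next
  case (Cons p ps')
  have split: "(\<forall>i. Q i) \<longleftrightarrow> Q 0 \<and> (\<forall>i. Q (Suc i))" for Q :: "nat \<Rightarrow> bool"
    by (metis nat.exhaust)
  have "(\<forall>i. Suc i < length ((a, b) # ps) \<and> snd (((a, b) # ps) ! i) \<noteq> snd (((a, b) # ps) ! Suc i) \<longrightarrow>
      fst (((a, b) # ps) ! Suc i) \<noteq> \<one>) \<longleftrightarrow>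
    (snd (hd ps) \<noteq> b \<longrightarrow> fst (hd ps) \<noteq> \<one>) \<and>
    (\<forall>i. Suc i < length ps \<and> snd (ps ! i) \<noteq> snd (ps ! Suc i) \<longrightarrow> fst (ps ! Suc i) \<noteq> \<one>)"
    using Cons by (subst split) auto
  then show ?thesis using Cons by (auto simp: hnn_normal_form_def T_def)
qed

lemma hnn_value_Cons: "hnn_value G s ((a, b) # ps) g = a \<otimes> sg b \<otimes> hnn_value G s ps g"
  by (simp add: hnn_value_def sg_def)

text \<open>The word is reduced, so its tail is not in \<open>U (\<not> b)\<close>; the stable
  letter therefore carries it into \<open>U b\<close>, and a nontrivial representative
  \<open>a\<close> in front takes it out of both sets again.\<close>

lemma nf_side:
  "nf ps h \<Longrightarrow> hnn_value G s ps h \<in> carrier G \<and>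
    (\<forall>b. hnn_value G s ps h \<in> U b \<longleftrightarrow> ps \<noteq> [] \<and> fst (hd ps) = \<one> \<and> snd (hd ps) = b)"
proof (induction ps)
  case Nil
  then have "h \<in> vstab x" by (simp add: nf_Nil)
  then have h: "h \<in> vstab x" "h \<in> carrier G" by (simp_all add: vstab_def)
  have "h \<notin> U b" for b using not_U_iff[OF h(2)] tau_mem[OF m_in[of b]] tau_m h by (simp add: vstab_def)
  then show ?case using h by (simp add: hnn_value_def)
next
  case (Cons p ps)
  obtain a b where p: "p = (a, b)" by force
  with Cons.prems have ab: "a \<in> T b" "nf ps h" and
    rest: "ps \<noteq> [] \<and> snd (hd ps) \<noteq> b \<Longrightarrow> fst (hd ps) \<noteq> \<one>" by (auto simp: nf_Cons)
  define r where "r = hnn_value G s ps h"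
  have r: "r \<in> carrier G" "r \<notin> U (\<not> b)" using Cons.IH[OF ab(2)] rest by (auto simp: r_def)
  note c = T_sub[OF ab(1)]
  define q where "q = sg b \<otimes> r"
  have q: "q \<in> U b" "q \<in> carrier G" using sg_mult_U[OF r] r sg_in by (simp_all add: q_def)
  have v: "hnn_value G s (p # ps) h = a \<otimes> q"
    using p c r sg_in by (simp add: hnn_value_Cons r_def[symmetric] q_def m_assoc)
  have "a \<otimes> q \<in> U d \<longleftrightarrow> a = \<one> \<and> b = d" for d
  proof (cases "d = (\<not> b)")
    case True
    then show ?thesis using U_separate[of a q b d] c q by simp
  next
    case False
    then have [simp]: "d = b" by auto
    show ?thesis using U_separate[of a q b b] c q T_estab[OF ab(1)] by (cases "a = \<one>") simp_all
  qed
  then show ?case using v p c q by auto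
qed

text \<open>Induction on the distance from \<open>x\<close> to \<open>vact g x\<close>. The first
  edge on the way is the reverse of \<open>f\<close>; it is crossed by \<open>k\<close>, a coset
  representative followed by a stable letter.\<close>

lemma nf_exists:
  "g \<in> carrier G \<Longrightarrow> \<exists>ps h. nf ps h \<and> hnn_value G s ps h = g"
proof (induction "card (x - vact g x)" arbitrary: g)
  case 0
  note g = 0(2)
  obtain d where d: "d \<in> E" "vact g x = tau d" using vact_x_tau[OF g] by blast
  have "vact g x = x"
    using 0(1) d finite_tau_diff[OF st_e_in d(1)] tau_subset_eq[OF st_e_in d(1)] unfolding x_def by auto
  then have "g \<in> vstab x" using g by (simp add: vstab_def)
  then show ?case by (intro exI[of _ "[]"] exI[of _ g]) (simp add: nf_Nil hnn_value_def)
next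
  case (Suc n)
  note g = Suc.prems
  obtain d where d: "d \<in> E" "vact g x = tau d" using vact_x_tau[OF g] by blast
  have "tau (st e) \<noteq> tau d" using Suc.hyps(2) d by (auto simp: x_def)
  then obtain f where f: "f \<in> x" "f \<notin> vact g x" "tau f = x"
    using tau_diff_min[OF st_e_in d(1)] d unfolding x_def by metis
  have fE: "f \<in> E" using f xy_sub by blast
  have "\<exists>c b. c \<in> vstab x \<and> f = act c (m b)"
  proof -
    obtain c where c: "c \<in> carrier G" "f = act c e \<or> f = act c (st e)" using one_orbit[OF fE] by blast
    have "\<exists>c b. c \<in> carrier G \<and> f = act c (m b)"
      using c(2)
    proof
      assume fe: "f = act c e"
      have "act (c \<otimes> s) (m False) = act c e"
        using c s_in e_in by (simp add: m_def act_mult act_in act_inv)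
      then show ?thesis using fe c s_in m_closed by metis
    next
      assume "f = act c (st e)"
      then show ?thesis using c by (intro exI[of _ c] exI[of _ True]) (simp add: m_def)
    qed
    then obtain c b where c: "c \<in> carrier G" "f = act c (m b)" by blast
    then have "vact c x = x" using f(3) vact_tau[OF c(1) m_in[of b]] tau_m by simp
    then show ?thesis using c by (auto simp: vstab_def)
  qed
  then obtain c b where c: "c \<in> vstab x" "c \<in> carrier G" "f = act c (m b)" by (auto simp: vstab_def)
  obtain a where a: "a \<in> T b" "a \<in> vstab x" "a \<in> carrier G" "inv c \<otimes> a \<in> estab (m b)"
    using transversal_pick[OF T_trans vstab_xy_subgroup(1) estab_subgroup[OF m_in] c(1)] by metis
  have fa: "f = act a (m b)"
    using a c act_mult[of "inv c" a "m b"] act_eq_move[of "inv c" "act a (m b)" "m b"] m_in act_in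
    by (auto simp: estab_def)
  define k where "k = a \<otimes> sg b"
  have k: "k \<in> carrier G" using a sg_in by (simp add: k_def)
  define g' where "g' = inv k \<otimes> g"
  have g': "g' \<in> carrier G" using k g by (simp add: g'_def)
  have gk: "g = k \<otimes> g'" using k g by (simp add: g'_def m_assoc[symmetric])
  have "vact k x = vact a (tau (st (m b)))"
    using vact_tau[OF sg_in m_in, of b "\<not> b"] tau_m sg_m(1) a sg_in xy_sub by (simp add: k_def vact_mult)
  also have "\<dots> = tau (st f)" using fa a m_in act_st vact_tau st_in by simp
  finally have "vact k (x - vact g' x) = tau (st f) - vact g x"
    using k g' xy_sub vact_sub gk by (simp add: vact_diff vact_mult)
  then have "card (x - vact g' x) = card (tau (st f) - tau d)"
    using card_vact[of k "x - vact g' x"] k xy_sub d by (metis Diff_subset subset_trans)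
  also have "\<dots> = n" using card_tau_flip[OF fE d(1)] f d Suc.hyps(2) by simp
  finally obtain ps h where ps: "nf ps h" "hnn_value G s ps h = g'" using Suc.hyps(1)[OF _ g'] by metis
  \<comment> \<open>If the rest began with the inverse of the new stable letter, \<open>f\<close>
    would point towards \<open>vact g x\<close>. Hence the new word is reduced.\<close>
  have "g' \<notin> U (\<not> b)"
  proof
    assume "g' \<in> U (\<not> b)"
    then have "act k (st (m (\<not> b))) \<in> vact g x"
      using k g' m_in st_in xy_sub vact_sub unfolding gk by (simp add: vact_mult act_mem_vact U_def)
    moreover have "act k (st (m (\<not> b))) = f"
      using a sg_in m_in st_in sg_m(2)[of b] fa by (simp add: k_def act_mult)
    ultimately show False using f(2) by simp
  qed
  then have "nf ((a, b) # ps) h" using nf_side[OF ps(1)] ps a by (auto simp: nf_Cons)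
  moreover have "hnn_value G s ((a, b) # ps) h = g" using ps(2) gk by (simp add: hnn_value_Cons k_def)
  ultimately show ?case by blast
qed

lemma hnn_Z_eq: "hnn_Z G (vstab x) T\<^sub>1 T\<^sub>2 s = Dpos"
proof
  show "hnn_Z G (vstab x) T\<^sub>1 T\<^sub>2 s \<subseteq> Dpos"
    unfolding U_True[symmetric] hnn_Z_def using nf_side by blast
  show "Dpos \<subseteq> hnn_Z G (vstab x) T\<^sub>1 T\<^sub>2 s"
  proof
    fix g assume g: "g \<in> Dpos"
    then have "g \<in> carrier G" by (simp add: Dpos_def)
    then obtain ps h where ps: "nf ps h" "hnn_value G s ps h = g" using nf_exists by blast
    then show "g \<in> hnn_Z G (vstab x) T\<^sub>1 T\<^sub>2 s"
      using nf_side[OF ps(1)] g unfolding U_True[symmetric] by (auto simp: hnn_Z_def)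
  qed
qed

end

lemma hnn_determined: "Dpos \<in> determined_sets G (HNN (vstab x) H H1 s)"
proof -
  obtain T\<^sub>1 T\<^sub>2 where T: "transversal G (vstab x) H T\<^sub>1" "transversal G (vstab x) H1 T\<^sub>2"
    using transversal_exists vstab_xy_subgroup H_subgroup H_sub H1_subgroup H1_sub by metis
  have "Dpos \<in> four_sets G H (hnn_Z G (vstab x) T\<^sub>1 T\<^sub>2 s)"
    unfolding hnn_Z_eq[OF T] by (simp add: four_sets_def)
  then show ?thesis using T by auto
qed

end

section \<open>Coarse geometry of nested sets\<close>

locale fg_group = group G for G :: "'a monoid" (structure) +
  fixes S :: "'a set"
  assumes finite_S: "finite S" and S_sub: "S \<subseteq> carrier G" and S_gen: "generate G S = carrier G"
    and S_inv: "s \<in> S \<Longrightarrow> inv s \<in> S"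
begin

primrec ball :: "nat \<Rightarrow> 'a set" where
  "ball 0 = {\<one>}"
| "ball (Suc n) = ball n \<union> (\<lambda>(b, s). b \<otimes> s) ` (ball n \<times> S)"

lemma ball_sub: "ball n \<subseteq> carrier G"
  by (induction n) (use S_sub in auto)

lemma ball_closed: "b \<in> ball n \<Longrightarrow> b \<in> carrier G"
  using ball_sub by blast

lemma S_closed: "s \<in> S \<Longrightarrow> s \<in> carrier G"
  using S_sub by blast

lemma finite_ball: "finite (ball n)"
  by (induction n) (use finite_S in auto)

lemma ball_mono: "m \<le> n \<Longrightarrow> ball m \<subseteq> ball n"
  by (rule lift_Suc_mono_le[of ball]) auto

lemma one_ball: "\<one> \<in> ball n"
  using ball_mono[of 0 n] by auto

lemma ball_mult: "a \<in> ball m \<Longrightarrow> b \<in> ball n \<Longrightarrow> a \<otimes> b \<in> ball (m + n)"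
proof (induction n arbitrary: b)
  case (Suc n)
  from Suc.prems(2) consider "b \<in> ball n" | c s where "c \<in> ball n" "s \<in> S" "b = c \<otimes> s" by auto
  then show ?case
  proof cases
    case 1
    then show ?thesis using Suc.IH[OF Suc.prems(1)] by simp
  next
    case 2
    then have "a \<otimes> b = (a \<otimes> c) \<otimes> s"
      using Suc.prems(1) ball_closed S_closed by (simp add: m_assoc)
    then show ?thesis using Suc.IH[OF Suc.prems(1) 2(1)] 2(2) by auto
  qed
qed (use ball_closed in auto)

lemma S_ball: "s \<in> S \<Longrightarrow> s \<in> ball 1"
  using S_closed by (auto intro!: image_eqI[of _ _ "(\<one>, s)"])

lemma ball_inv: "b \<in> ball n \<Longrightarrow> inv b \<in> ball n"
proof (induction n arbitrary: b)
  case (Suc n)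
  from Suc.prems consider "b \<in> ball n" | c s where "c \<in> ball n" "s \<in> S" "b = c \<otimes> s" by auto
  then show ?case
  proof cases
    case 1
    then show ?thesis using Suc.IH by simp
  next
    case 2
    then have "inv b = inv s \<otimes> inv c" using ball_closed S_closed by (simp add: inv_mult_group)
    then show ?thesis using ball_mult[OF S_ball[OF S_inv[OF 2(2)]] Suc.IH[OF 2(1)]] by simp
  qed
qed simp

lemma ball_exhaust: "g \<in> carrier G \<Longrightarrow> \<exists>n. g \<in> ball n"
proof -
  assume "g \<in> carrier G"
  then have "g \<in> generate G S" using S_gen by simp
  then show ?thesis
  proof induction
    case one
    then show ?case using one_ball by blast
  next
    case (incl h)
    then show ?case using S_ball by blast
  next
    case (inv h)
    then show ?case using S_ball S_inv by blast
  next
    case (eng h1 h2)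
    then show ?case using ball_mult by blast
  qed
qed

lemma finite_sub_ball:
  assumes "finite A" "A \<subseteq> carrier G"
  shows "\<exists>n. A \<subseteq> ball n"
  using assms
proof (induction A)
  case (insert a A)
  then obtain n m where "A \<subseteq> ball n" "a \<in> ball m" using ball_exhaust by blast
  then have "insert a A \<subseteq> ball (max m n)" using ball_mono[of m "max m n"] ball_mono[of n "max m n"] by auto
  then show ?case by blast
qed simp

text \<open>The ends, on both sides, of the Cayley graph edges that join \<open>U\<close> to its
  complement; hence a set and its complement have the same boundary.\<close>

definition bd :: "'a set \<Rightarrow> 'a set" where
  "bd U = {x \<in> carrier G. \<exists>s\<in>S. x \<in> U \<longleftrightarrow> x \<otimes> s \<notin> U}"

definition nb :: "nat \<Rightarrow> 'a set \<Rightarrow> 'a set" where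
  "nb n U = {x \<otimes> b | x b. x \<in> bd U \<and> b \<in> ball n}"

lemma bd_sub: "bd U \<subseteq> carrier G"
  by (auto simp: bd_def)

lemma bd_closed: "x \<in> bd U \<Longrightarrow> x \<in> carrier G"
  by (simp add: bd_def)

lemma nbI: "x \<in> bd U \<Longrightarrow> b \<in> ball n \<Longrightarrow> x \<otimes> b \<in> nb n U"
  by (auto simp: nb_def)

lemma nb_sub: "nb n U \<subseteq> carrier G"
  using bd_closed ball_closed by (auto simp: nb_def)

lemma nb_mono: "m \<le> n \<Longrightarrow> nb m U \<subseteq> nb n U"
  using ball_mono by (fastforce simp: nb_def)

lemma bd_nb: "bd U \<subseteq> nb n U"
  using nbI[OF _ one_ball] bd_sub by fastforce

lemma nb_ball:
  assumes "x \<in> nb m U" "b \<in> ball n"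
  shows "x \<otimes> b \<in> nb (m + n) U"
proof -
  obtain y c where y: "y \<in> bd U" "c \<in> ball m" "x = y \<otimes> c" using assms by (auto simp: nb_def)
  then have "x \<otimes> b = y \<otimes> (c \<otimes> b)" using assms bd_closed ball_closed by (simp add: m_assoc)
  then show ?thesis using nbI[OF y(1) ball_mult[OF y(2) assms(2)]] by simp
qed

lemma bd_compl: "bd (carrier G - U) = bd U"
  using S_closed by (auto simp: bd_def)

lemma nb_compl: "nb n (carrier G - U) = nb n U"
  by (simp add: nb_def bd_compl)

lemma mem_tr: "\<lbrakk>g \<in> carrier G; U \<subseteq> carrier G; x \<in> carrier G\<rbrakk> \<Longrightarrow> x \<in> g <# U \<longleftrightarrow> inv g \<otimes> x \<in> U"
  using mem_lcoset by blast

lemma mult_mem_tr: "\<lbrakk>g \<in> carrier G; U \<subseteq> carrier G; x \<in> carrier G\<rbrakk> \<Longrightarrow> g \<otimes> x \<in> g <# U \<longleftrightarrow> x \<in> U"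
  using mem_tr[of g U "g \<otimes> x"] by (simp add: m_assoc[symmetric])

lemma tr_sub: "\<lbrakk>g \<in> carrier G; U \<subseteq> carrier G\<rbrakk> \<Longrightarrow> g <# U \<subseteq> carrier G"
  by (rule l_coset_subset_G)

lemma tr_inv: "\<lbrakk>g \<in> carrier G; U \<subseteq> carrier G\<rbrakk> \<Longrightarrow> inv g <# (g <# U) = U"
  "\<lbrakk>g \<in> carrier G; U \<subseteq> carrier G\<rbrakk> \<Longrightarrow> g <# (inv g <# U) = U"
  by (simp_all add: lcos_m_assoc lcos_mult_one)

lemma tr_diff:
  assumes "g \<in> carrier G" "U \<subseteq> carrier G" "W \<subseteq> carrier G"
  shows "g <# (U - W) = (g <# U) - (g <# W)"
proof -
  have "x \<in> g <# (U - W) \<longleftrightarrow> x \<in> (g <# U) - (g <# W)" if "x \<in> carrier G" for x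
    using that assms mem_tr[of g U x] mem_tr[of g W x] mem_tr[of g "U - W" x] by blast
  then show ?thesis using tr_sub[OF assms(1,2)] tr_sub[of g "U - W"] assms by blast
qed

lemma tr_carrier: "g \<in> carrier G \<Longrightarrow> g <# carrier G = carrier G"
  using coset_join3[OF _ subgroup_self] by blast

lemma tr_compl: "\<lbrakk>g \<in> carrier G; U \<subseteq> carrier G\<rbrakk> \<Longrightarrow> g <# (carrier G - U) = carrier G - (g <# U)"
  using tr_diff[of g "carrier G" U] tr_carrier by simp

lemma tr_mono: "U \<subseteq> W \<Longrightarrow> g <# U \<subseteq> g <# W"
  by (auto simp: l_coset_def)

lemma tr_mono_iff: "\<lbrakk>g \<in> carrier G; U \<subseteq> carrier G; W \<subseteq> carrier G\<rbrakk> \<Longrightarrow> g <# U \<subseteq> g <# W \<longleftrightarrow> U \<subseteq> W"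
  using tr_mono[of U W g] tr_mono[of "g <# U" "g <# W" "inv g"] tr_inv by auto

lemma bd_tr:
  assumes "g \<in> carrier G" "U \<subseteq> carrier G"
  shows "bd (g <# U) = g <# bd U"
proof -
  have "x \<in> bd (g <# U) \<longleftrightarrow> x \<in> g <# bd U" if x: "x \<in> carrier G" for x
  proof -
    have "x \<in> g <# bd U \<longleftrightarrow> inv g \<otimes> x \<in> bd U" using mem_tr[OF assms(1) bd_sub x] .
    also have "\<dots> \<longleftrightarrow> (\<exists>s\<in>S. inv g \<otimes> x \<in> U \<longleftrightarrow> inv g \<otimes> (x \<otimes> s) \<notin> U)"
      using x assms S_closed by (auto simp: bd_def m_assoc)
    also have "\<dots> \<longleftrightarrow> x \<in> bd (g <# U)"
      using x assms S_closed mem_tr by (auto simp: bd_def)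
    finally show ?thesis by blast
  qed
  then show ?thesis using bd_sub tr_sub[OF assms(1) bd_sub] by blast
qed

lemma nb_tr:
  assumes "g \<in> carrier G" "U \<subseteq> carrier G"
  shows "nb n (g <# U) = g <# nb n U"
proof -
  have "nb n (g <# U) = {g \<otimes> x \<otimes> b | x b. x \<in> bd U \<and> b \<in> ball n}"
    unfolding nb_def bd_tr[OF assms] by (auto simp: l_coset_def)
  also have "\<dots> = {g \<otimes> (x \<otimes> b) | x b. x \<in> bd U \<and> b \<in> ball n}"
    using assms bd_sub ball_closed by (metis (no_types, opaque_lifting) m_assoc subsetD)
  also have "\<dots> = g <# nb n U" by (auto simp: l_coset_def nb_def)
  finally show ?thesis .
qed

lemma cross:
  assumes "x \<in> carrier G" "b \<in> ball n" "x \<in> U \<longleftrightarrow> x \<otimes> b \<notin> U"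
  shows "\<exists>c\<in>ball n. x \<otimes> c \<in> bd U"
  using assms(2,3)
proof (induction n arbitrary: b)
  case 0
  then show ?case using assms(1) by simp
next
  case (Suc n)
  from Suc.prems(1) consider "b \<in> ball n" | c s where "c \<in> ball n" "s \<in> S" "b = c \<otimes> s" by auto
  then show ?case
  proof cases
    case 1
    then show ?thesis using Suc.IH Suc.prems(2) by auto
  next
    case 2
    note c = ball_closed[OF 2(1)] S_closed[OF 2(2)]
    show ?thesis
    proof (cases "x \<in> U \<longleftrightarrow> x \<otimes> c \<in> U")
      case True
      then have "x \<otimes> c \<in> U \<longleftrightarrow> x \<otimes> c \<otimes> s \<notin> U"
        using Suc.prems(2) 2(3) c assms(1) by (simp add: m_assoc)
      then have "x \<otimes> c \<in> bd U"
        using 2(2) c assms(1) unfolding bd_def by blast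
      then show ?thesis using 2(1) by auto
    next
      case False
      then show ?thesis using Suc.IH[OF 2(1)] by auto
    qed
  qed
qed

lemma cross_nb:
  assumes "x \<in> carrier G" "b \<in> ball n" "x \<in> U \<longleftrightarrow> x \<otimes> b \<notin> U"
  shows "x \<in> nb n U"
proof -
  obtain c where c: "c \<in> ball n" "x \<otimes> c \<in> bd U" using cross[OF assms] by blast
  have "x = (x \<otimes> c) \<otimes> inv c" using assms(1) ball_closed[OF c(1)] by (simp add: m_assoc)
  then show ?thesis using nbI[OF c(2) ball_inv[OF c(1)]] by simp
qed

lemma bd_nonempty:
  assumes "x \<in> U" "y \<notin> U" "x \<in> carrier G" "y \<in> carrier G"
  shows "bd U \<noteq> {}"
proof -
  obtain n where "inv x \<otimes> y \<in> ball n" using ball_exhaust assms by blast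
  moreover have "x \<otimes> (inv x \<otimes> y) = y" using assms by (simp add: m_assoc[symmetric])
  ultimately show ?thesis using cross[of x "inv x \<otimes> y" n U] assms by auto
qed

text \<open>An edge leaving \<open>A \<inter> B\<close> would leave \<open>A\<close> from a point of
  \<open>B\<close> or \<open>B\<close> from a point of \<open>A\<close>. So the intersection has no
  boundary in the connected Cayley graph.\<close>

lemma no_boundary_meet:
  assumes "A \<subseteq> carrier G" "B \<subseteq> carrier G" "bd A \<inter> B = {}" "bd B \<inter> A = {}"
  shows "A \<inter> B = {} \<or> A \<inter> B = carrier G"
proof -
  have "bd (A \<inter> B) = {}"
  proof (rule ccontr)
    assume "bd (A \<inter> B) \<noteq> {}"
    then obtain x s where x: "x \<in> carrier G" "s \<in> S" "x \<in> A \<inter> B \<longleftrightarrow> x \<otimes> s \<notin> A \<inter> B" by (auto simp: bd_def)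
    have pass: "z \<otimes> r \<in> A \<inter> B" if "z \<in> A \<inter> B" "r \<in> S" for z r
      using that assms by (auto simp: bd_def subset_iff)
    have "x = (x \<otimes> s) \<otimes> inv s" using x S_closed by (simp add: m_assoc)
    then show False using x pass[of x s] pass[of "x \<otimes> s" "inv s"] S_inv by metis
  qed
  then show ?thesis using bd_nonempty[of _ "A \<inter> B"] assms by blast
qed

text \<open>Smallness of \<open>U - W\<close> without mention of a subgroup: if \<open>U\<close> is
  a nontrivial almost invariant set for \<open>L\<close>, a set is \<open>L\<close>-finite exactly
  if it stays near the boundary of \<open>U\<close>.\<close>

definition csub :: "'a set \<Rightarrow> 'a set \<Rightarrow> bool" where
  "csub U W \<longleftrightarrow> (\<exists>d. U - W \<subseteq> nb d U)"

text \<open>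
  Coarse containment \<open>csub\<close> is only a preorder.  Inside each class of mutually coarsely contained
  sets, which are linearly ordered by inclusion in the situation considered below, it is refined
  by inclusion.
\<close>
definition sle :: "'a set \<Rightarrow> 'a set \<Rightarrow> bool" where
  "sle U W \<longleftrightarrow> U \<subseteq> W \<or> (csub U W \<and> \<not> csub W U)"

lemma subset_csub: "U \<subseteq> W \<Longrightarrow> csub U W"
  by (auto simp: csub_def)

lemma sle_csub: "sle U W \<Longrightarrow> csub U W"
  by (auto simp: sle_def subset_csub)

lemma csub_tr:
  assumes "g \<in> carrier G" "U \<subseteq> carrier G" "W \<subseteq> carrier G"
  shows "csub (g <# U) (g <# W) \<longleftrightarrow> csub U W"
  unfolding csub_def using assms nb_sub
  by (simp add: nb_tr tr_diff[symmetric] tr_mono_iff Diff_subset[THEN subset_trans])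

lemma sle_tr:
  assumes "g \<in> carrier G" "U \<subseteq> carrier G" "W \<subseteq> carrier G"
  shows "sle (g <# U) (g <# W) \<longleftrightarrow> sle U W"
  using assms by (simp add: sle_def csub_tr tr_mono_iff)

definition Stab :: "'a set \<Rightarrow> 'a set" where "Stab U = {k \<in> carrier G. k <# U = U}"

end

text \<open>What the translates retain of almost invariance: \<open>big\<close> is nontriviality,
  \<open>cofinite\<close> says that the stabilizer has finitely many orbits on the boundary, and
  \<open>conn\<close> that, for one radius \<open>n\<close>, a set can cut the neighbourhood of a
  boundary only if its own boundary meets it.\<close>

locale coarse_family = fg_group G S for G :: "'a monoid" (structure) and S +
  fixes F :: "'a set set"
  assumes F_sub: "U \<in> F \<Longrightarrow> U \<subseteq> carrier G"
    and F_compl: "U \<in> F \<Longrightarrow> carrier G - U \<in> F"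
    and F_tr: "\<lbrakk>g \<in> carrier G; U \<in> F\<rbrakk> \<Longrightarrow> g <# U \<in> F"
    and big: "U \<in> F \<Longrightarrow> \<not> U \<subseteq> nb d U"
    and cofinite: "U \<in> F \<Longrightarrow> \<exists>A. finite A \<and> A \<subseteq> carrier G \<and> (\<forall>x\<in>bd U. \<exists>k\<in>Stab U. \<exists>a\<in>A. x = k \<otimes> a)"
    and finite_orbits: "\<exists>Y. finite Y \<and> Y \<subseteq> F \<and> (\<forall>U\<in>F. \<exists>g\<in>carrier G. \<exists>X\<in>Y. U = g <# X)"
    and conn: "\<exists>n. \<forall>U\<in>F. \<forall>W. W \<subseteq> carrier G \<longrightarrow> bd W \<inter> nb n U = {} \<longrightarrow> nb n U \<subseteq> W \<or> nb n U \<inter> W = {}"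
begin

lemma compl_compl: "U \<in> F \<Longrightarrow> carrier G - (carrier G - U) = U"
  using F_sub by blast

lemma nb_cofinite:
  assumes "U \<in> F"
  shows "\<exists>A. finite A \<and> A \<subseteq> carrier G \<and> (\<forall>x\<in>nb d U. \<exists>k\<in>Stab U. \<exists>a\<in>A. x = k \<otimes> a)"
proof -
  obtain A where A: "finite A" "A \<subseteq> carrier G" "\<forall>x\<in>bd U. \<exists>k\<in>Stab U. \<exists>a\<in>A. x = k \<otimes> a"
    using cofinite[OF assms] by blast
  let ?A = "(\<lambda>(a, b). a \<otimes> b) ` (A \<times> ball d)"
  have "\<exists>k\<in>Stab U. \<exists>a\<in>?A. x = k \<otimes> a" if x: "x \<in> nb d U" for x
  proof -
    obtain y b where y: "y \<in> bd U" "b \<in> ball d" "x = y \<otimes> b" using x by (auto simp: nb_def)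
    then obtain k a where k: "k \<in> Stab U" "a \<in> A" "y = k \<otimes> a" using A by blast
    then have "k \<in> carrier G" "a \<in> carrier G" using A(2) by (auto simp: Stab_def)
    then have "x = k \<otimes> (a \<otimes> b)" using k(3) y ball_closed by (simp add: m_assoc)
    then show ?thesis using k y by blast
  qed
  moreover have "finite ?A" "?A \<subseteq> carrier G" using A finite_ball ball_closed by auto
  ultimately show ?thesis by blast
qed

text \<open>\<open>big\<close> provides one point of \<open>U\<close> far from the boundary. Up to
  the stabilizer of \<open>U\<close> the neighbourhood has finitely many points, so one distance
  \<open>D\<close> serves all of them.\<close>

lemma deep:
  assumes "U \<in> F"
  shows "\<exists>D. \<forall>x\<in>nb d U. \<exists>b\<in>ball D. x \<otimes> b \<in> U \<and> x \<otimes> b \<notin> nb d' U"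
proof -
  obtain u where u: "u \<in> U" "u \<notin> nb d' U" using big[OF assms] by blast
  have uc: "u \<in> carrier G" using u F_sub assms by blast
  obtain A where A: "finite A" "A \<subseteq> carrier G" "\<forall>x\<in>nb d U. \<exists>k\<in>Stab U. \<exists>a\<in>A. x = k \<otimes> a"
    using nb_cofinite[OF assms, of d] by blast
  have "finite ((\<lambda>a. inv a \<otimes> u) ` A)" "(\<lambda>a. inv a \<otimes> u) ` A \<subseteq> carrier G" using A(1,2) uc by auto
  then obtain D where D: "(\<lambda>a. inv a \<otimes> u) ` A \<subseteq> ball D" using finite_sub_ball by blast
  have "\<exists>b\<in>ball D. x \<otimes> b \<in> U \<and> x \<otimes> b \<notin> nb d' U" if x: "x \<in> nb d U" for x
  proof -
    obtain k a where k: "k \<in> Stab U" "a \<in> A" "x = k \<otimes> a" using A x by blast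
    have kc: "k \<in> carrier G" "k <# U = U" using k by (auto simp: Stab_def)
    have ac: "a \<in> carrier G" using k A by blast
    have e: "x \<otimes> (inv a \<otimes> u) = k \<otimes> u"
      using k(3) kc ac uc by (simp add: m_assoc) (simp add: m_assoc[symmetric])
    have "k \<otimes> u \<in> U" using mult_mem_tr[OF kc(1) F_sub[OF assms] uc] kc u by simp
    moreover have "k \<otimes> u \<notin> nb d' U"
      using mult_mem_tr[OF kc(1) nb_sub uc, of d' U] nb_tr[OF kc(1) F_sub[OF assms], of d'] kc u by simp
    ultimately show ?thesis using e D k(2) by (intro bexI[of _ "inv a \<otimes> u"]) auto
  qed
  then show ?thesis by blast
qed

text \<open>The symmetry of smallness: from a point of \<open>U - W\<close> one gets within distance
  \<open>D\<close> to a point deep in \<open>U\<close>, which must belong to \<open>W\<close>, so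
  the boundary of \<open>W\<close> is crossed on the way.\<close>

lemma csub_sym_bound:
  assumes "U \<in> F" "csub U W"
  shows "\<exists>D. U - W \<subseteq> nb D W"
proof -
  obtain d where d: "U - W \<subseteq> nb d U" using assms by (auto simp: csub_def)
  obtain D where D: "\<forall>x\<in>nb d U. \<exists>b\<in>ball D. x \<otimes> b \<in> U \<and> x \<otimes> b \<notin> nb d U"
    using deep[OF assms(1)] by blast
  have "x \<in> nb D W" if x: "x \<in> U - W" for x
  proof -
    obtain b where b: "b \<in> ball D" "x \<otimes> b \<in> U" "x \<otimes> b \<notin> nb d U" using x d D by blast
    then have "x \<otimes> b \<in> W" using d by blast
    then show ?thesis using cross_nb[OF _ b(1)] x F_sub[OF assms(1)] by blast
  qed
  then show ?thesis by blast
qed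

lemma csub_compl:
  assumes "U \<in> F" "W \<in> F" "csub U W"
  shows "csub (carrier G - W) (carrier G - U)"
proof -
  have "(carrier G - W) - (carrier G - U) = U - W" using F_sub assms by blast
  then show ?thesis using csub_sym_bound[OF assms(1,3)] by (auto simp: csub_def nb_compl)
qed

lemma csub_compl_iff:
  assumes "U \<in> F" "W \<in> F"
  shows "csub (carrier G - W) (carrier G - U) \<longleftrightarrow> csub U W"
  using csub_compl[OF assms] csub_compl[of "carrier G - W" "carrier G - U"] F_compl assms compl_compl by auto

text \<open>\<open>U - W\<close> is near the boundary of the middle set \<open>V\<close>. Moving
  from there deep into the complement of \<open>V\<close> one leaves \<open>U\<close>, so the
  boundary of \<open>U\<close> is near as well.\<close>

lemma csub_trans:
  assumes "U \<in> F" "V \<in> F" "W \<in> F" "csub U V" "csub V W"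
  shows "csub U W"
proof -
  obtain d1 d2 where d: "U - V \<subseteq> nb d1 V" "V - W \<subseteq> nb d2 V"
    using csub_sym_bound[OF assms(1,4)] assms(5) by (auto simp: csub_def)
  define d where "d = max d1 d2"
  have dd: "U - V \<subseteq> nb d V" "V - W \<subseteq> nb d V"
    using d nb_mono[of d1 d V] nb_mono[of d2 d V] by (auto simp: d_def)
  obtain D where D: "\<forall>x\<in>nb d V. \<exists>b\<in>ball D. x \<otimes> b \<in> carrier G - V \<and> x \<otimes> b \<notin> nb d V"
    using deep[OF F_compl[OF assms(2)], of d d] by (auto simp: nb_compl)
  have "x \<in> nb D U" if x: "x \<in> U - W" for x
  proof -
    have "x \<in> nb d V" using x dd by blast
    then obtain b where b: "b \<in> ball D" "x \<otimes> b \<in> carrier G - V" "x \<otimes> b \<notin> nb d V" using D by blast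
    then have "x \<otimes> b \<notin> U" using dd by blast
    then show ?thesis using cross_nb[OF _ b(1)] x F_sub[OF assms(1)] by blast
  qed
  then show ?thesis by (auto simp: csub_def)
qed

lemma csub_excl:
  assumes "U \<in> F" "csub U W"
  shows "\<not> csub U (carrier G - W)"
proof
  assume "csub U (carrier G - W)"
  then obtain d1 d2 where d: "U - W \<subseteq> nb d1 U" "U - (carrier G - W) \<subseteq> nb d2 U"
    using assms by (auto simp: csub_def)
  have "U \<subseteq> nb (max d1 d2) U" using d nb_mono[of d1 "max d1 d2" U] nb_mono[of d2 "max d1 d2" U] by fastforce
  then show False using big assms by blast
qed

end

section \<open>The nested order and its finite intervals\<close>

locale nested_family = coarse_family G S F for G :: "'a monoid" (structure) and S and F +
  assumes almost: "\<lbrakk>U \<in> F; W \<in> F\<rbrakk> \<Longrightarrow> csub U W \<or> csub U (carrier G - W) \<or> csub (carrier G - U) W \<or> csub (carrier G - U) (carrier G - W)"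
    and good: "\<lbrakk>U \<in> F; W \<in> F; csub U W; csub W U\<rbrakk> \<Longrightarrow> U \<subseteq> W \<or> W \<subseteq> U"
begin

lemma sle_antisym: "\<lbrakk>sle U W; sle W U\<rbrakk> \<Longrightarrow> U = W"
  using subset_csub by (auto simp: sle_def)

text \<open>If \<open>W\<close> is also coarsely contained in \<open>U\<close>, all three sets are
  coarsely equal, and both given relations are inclusions.\<close>

lemma sle_trans:
  assumes "U \<in> F" "V \<in> F" "W \<in> F" "sle U V" "sle V W"
  shows "sle U W"
proof -
  have UW: "csub U W" using csub_trans[OF assms(1-3)] sle_csub assms(4,5) by blast
  show ?thesis
  proof (cases "csub W U")
    case True
    then have "csub V U" "csub W V"
      using csub_trans[of V W U] csub_trans[of W U V] sle_csub assms by blast+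
    then show ?thesis using assms(4,5) by (auto simp: sle_def)
  next
    case False
    then show ?thesis using UW by (simp add: sle_def)
  qed
qed

lemma sle_compl:
  assumes "U \<in> F" "W \<in> F" "sle U W"
  shows "sle (carrier G - W) (carrier G - U)"
  using assms csub_compl_iff[OF assms(1,2)] csub_compl_iff[OF assms(2,1)] by (auto simp: sle_def)

lemma sle_total_of_csub: "\<lbrakk>U \<in> F; W \<in> F; csub U W\<rbrakk> \<Longrightarrow> sle U W \<or> sle W U"
  using good[of U W] by (auto simp: sle_def)

lemma sle_nested:
  assumes "U \<in> F" "W \<in> F"
  shows "sle U W \<or> sle U (carrier G - W) \<or> sle (carrier G - U) W \<or> sle (carrier G - U) (carrier G - W)"
proof -
  have *: "sle V Z \<Longrightarrow> sle (carrier G - Z) (carrier G - V)" if "V \<in> F" "Z \<in> F" for V Z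
    using sle_compl that by blast
  note cc = compl_compl[OF assms(1)] compl_compl[OF assms(2)] F_compl[OF assms(1)] F_compl[OF assms(2)]
  from almost[OF assms] show ?thesis
    using sle_total_of_csub[OF assms] sle_total_of_csub[OF assms(1) F_compl[OF assms(2)]]
      sle_total_of_csub[OF F_compl[OF assms(1)] assms(2)] sle_total_of_csub[OF F_compl[OF assms(1)] F_compl[OF assms(2)]]
      *[of W U] *[of "carrier G - W" U] *[of W "carrier G - U"] *[of "carrier G - W" "carrier G - U"] cc assms
    by auto
qed

lemma sle_excl: "\<lbrakk>U \<in> F; sle U W\<rbrakk> \<Longrightarrow> \<not> sle U (carrier G - W)"
  using csub_excl sle_csub by blast

lemma F_bd_nonempty:
  assumes "U \<in> F"
  obtains x where "x \<in> bd U" "x \<in> carrier G"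
proof -
  obtain u v where "u \<in> U" "v \<in> carrier G - U" using big[OF assms] big[OF F_compl[OF assms]] by blast
  then have "bd U \<noteq> {}" using bd_nonempty[of u U v] F_sub[OF assms] by auto
  then show thesis using that bd_sub by blast
qed

text \<open>If \<open>z\<close> is in the boundary of \<open>g <# X\<close>, then
  \<open>inv g \<otimes> z = k \<otimes> a\<close> with \<open>k\<close> in the stabilizer of
  \<open>X\<close>, so \<open>g <# X\<close> is the translate of \<open>X\<close> by
  \<open>z \<otimes> inv a\<close>. Only finitely many \<open>X\<close> and \<open>a\<close>
  occur.\<close>

lemma locally_finite:
  assumes "z \<in> carrier G"
  shows "finite {W \<in> F. z \<in> bd W}"
proof -
  obtain Y where Y: "finite Y" "Y \<subseteq> F" "\<forall>U\<in>F. \<exists>g\<in>carrier G. \<exists>X\<in>Y. U = g <# X" using finite_orbits by blast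
  have "\<forall>X\<in>Y. \<exists>A. finite A \<and> A \<subseteq> carrier G \<and> (\<forall>x\<in>bd X. \<exists>k\<in>Stab X. \<exists>a\<in>A. x = k \<otimes> a)"
    using cofinite Y(2) by blast
  then obtain A where A: "\<And>X. X \<in> Y \<Longrightarrow> finite (A X) \<and> A X \<subseteq> carrier G \<and> (\<forall>x\<in>bd X. \<exists>k\<in>Stab X. \<exists>a\<in>A X. x = k \<otimes> a)"
    by metis
  have "{W \<in> F. z \<in> bd W} \<subseteq> (\<Union>X\<in>Y. (\<lambda>a. (z \<otimes> inv a) <# X) ` A X)"
  proof
    fix W assume "W \<in> {W \<in> F. z \<in> bd W}"
    then obtain g X where g: "g \<in> carrier G" "X \<in> Y" "W = g <# X" "z \<in> bd W" using Y(3) by blast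
    have X: "X \<subseteq> carrier G" using g Y F_sub by blast
    have "inv g \<otimes> z \<in> bd X" using g bd_tr[OF g(1) X] mem_tr[OF g(1) bd_sub assms] by simp
    then obtain k a where k: "k \<in> Stab X" "a \<in> A X" "inv g \<otimes> z = k \<otimes> a" using A[OF g(2)] by blast
    have kc: "k \<in> carrier G" "k <# X = X" "a \<in> carrier G" using k A[OF g(2)] by (auto simp: Stab_def)
    have "z = g \<otimes> k \<otimes> a" using k(3) g(1) kc assms by (metis inv_solve_left m_assoc m_closed)
    then have "z \<otimes> inv a = g \<otimes> k" using g(1) kc by (simp add: m_assoc)
    then have "(z \<otimes> inv a) <# X = W" using g kc X lcos_m_assoc[of X g k] by simp
    then show "W \<in> (\<Union>X\<in>Y. (\<lambda>a. (z \<otimes> inv a) <# X) ` A X)" using g(2) k(2) by blast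
  qed
  then show ?thesis by (rule finite_subset) (use Y A in auto)
qed

text \<open>Take the side of \<open>W\<close> that misses the boundary of \<open>U\<close> and the
  side of \<open>U\<close> that misses the boundary of \<open>W\<close>. Their intersection has no
  boundary, and it is not everything because \<open>big\<close> holds for complements; so it is
  empty.\<close>

lemma corner_empty:
  assumes "U \<in> F" "W \<in> F" "bd U \<subseteq> W \<or> bd U \<inter> W = {}" "bd W \<subseteq> U \<or> bd W \<inter> U = {}"
  shows "U \<subseteq> W \<or> U \<inter> W = {} \<or> W \<subseteq> U \<or> U \<union> W = carrier G"
proof -
  have ne: "Z \<noteq> carrier G" if "Z \<in> F" for Z using big[OF F_compl[OF that]] by auto
  have meet: "A \<inter> B = {}" if "A \<in> F" "B \<in> F" "bd A \<inter> B = {}" "bd B \<inter> A = {}" for A B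
    using no_boundary_meet[of A B] that F_sub[OF that(1)] F_sub[OF that(2)] ne[OF that(1)] by blast
  note U = F_sub[OF assms(1)] and W = F_sub[OF assms(2)]
  note c = F_compl[OF assms(1)] F_compl[OF assms(2)]
  from assms(3,4) consider "bd U \<inter> W = {}" "bd W \<inter> U = {}" | "bd U \<subseteq> W" "bd W \<inter> U = {}"
    | "bd U \<inter> W = {}" "bd W \<subseteq> U" | "bd U \<subseteq> W" "bd W \<subseteq> U" by blast
  then show ?thesis
  proof cases
    case 1 then show ?thesis using meet[OF assms(1,2)] by blast
  next
    case 2 then show ?thesis using meet[OF assms(1) c(2)] U by (auto simp: bd_compl)
  next
    case 3 then show ?thesis using meet[OF c(1) assms(2)] W by (auto simp: bd_compl)
  next
    case 4 then show ?thesis using meet[OF c] U W by (auto simp: bd_compl)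
  qed
qed

text \<open>If the boundary of \<open>W\<close> stays away from the \<open>n\<close>-neighbourhood
  of that of \<open>U\<close>, the sets are exactly nested, and \<open>sle U W\<close> leaves only
  \<open>U \<subseteq> W\<close>. Otherwise \<open>W\<close> has a boundary point in that
  neighbourhood; up to the stabilizer of \<open>U\<close> there are finitely many such
  \<open>W\<close>, and \<open>D\<close> is the maximum of their bounds.\<close>

lemma sle_bounded:
  assumes "U \<in> F"
  shows "\<exists>D. \<forall>W\<in>F. sle U W \<longrightarrow> U - W \<subseteq> nb D U"
proof -
  note U = F_sub[OF assms]
  obtain n where n0: "\<forall>U\<in>F. \<forall>W. W \<subseteq> carrier G \<longrightarrow> bd W \<inter> nb n U = {} \<longrightarrow> nb n U \<subseteq> W \<or> nb n U \<inter> W = {}"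
    using conn ..
  have n: "nb n U \<subseteq> W \<or> nb n U \<inter> W = {}" if "U \<in> F" "W \<subseteq> carrier G" "bd W \<inter> nb n U = {}" for U W
    by (rule n0[rule_format, OF that])
  have near: "bd W \<inter> nb n U \<noteq> {}" if W: "W \<in> F" and le: "sle U W" and ns: "\<not> U \<subseteq> W" for W
  proof
    assume e: "bd W \<inter> nb n U = {}"
    \<comment> \<open>Balls are closed under inverses, so being within distance \<open>n\<close> is
      symmetric.\<close>
    have e': "bd U \<inter> nb n W = {}"
    proof (rule ccontr)
      assume "bd U \<inter> nb n W \<noteq> {}"
      then obtain y b where y: "y \<in> bd W" "b \<in> ball n" "y \<otimes> b \<in> bd U" by (auto simp: nb_def)
      have "y \<otimes> b \<otimes> inv b = y" using y bd_sub ball_closed by (auto simp: m_assoc subset_iff)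
      then have "y \<in> nb n U" using nbI[OF y(3) ball_inv[OF y(2)]] by simp
      then show False using y e by blast
    qed
    have "bd U \<subseteq> W \<or> bd U \<inter> W = {}" using n[OF assms F_sub[OF W] e] bd_nb[of U n] by (elim disjE) blast+
    moreover have "bd W \<subseteq> U \<or> bd W \<inter> U = {}" using n[OF W U e'] bd_nb[of W n] by (elim disjE) blast+
    ultimately have "U \<subseteq> W \<or> U \<inter> W = {} \<or> W \<subseteq> U \<or> U \<union> W = carrier G" by (rule corner_empty[OF assms W])
    then consider "U \<inter> W = {}" | "W \<subseteq> U" | "U \<union> W = carrier G" using ns by blast
    then show False
    proof cases
      case 1
      then have "U \<subseteq> carrier G - W" using U by blast
      then show ?thesis using csub_excl[OF assms sle_csub[OF le]] subset_csub[of U "carrier G - W"] by blast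
    next
      case 2
      then show ?thesis using le ns subset_csub[of W U] by (simp add: sle_def)
    next
      case 3
      then have "csub (carrier G - W) U" using subset_csub[of "carrier G - W" U] by blast
      moreover have "csub (carrier G - W) (carrier G - U)" using csub_compl assms W sle_csub[OF le] by blast
      ultimately show ?thesis using csub_excl[OF F_compl[OF W], of U] by blast
    qed
  qed
  obtain A where A: "finite A" "A \<subseteq> carrier G" "\<forall>x\<in>nb n U. \<exists>k\<in>Stab U. \<exists>a\<in>A. x = k \<otimes> a"
    using nb_cofinite[OF assms, of n] by blast
  define B where "B = {W \<in> F. \<exists>a\<in>A. a \<in> bd W}"
  have "B = (\<Union>a\<in>A. {W \<in> F. a \<in> bd W})" by (auto simp: B_def)
  then have fB: "finite B" using A(1,2) locally_finite by auto
  have "\<forall>W\<in>B. \<exists>d. csub U W \<longrightarrow> U - W \<subseteq> nb d U" by (auto simp: csub_def)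
  then obtain d where d: "\<And>W. W \<in> B \<Longrightarrow> csub U W \<Longrightarrow> U - W \<subseteq> nb (d W) U" by metis
  define D where "D = Max (insert 0 (d ` B))"
  have dD: "d W \<le> D" if "W \<in> B" for W using that fB by (auto simp: D_def)
  have "U - W \<subseteq> nb D U" if W: "W \<in> F" and le: "sle U W" for W
  proof (cases "U \<subseteq> W")
    case False
    obtain z where z: "z \<in> bd W" "z \<in> nb n U" using near[OF W le False] by blast
    from A(3)[rule_format, OF z(2)] obtain k a where k: "k \<in> Stab U" "a \<in> A" "k \<otimes> a \<in> bd W"
      using z(1) by auto
    have kc: "k \<in> carrier G" "k <# U = U" "a \<in> carrier G" using k A(2) by (auto simp: Stab_def)
    define W' where "W' = inv k <# W"
    have W': "W' \<in> F" "W = k <# W'"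
      using F_tr[OF inv_closed[OF kc(1)] W] tr_inv(2)[OF kc(1) F_sub[OF W]] by (simp_all add: W'_def)
    have "a \<in> bd W'" using k(3) mult_mem_tr[OF kc(1) bd_sub kc(3)] bd_tr[OF kc(1) F_sub[OF W'(1)]] W'(2) by simp
    then have "W' \<in> B" using W' k(2) by (auto simp: B_def)
    moreover have "csub U W'" using csub_tr[OF kc(1) U F_sub[OF W'(1)]] sle_csub[OF le] kc(2) W'(2) by simp
    ultimately have "U - W' \<subseteq> nb D U" using d[of W'] nb_mono[OF dD[of W'], of U] by blast
    then have "k <# (U - W') \<subseteq> k <# nb D U" by (rule tr_mono)
    then show ?thesis using tr_diff[OF kc(1) U F_sub[OF W'(1)]] nb_tr[OF kc(1) U, of D] kc(2) W'(2) by simp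
  qed blast
  then show ?thesis by blast
qed

lemma sle_bounded_below:
  assumes "V \<in> F"
  shows "\<exists>D. \<forall>W\<in>F. sle W V \<longrightarrow> W - V \<subseteq> nb D V"
proof -
  obtain D where D: "\<forall>W\<in>F. sle (carrier G - V) W \<longrightarrow> (carrier G - V) - W \<subseteq> nb D V"
    using sle_bounded[OF F_compl[OF assms]] unfolding nb_compl ..
  have "W - V \<subseteq> nb D V" if "W \<in> F" "sle W V" for W
  proof -
    have "(carrier G - V) - (carrier G - W) \<subseteq> nb D V"
      by (rule D[rule_format, OF F_compl[OF that(1)] sle_compl[OF that(1) assms that(2)]])
    then show ?thesis using F_sub[OF that(1)] by blast
  qed
  then show ?thesis by blast
qed

text \<open>\<open>u\<close> is so deep in \<open>U\<close> and \<open>v\<close> so far outside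
  \<open>V\<close> that every \<open>W\<close> of the interval contains \<open>u\<close> and omits
  \<open>v\<close>. Its boundary then meets the ball of radius \<open>N\<close> around
  \<open>u\<close>, and local finiteness applies.\<close>

lemma sle_interval:
  assumes "U \<in> F" "V \<in> F"
  shows "finite {W \<in> F. sle U W \<and> sle W V}"
proof -
  obtain D where D: "\<forall>W\<in>F. sle U W \<longrightarrow> U - W \<subseteq> nb D U" using sle_bounded[OF assms(1)] ..
  obtain D' where D': "\<forall>W\<in>F. sle W V \<longrightarrow> W - V \<subseteq> nb D' V" using sle_bounded_below[OF assms(2)] ..
  obtain u where u: "u \<in> U" "u \<notin> nb D U" using big[OF assms(1)] by blast
  obtain v where v: "v \<in> carrier G" "v \<notin> V" "v \<notin> nb D' V"
    using big[OF F_compl[OF assms(2)], of D'] by (auto simp: nb_compl)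
  have uc: "u \<in> carrier G" using u F_sub assms by blast
  obtain N where N: "inv u \<otimes> v \<in> ball N" using ball_exhaust uc v by blast
  have uv: "u \<otimes> (inv u \<otimes> v) = v" using uc v by (simp add: m_assoc[symmetric])
  have "{W \<in> F. sle U W \<and> sle W V} \<subseteq> (\<Union>c\<in>ball N. {W \<in> F. u \<otimes> c \<in> bd W})"
  proof
    fix W assume W: "W \<in> {W \<in> F. sle U W \<and> sle W V}"
    then have "u \<in> W" "v \<notin> W" using D D' u v by blast+
    then obtain c where "c \<in> ball N" "u \<otimes> c \<in> bd W" using cross[OF uc N, of W] uv by auto
    then show "W \<in> (\<Union>c\<in>ball N. {W \<in> F. u \<otimes> c \<in> bd W})" using W by blast
  qed
  then show ?thesis
    by (rule finite_subset) (use finite_ball locally_finite uc ball_closed in auto)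
qed

text \<open>\<open>x0\<close> and its neighbour \<open>x0 \<otimes> s\<close> are on different sides
  of \<open>X\<close>. So whichever of \<open>X\<close> and its complement is \<open>Z\<close>, it
  contains a point \<open>z\<close> at bounded distance from the identity;
  \<open>g \<otimes> z\<close> is in \<open>X\<close> or near its boundary, and \<open>g\<close> is
  at bounded distance from \<open>g \<otimes> z\<close>.\<close>

lemma position_near:
  assumes "X \<in> F"
  shows "\<exists>D. \<forall>g\<in>carrier G. sle (g <# X) X \<or> sle (g <# (carrier G - X)) X \<longrightarrow> g \<in> X \<or> g \<in> nb D X"
proof -
  note X = F_sub[OF assms]
  obtain D where D: "\<forall>W\<in>F. sle W X \<longrightarrow> W - X \<subseteq> nb D X" using sle_bounded_below[OF assms] ..
  obtain x0 where x0: "x0 \<in> bd X" "x0 \<in> carrier G" using F_bd_nonempty[OF assms] by blast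
  then obtain s where s: "s \<in> S" "x0 \<in> X \<longleftrightarrow> x0 \<otimes> s \<notin> X" by (auto simp: bd_def)
  have sc: "s \<in> carrier G" using s S_closed by blast
  obtain N where N: "{inv x0, inv (x0 \<otimes> s)} \<subseteq> ball N" using finite_sub_ball[of "{inv x0, inv (x0 \<otimes> s)}"] x0 sc by auto
  have "g \<in> X \<or> g \<in> nb (D + N) X"
    if g: "g \<in> carrier G" and le: "sle (g <# X) X \<or> sle (g <# (carrier G - X)) X" for g
  proof -
    obtain Z where Z: "Z = X \<or> Z = carrier G - X" "sle (g <# Z) X" using le by blast
    have ZF: "Z \<in> F" using Z assms F_compl by blast
    have "x0 \<in> Z \<or> x0 \<otimes> s \<in> Z" using Z(1) s x0 sc by auto
    then obtain z where z: "z = x0 \<or> z = x0 \<otimes> s" "z \<in> Z" by blast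
    have zc: "z \<in> carrier G" "inv z \<in> ball N" using z x0 sc N by auto
    have gz: "g \<otimes> z \<in> g <# Z" using mult_mem_tr[OF g F_sub[OF ZF] zc(1)] z by simp
    have ge: "g \<otimes> z \<otimes> inv z = g" using g zc by (simp add: m_assoc)
    have "(g <# Z) - X \<subseteq> nb D X" by (rule D[rule_format, OF F_tr[OF g ZF] Z(2)])
    then have "g \<otimes> z \<in> X \<or> g \<otimes> z \<in> nb D X" using gz by blast
    then show ?thesis
    proof
      assume "g \<otimes> z \<in> nb D X"
      then show ?thesis using nb_ball[OF _ zc(2)] ge by fastforce
    next
      assume gX: "g \<otimes> z \<in> X"
      show ?thesis
      proof (cases "g \<in> X")
        case False
        have "z \<in> ball N" using ball_inv[OF zc(2)] zc(1) by simp
        then have "g \<in> nb N X" using cross_nb[OF g, of z N X] gX False by blast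
        then show ?thesis using nb_mono[of N "D + N" X] by auto
      qed auto
    qed
  qed
  then show ?thesis by blast
qed

text \<open>The assumptions leave open whether \<open>P\<close> contains the \<open>g\<close> for
  which \<open>g <# X\<close> is \<open>X\<close> or its complement. Such \<open>g\<close> preserve
  the boundary of \<open>X\<close> and therefore lie at bounded distance from it.\<close>

lemma position_almost_equal:
  assumes "X \<in> F" "P \<subseteq> carrier G"
    and P1: "\<And>g. g \<in> P \<Longrightarrow> sle (g <# X) X \<or> sle (g <# (carrier G - X)) X"
    and P2: "\<And>g. \<lbrakk>g \<in> carrier G; sle (g <# X) X \<or> sle (g <# (carrier G - X)) X; g <# X \<noteq> X; g <# X \<noteq> carrier G - X\<rbrakk> \<Longrightarrow> g \<in> P"
  shows "\<exists>D. sym_diff P X \<subseteq> nb D X"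
proof -
  note X = F_sub[OF assms(1)]
  obtain D1 where D1: "\<forall>g\<in>carrier G. sle (g <# X) X \<or> sle (g <# (carrier G - X)) X \<longrightarrow> g \<in> X \<or> g \<in> nb D1 X"
    using position_near[OF assms(1)] ..
  obtain D2 where D2: "\<forall>g\<in>carrier G. sle (g <# (carrier G - X)) (carrier G - X) \<or> sle (g <# X) (carrier G - X) \<longrightarrow> g \<notin> X \<or> g \<in> nb D2 X"
    using position_near[OF F_compl[OF assms(1)]] unfolding nb_compl compl_compl[OF assms(1)] by auto
  obtain x0 where x0: "x0 \<in> bd X" "x0 \<in> carrier G" using F_bd_nonempty[OF assms(1)] by blast
  obtain D3 where D3: "inv x0 \<in> ball D3" using ball_exhaust x0 by blast
  define D where "D = max D1 (max D2 D3)"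
  have mono: "nb D1 X \<subseteq> nb D X" "nb D2 X \<subseteq> nb D X" "nb D3 X \<subseteq> nb D X"
    using nb_mono[of _ D X] by (auto simp: D_def)
  have "g \<in> nb D X" if g: "g \<in> sym_diff P X" for g
  proof -
    have gc: "g \<in> carrier G" using g X assms(2) by blast
    show ?thesis
    proof (cases "g \<in> P")
      case True
      then show ?thesis using g D1 P1[OF True] gc mono by blast
    next
      case False
      then have gX: "g \<in> X" using g by blast
      from sle_nested[OF F_tr[OF gc assms(1)] assms(1)]
      consider "sle (g <# X) X \<or> sle (g <# (carrier G - X)) X"
        | "sle (g <# (carrier G - X)) (carrier G - X) \<or> sle (g <# X) (carrier G - X)"
        using tr_compl[OF gc X] by auto
      then show ?thesis
      proof cases
        case 1
        then have "g <# X = X \<or> g <# X = carrier G - X" using P2[OF gc] False by blast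
        then have "bd (g <# X) = bd X" using bd_compl by metis
        then have "g \<otimes> x0 \<in> bd X" using mult_mem_tr[OF gc bd_sub x0(2)] bd_tr[OF gc X] x0 by blast
        then have "g \<otimes> x0 \<otimes> inv x0 \<in> nb D3 X" using nbI D3 by blast
        then show ?thesis using gc x0 mono by (auto simp: m_assoc)
      next
        case 2
        then show ?thesis using D2 gc gX mono by blast
      qed
    qed
  qed
  then show ?thesis by blast
qed

end

section \<open>Almost invariant sets and their boundaries\<close>

context fg_group
begin

lemma set_stabilizer_Stab: "set_stabilizer G U = Stab U"
  by (simp add: set_stabilizer_def stabilizer_def Stab_def)

lemma H_finite_iff:
  "H_finite G L A \<longleftrightarrow> (\<exists>B. finite B \<and> B \<subseteq> carrier G \<and> (\<forall>x\<in>A. \<exists>h\<in>L. \<exists>b\<in>B. x = h \<otimes> b))"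
proof -
  have "A \<subseteq> (\<Union>g\<in>B. L #> g) \<longleftrightarrow> (\<forall>x\<in>A. \<exists>h\<in>L. \<exists>b\<in>B. x = h \<otimes> b)" for B
  proof -
    have "x \<in> (\<Union>g\<in>B. L #> g) \<longleftrightarrow> (\<exists>h\<in>L. \<exists>b\<in>B. x = h \<otimes> b)" for x
      by (auto simp: r_coset_def)
    then show ?thesis by (simp add: subset_iff Ball_def)
  qed
  then show ?thesis by (simp add: H_finite_def)
qed

lemma H_finite_subset: "H_finite G L B \<Longrightarrow> A \<subseteq> B \<Longrightarrow> H_finite G L A"
  unfolding H_finite_def by (meson subset_trans)

section \<open>The boundary of a single almost invariant set\<close>

context
  fixes L U
  assumes ai: "nontrivial_ai G L U"
begin

lemma ai_sub: "U \<subseteq> carrier G"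
  using ai by (simp add: nontrivial_ai_def almost_invariant_def)

lemma ai_subgroup: "subgroup L G"
  using ai by (simp add: nontrivial_ai_def almost_invariant_def)

lemma ai_closed: "h \<in> L \<Longrightarrow> h \<in> carrier G"
  using ai_subgroup subgroup.subset by blast

lemma ai_Stab: "L \<subseteq> Stab U"
  using ai ai_closed by (auto simp: nontrivial_ai_def almost_invariant_def Stab_def)

lemma Stab_subgroup: "subgroup (Stab U) G"
proof (rule subgroupI)
  show "Stab U \<noteq> {}" using ai_Stab subgroup.one_closed[OF ai_subgroup] by blast
  show "inv k \<in> Stab U" if "k \<in> Stab U" for k
    using that tr_inv(1)[of k U] ai_sub by (auto simp: Stab_def)
  show "k \<otimes> l \<in> Stab U" if "k \<in> Stab U" "l \<in> Stab U" for k l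
    using that lcos_m_assoc[OF ai_sub, of k l] by (auto simp: Stab_def)
qed (auto simp: Stab_def)

lemma coset_image_iff:
  assumes "x \<in> carrier G"
  shows "L #> x \<in> coset_image G L U \<longleftrightarrow> x \<in> U"
proof
  assume "L #> x \<in> coset_image G L U"
  then obtain u where u: "u \<in> U" "L #> x = L #> u" by (auto simp: coset_image_def)
  then have "x \<in> L #> u" using rcos_self[OF assms ai_subgroup] by simp
  then obtain h where "h \<in> L" "x = h \<otimes> u" by (auto simp: r_coset_def)
  then show "x \<in> U" using u ai_Stab ai_sub mult_mem_tr[of h U u] by (auto simp: Stab_def)
qed (auto simp: coset_image_def)

lemma coset_eqD: "\<lbrakk>x \<in> carrier G; y \<in> carrier G; L #> x = L #> y\<rbrakk> \<Longrightarrow> \<exists>h\<in>L. x = h \<otimes> y"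
  using rcos_self[OF _ ai_subgroup, of x] by (auto simp: r_coset_def)

lemma finite_cosets_H_finite:
  assumes "finite B" "\<And>x. x \<in> A \<Longrightarrow> x \<in> carrier G \<and> L #> x \<in> B"
  shows "H_finite G L A"
proof -
  define r where "r C = (SOME c. c \<in> carrier G \<and> L #> c = C)" for C
  have r: "r (L #> x) \<in> carrier G \<and> L #> r (L #> x) = L #> x" if "x \<in> carrier G" for x
    unfolding r_def by (rule someI[of _ x]) (use that in auto)
  let ?B = "r ` (B \<inter> (\<lambda>x. L #> x) ` carrier G)"
  have "\<exists>h\<in>L. \<exists>b\<in>?B. x = h \<otimes> b" if "x \<in> A" for x
    using assms(2)[OF that] coset_eqD[of x "r (L #> x)"] r[of x] by blast
  moreover have "finite ?B" "?B \<subseteq> carrier G" using assms(1) r by auto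
  ultimately show ?thesis unfolding H_finite_iff by (intro exI conjI ballI)
qed

lemma H_finite_finite_cosets:
  assumes "H_finite G L A"
  shows "finite ((\<lambda>x. L #> x) ` A)"
proof -
  obtain B where B: "finite B" "B \<subseteq> carrier G" "\<forall>x\<in>A. \<exists>h\<in>L. \<exists>b\<in>B. x = h \<otimes> b"
    using assms unfolding H_finite_iff by (elim exE conjE)
  have "(\<lambda>x. L #> x) ` A \<subseteq> (\<lambda>x. L #> x) ` B"
  proof
    fix C assume "C \<in> (\<lambda>x. L #> x) ` A"
    then obtain x where x: "x \<in> A" "C = L #> x" by blast
    from B(3)[rule_format, OF x(1)] obtain h b where hb: "h \<in> L" "b \<in> B" "x = h \<otimes> b" by blast
    then have "L #> x = L #> b"
      using B(2) ai_closed coset_mult_assoc[of L h b] subgroup.subset[OF ai_subgroup]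
        coset_join2[OF _ ai_subgroup, of h] by auto
    then show "C \<in> (\<lambda>x. L #> x) ` B" using x hb by blast
  qed
  then show ?thesis using B(1) finite_surj by blast
qed

text \<open>Almost invariance under the finitely many generators says that edges of the Cayley graph
  leave \<open>U\<close> into finitely many cosets of \<open>L\<close> only. The boundary points
  inside \<open>U\<close> are one generator away from these.\<close>

lemma bd_H_finite: "H_finite G L (bd U)"
proof -
  let ?P = "coset_image G L U"
  define B where "B = (\<Union>s\<in>S. sym_diff ((\<lambda>C. C #> s) ` ?P) ?P)"
  have fB: "finite B" using ai finite_S S_closed
    by (auto simp: B_def nontrivial_ai_def almost_invariant_def ai_cosets_def)
  have L: "L \<subseteq> carrier G" using subgroup.subset[OF ai_subgroup] .
  have out: "L #> (x \<otimes> s) \<in> B" if "x \<in> U" "s \<in> S" "x \<otimes> s \<notin> U" for x s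
  proof -
    have c: "x \<in> carrier G" "s \<in> carrier G" using that ai_sub S_closed by auto
    have "L #> (x \<otimes> s) = (L #> x) #> s" using coset_mult_assoc L c by simp
    then have "L #> (x \<otimes> s) \<in> (\<lambda>C. C #> s) ` ?P" using that(1) by (auto simp: coset_image_def)
    moreover have "L #> (x \<otimes> s) \<notin> ?P" using coset_image_iff that c by simp
    ultimately show ?thesis using that(2) by (auto simp: B_def)
  qed
  define Q where "Q = {x \<in> carrier G. L #> x \<in> B}"
  have "H_finite G L Q" by (rule finite_cosets_H_finite[OF fB]) (auto simp: Q_def)
  then obtain A where A: "finite A" "A \<subseteq> carrier G" "\<forall>x\<in>Q. \<exists>h\<in>L. \<exists>b\<in>A. x = h \<otimes> b"
    unfolding H_finite_iff by blast
  let ?A = "A \<union> (\<lambda>(a, s). a \<otimes> inv s) ` (A \<times> S)"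
  have "\<exists>h\<in>L. \<exists>b\<in>?A. x = h \<otimes> b" if x: "x \<in> bd U" for x
  proof -
    obtain s where s: "s \<in> S" "x \<in> U \<longleftrightarrow> x \<otimes> s \<notin> U" "x \<in> carrier G" using x by (auto simp: bd_def)
    note sc = S_closed[OF s(1)]
    show ?thesis
    proof (cases "x \<in> U")
      case True
      then have "x \<otimes> s \<in> Q" using out s sc by (auto simp: Q_def)
      from A(3)[rule_format, OF this] obtain h a where h: "h \<in> L" "a \<in> A" "x \<otimes> s = h \<otimes> a" by blast
      have "x = h \<otimes> (a \<otimes> inv s)"
        using h s(3) sc A(2) ai_closed inv_solve_right[of x "h \<otimes> a" s] by (auto simp: m_assoc)
      moreover have "a \<otimes> inv s \<in> ?A" using h(2) s(1) by auto
      ultimately show ?thesis using h(1) by blast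
    next
      case False
      then have "x \<otimes> s \<in> U" "x \<otimes> s \<otimes> inv s = x" using s sc by (auto simp: m_assoc)
      then have "x \<in> Q" using out[of "x \<otimes> s" "inv s"] False s S_inv by (auto simp: Q_def)
      from A(3)[rule_format, OF this] show ?thesis by blast
    qed
  qed
  moreover have "finite ?A" "?A \<subseteq> carrier G" using A finite_S S_closed by auto
  ultimately show ?thesis unfolding H_finite_iff by (intro exI conjI ballI)
qed

lemma nb_H_finite: "H_finite G L (nb d U)"
proof -
  obtain A where A: "finite A" "A \<subseteq> carrier G" "\<forall>x\<in>bd U. \<exists>h\<in>L. \<exists>b\<in>A. x = h \<otimes> b"
    using bd_H_finite unfolding H_finite_iff by (elim exE conjE)
  let ?A = "(\<lambda>(a, b). a \<otimes> b) ` (A \<times> ball d)"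
  have "\<exists>h\<in>L. \<exists>a\<in>?A. x = h \<otimes> a" if x: "x \<in> nb d U" for x
  proof -
    obtain y b where y: "y \<in> bd U" "b \<in> ball d" "x = y \<otimes> b" using x by (auto simp: nb_def)
    from A(3)[rule_format, OF y(1)] obtain h a where h: "h \<in> L" "a \<in> A" "y = h \<otimes> a" by blast
    then have "x = h \<otimes> (a \<otimes> b)" using y ball_closed A(2) ai_closed by (auto simp: m_assoc)
    moreover have "a \<otimes> b \<in> ?A" using h(2) y(2) by auto
    ultimately show ?thesis using h(1) by blast
  qed
  moreover have "finite ?A" "?A \<subseteq> carrier G" using A finite_ball ball_closed by auto
  ultimately show ?thesis unfolding H_finite_iff by (intro exI conjI ballI)
qed

lemma ai_big: "\<not> U \<subseteq> nb d U" "\<not> carrier G - U \<subseteq> nb d U"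
  using H_finite_finite_cosets[OF H_finite_subset[OF nb_H_finite]] ai
  by (auto simp: nontrivial_ai_def coset_image_def)

lemma ai_bd_nonempty:
  obtains x where "x \<in> bd U" "x \<in> carrier G"
proof -
  obtain u v where "u \<in> U" "v \<in> carrier G - U" using ai_big by blast
  then have "bd U \<noteq> {}" using bd_nonempty[of u U v] ai_sub by auto
  then show thesis using that bd_sub by blast
qed

lemma Stab_bd: "k \<in> Stab U \<Longrightarrow> x \<in> bd U \<Longrightarrow> k \<otimes> x \<in> bd U"
  using mult_mem_tr[of k "bd U" x] bd_tr[of k U] bd_sub ai_sub by (auto simp: Stab_def)

text \<open>\<open>L\<close> preserves the boundary, so finitely many \<open>L\<close>-orbits stay
  at bounded distance from the orbit of one boundary point.\<close>

lemma H_finite_nb: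
  assumes "H_finite G L A"
  shows "\<exists>d. A \<subseteq> nb d U"
proof -
  obtain B where B: "finite B" "B \<subseteq> carrier G" "\<forall>x\<in>A. \<exists>h\<in>L. \<exists>b\<in>B. x = h \<otimes> b"
    using assms unfolding H_finite_iff by (elim exE conjE)
  obtain x0 where x0: "x0 \<in> bd U" "x0 \<in> carrier G" using ai_bd_nonempty by blast
  have "finite ((\<lambda>b. inv x0 \<otimes> b) ` B)" "(\<lambda>b. inv x0 \<otimes> b) ` B \<subseteq> carrier G" using B x0 by auto
  then obtain d where d: "(\<lambda>b. inv x0 \<otimes> b) ` B \<subseteq> ball d" using finite_sub_ball by blast
  have "x \<in> nb d U" if "x \<in> A" for x
  proof -
    from B(3)[rule_format, OF that] obtain h b where h: "h \<in> L" "b \<in> B" "x = h \<otimes> b" by blast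
    have c: "h \<in> carrier G" "b \<in> carrier G" using h B ai_closed by auto
    have "x = (h \<otimes> x0) \<otimes> (inv x0 \<otimes> b)"
      using c x0(2) h(3) by (simp add: m_assoc) (simp add: m_assoc[symmetric])
    moreover have "h \<otimes> x0 \<in> bd U" using Stab_bd x0 h ai_Stab by blast
    moreover have "inv x0 \<otimes> b \<in> ball d" using d h(2) by blast
    ultimately show ?thesis using nbI by metis
  qed
  then show ?thesis by blast
qed

text \<open>The stabilizer moves a boundary point within the boundary, which is
  \<open>L\<close>-finite. This yields the finite index of \<open>L\<close> in the
  stabilizer.\<close>

lemma Stab_H_finite: "H_finite G L (Stab U)"
proof -
  obtain B where B: "finite B" "B \<subseteq> carrier G" "\<forall>x\<in>bd U. \<exists>h\<in>L. \<exists>b\<in>B. x = h \<otimes> b"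
    using bd_H_finite unfolding H_finite_iff by (elim exE conjE)
  obtain x0 where x0: "x0 \<in> bd U" "x0 \<in> carrier G" using ai_bd_nonempty by blast
  have "\<exists>h\<in>L. \<exists>b\<in>(\<lambda>b. b \<otimes> inv x0) ` B. k = h \<otimes> b" if k: "k \<in> Stab U" for k
  proof -
    from B(3)[rule_format, OF Stab_bd[OF k x0(1)]] obtain h b where h: "h \<in> L" "b \<in> B" "k \<otimes> x0 = h \<otimes> b" by blast
    then have "k = h \<otimes> (b \<otimes> inv x0)"
      using k x0 B(2) ai_closed inv_solve_right[of k "h \<otimes> b" x0] by (auto simp: m_assoc Stab_def)
    moreover have "b \<otimes> inv x0 \<in> (\<lambda>b. b \<otimes> inv x0) ` B" using h(2) by blast
    ultimately show ?thesis using h(1) by blast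
  qed
  moreover have "finite ((\<lambda>b. b \<otimes> inv x0) ` B)" "(\<lambda>b. b \<otimes> inv x0) ` B \<subseteq> carrier G" using B x0 by auto
  ultimately show ?thesis unfolding H_finite_iff by (intro exI conjI ballI)
qed

lemma finite_index_Stab:
  "subgroup L (G\<lparr>carrier := Stab U\<rparr>)" "finite (rcosets\<^bsub>G\<lparr>carrier := Stab U\<rparr>\<^esub> L)"
proof -
  show "subgroup L (G\<lparr>carrier := Stab U\<rparr>)"
    using subgroup_incl[OF ai_subgroup Stab_subgroup ai_Stab] .
  have "rcosets\<^bsub>G\<lparr>carrier := Stab U\<rparr>\<^esub> L = (\<lambda>x. L #> x) ` Stab U"
    by (auto simp: RCOSETS_def r_coset_def)
  then show "finite (rcosets\<^bsub>G\<lparr>carrier := Stab U\<rparr>\<^esub> L)"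
    using H_finite_finite_cosets[OF Stab_H_finite] by simp
qed

lemma ai_cofinite: "\<exists>A. finite A \<and> A \<subseteq> carrier G \<and> (\<forall>x\<in>bd U. \<exists>k\<in>Stab U. \<exists>a\<in>A. x = k \<otimes> a)"
proof -
  obtain B where B: "finite B" "B \<subseteq> carrier G" "\<forall>x\<in>bd U. \<exists>h\<in>L. \<exists>b\<in>B. x = h \<otimes> b"
    using bd_H_finite unfolding H_finite_iff by (elim exE conjE)
  have "\<exists>k\<in>Stab U. \<exists>a\<in>B. x = k \<otimes> a" if "x \<in> bd U" for x
    using B(3)[rule_format, OF that] ai_Stab by (meson subsetD)
  then show ?thesis using B(1,2) by (intro exI[of _ B]) simp
qed

lemma nontrivial_ai_compl: "nontrivial_ai G L (carrier G - U)"
proof -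
  let ?P = "coset_image G L U" and ?Q = "coset_image G L (carrier G - U)"
  have L: "L \<subseteq> carrier G" using subgroup.subset[OF ai_subgroup] .
  have Q: "L #> x \<in> ?Q \<longleftrightarrow> L #> x \<notin> ?P" if "x \<in> carrier G" for x
  proof
    assume "L #> x \<in> ?Q"
    then obtain y where "y \<in> carrier G - U" "L #> x = L #> y" by (auto simp: coset_image_def)
    then show "L #> x \<notin> ?P" using coset_image_iff[of y] by simp
  next
    assume "L #> x \<notin> ?P"
    then show "L #> x \<in> ?Q" using that by (auto simp: coset_image_def)
  qed
  have tr: "L #> x \<in> (\<lambda>C. C #> g) ` coset_image G L V \<longleftrightarrow> L #> (x \<otimes> inv g) \<in> coset_image G L V"
    if "x \<in> carrier G" "g \<in> carrier G" "V \<subseteq> carrier G" for x g V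
  proof
    assume "L #> x \<in> (\<lambda>C. C #> g) ` coset_image G L V"
    then obtain v where v: "v \<in> V" "L #> x = (L #> v) #> g" by (auto simp: coset_image_def)
    then have "(L #> x) #> inv g = L #> v"
      using that L coset_mult_assoc[of L v g] coset_mult_assoc[of L "v \<otimes> g" "inv g"] by (auto simp: m_assoc)
    then show "L #> (x \<otimes> inv g) \<in> coset_image G L V"
      using v that L coset_mult_assoc[of L x "inv g"] by (auto simp: coset_image_def)
  next
    assume *: "L #> (x \<otimes> inv g) \<in> coset_image G L V"
    have "(L #> (x \<otimes> inv g)) #> g = L #> x"
      using that L coset_mult_assoc[of L "x \<otimes> inv g" g] by (simp add: m_assoc)
    then show "L #> x \<in> (\<lambda>C. C #> g) ` coset_image G L V" using * by (metis imageI)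
  qed
  have "finite (sym_diff ((\<lambda>C. C #> g) ` ?Q) ?Q)" if g: "g \<in> carrier G" for g
  proof -
    have "sym_diff ((\<lambda>C. C #> g) ` ?Q) ?Q \<subseteq> sym_diff ((\<lambda>C. C #> g) ` ?P) ?P"
    proof
      fix C assume C: "C \<in> sym_diff ((\<lambda>C. C #> g) ` ?Q) ?Q"
      have "\<exists>x\<in>carrier G. C = L #> x"
        using C g L coset_mult_assoc[of L _ g] by (auto simp: coset_image_def)
      then obtain x where x: "x \<in> carrier G" "C = L #> x" by blast
      then show "C \<in> sym_diff ((\<lambda>C. C #> g) ` ?P) ?P"
        using C Q[OF x(1)] Q[of "x \<otimes> inv g"] tr[OF x(1) g ai_sub] tr[OF x(1) g, of "carrier G - U"] g by auto
    qed
    moreover have "finite (sym_diff ((\<lambda>C. C #> g) ` ?P) ?P)"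
      using ai g by (simp add: nontrivial_ai_def almost_invariant_def ai_cosets_def)
    ultimately show ?thesis by (rule finite_subset)
  qed
  moreover have "?Q \<subseteq> rcosets L" by (auto simp: coset_image_def RCOSETS_def)
  moreover have "h <# (carrier G - U) = carrier G - U" if "h \<in> L" for h
    using that ai_Stab tr_compl[OF ai_closed[OF that] ai_sub] by (auto simp: Stab_def)
  moreover have "carrier G - (carrier G - U) = U" using ai_sub by blast
  ultimately show ?thesis
    using ai by (auto simp: nontrivial_ai_def almost_invariant_def ai_cosets_def)
qed

text \<open>This is where finite generation of \<open>L\<close> enters: it makes a neighbourhood of the boundary connected.\<close>
lemma ai_conn:
  assumes "fin_gen G L"
  shows "\<exists>n0. \<forall>n\<ge>n0. \<forall>W. W \<subseteq> carrier G \<longrightarrow> bd W \<inter> nb n U = {} \<longrightarrow> nb n U \<subseteq> W \<or> nb n U \<inter> W = {}"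
proof -
  obtain T where T: "finite T" "T \<subseteq> L" "generate G T = L" using assms by (auto simp: fin_gen_def)
  have Tc: "t \<in> carrier G" if "t \<in> T" for t using that T ai_closed by blast
  obtain B where B: "finite B" "B \<subseteq> carrier G" "\<forall>x\<in>bd U. \<exists>h\<in>L. \<exists>b\<in>B. x = h \<otimes> b"
    using bd_H_finite unfolding H_finite_iff by (elim exE conjE)
  obtain x0 where x0: "x0 \<in> bd U" "x0 \<in> carrier G" using ai_bd_nonempty by blast
  \<comment> \<open>The steps, seen from \<open>x0\<close>, that lead along the
    \<open>L\<close>-orbit of \<open>x0\<close> by a generator of \<open>L\<close> or its inverse,
    and from that orbit to any boundary point.\<close>
  define A where "A = (\<lambda>a. inv x0 \<otimes> a) ` (B \<union> (\<lambda>t. t \<otimes> x0) ` T \<union> (\<lambda>t. inv t \<otimes> x0) ` T)"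
  have "finite A" "A \<subseteq> carrier G" using T(1) B(1,2) Tc x0(2) by (auto simp: A_def)
  then obtain n0 where n0: "A \<subseteq> ball n0" using finite_sub_ball by blast
  have main: "nb n U \<subseteq> W \<or> nb n U \<inter> W = {}" if n: "n0 \<le> n" and W: "W \<subseteq> carrier G" "bd W \<inter> nb n U = {}" for n W
  proof -
    have An: "a \<in> A \<Longrightarrow> a \<in> ball n" for a using n0 ball_mono[OF n] by blast
    \<comment> \<open>On the way from \<open>y\<close> to \<open>y \<otimes> b\<close> one stays in
      \<open>nb n U\<close>, which the boundary of \<open>W\<close> avoids, so the side of
      \<open>W\<close> does not change.\<close>
    have near: "y \<otimes> b \<in> W \<longleftrightarrow> y \<in> W" if y: "y \<in> bd U" "b \<in> ball n" for y b
    proof (rule ccontr)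
      assume "\<not> (y \<otimes> b \<in> W \<longleftrightarrow> y \<in> W)"
      then obtain c where "c \<in> ball n" "y \<otimes> c \<in> bd W"
        using cross[OF bd_closed[OF y(1)] y(2), of W] by auto
      then show False using nbI[OF y(1)] W(2) by blast
    qed
    have Lx0: "h \<otimes> x0 \<in> bd U" if "h \<in> L" for h using Stab_bd x0 that ai_Stab by blast
    have step: "h \<otimes> a \<in> W \<longleftrightarrow> h \<otimes> x0 \<in> W" if h: "h \<in> L" and a: "a \<in> carrier G" "inv x0 \<otimes> a \<in> A" for h a
    proof -
      have "(h \<otimes> x0) \<otimes> (inv x0 \<otimes> a) = h \<otimes> a"
        using ai_closed[OF h] x0(2) a(1) by (simp add: m_assoc) (simp add: m_assoc[symmetric])
      then show ?thesis using near[OF Lx0[OF h] An[OF a(2)]] by simp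
    qed
    have gen: "h \<otimes> l \<otimes> x0 \<in> W \<longleftrightarrow> h \<otimes> x0 \<in> W" if "l \<in> generate G T" "h \<in> L" for l h
      using that
    proof (induction arbitrary: h)
      case one
      then show ?case using ai_closed by simp
    next
      case (incl t)
      then have "inv x0 \<otimes> (t \<otimes> x0) \<in> A" by (auto simp: A_def)
      then show ?case using step[of h "t \<otimes> x0"] incl Tc ai_closed x0(2) by (simp add: m_assoc)
    next
      case (inv t)
      then have "inv x0 \<otimes> (inv t \<otimes> x0) \<in> A" by (auto simp: A_def)
      then show ?case using step[of h "inv t \<otimes> x0"] inv Tc ai_closed x0(2) by (simp add: m_assoc)
    next
      case (eng l1 l2)
      then have l: "l1 \<in> L" "l2 \<in> L" using T(3) by auto
      then have "h \<otimes> l1 \<in> L" using eng.prems subgroup.m_closed[OF ai_subgroup] by blast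
      then show ?case using eng.IH(1)[OF eng.prems] eng.IH(2)[of "h \<otimes> l1"] l ai_closed eng.prems by (simp add: m_assoc)
    qed
    have all: "y \<in> W \<longleftrightarrow> x0 \<in> W" if y: "y \<in> bd U" for y
    proof -
      from B(3)[rule_format, OF y] obtain h b where h: "h \<in> L" "b \<in> B" "y = h \<otimes> b" by blast
      have "b \<in> carrier G" "inv x0 \<otimes> b \<in> A" using h B(2) by (auto simp: A_def)
      then have "y \<in> W \<longleftrightarrow> h \<otimes> x0 \<in> W" using step[OF h(1)] h(3) by simp
      moreover have "\<one> \<otimes> h \<otimes> x0 \<in> W \<longleftrightarrow> \<one> \<otimes> x0 \<in> W"
        using gen[of h \<one>] h(1) T(3) subgroup.one_closed[OF ai_subgroup] by simp
      ultimately show ?thesis using ai_closed[OF h(1)] x0(2) by simp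
    qed
    have "z \<in> W \<longleftrightarrow> x0 \<in> W" if z: "z \<in> nb n U" for z
    proof -
      obtain y b where "y \<in> bd U" "b \<in> ball n" "z = y \<otimes> b" using z by (auto simp: nb_def)
      then show ?thesis using near all by simp
    qed
    then show ?thesis by blast
  qed
  show ?thesis by (intro exI[of _ n0] allI impI) (rule main)
qed

end

lemma Stab_tr:
  assumes "g \<in> carrier G" "U \<subseteq> carrier G" "k \<in> Stab U"
  shows "g \<otimes> k \<otimes> inv g \<in> Stab (g <# U)"
proof -
  have k: "k \<in> carrier G" "k <# U = U" using assms by (auto simp: Stab_def)
  have "(g \<otimes> k \<otimes> inv g) <# (g <# U) = g <# U"
    using assms(1,2) k lcos_m_assoc[of U "g \<otimes> k \<otimes> inv g" g] lcos_m_assoc[of U g k] by (simp add: m_assoc)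
  then show ?thesis using assms k by (simp add: Stab_def)
qed

section \<open>The family of all translates\<close>

context
  fixes J :: "'j set" and H :: "'j \<Rightarrow> 'a set" and X :: "'j \<Rightarrow> 'a set" and F
  assumes finite_J: "finite J"
    and ai: "\<And>j. j \<in> J \<Longrightarrow> nontrivial_ai G (H j) (X j)"
    and fg: "\<And>j. j \<in> J \<Longrightarrow> fin_gen G (H j)"
    and F_def: "F = (\<Union>j\<in>J. translates G (X j))"
begin

lemma translatesE:
  assumes "U \<in> F"
  obtains g j where "g \<in> carrier G" "j \<in> J" "U = g <# X j \<or> U = g <# (carrier G - X j)"
  using assms by (auto simp: F_def translates_def)

lemma translatesI: "\<lbrakk>g \<in> carrier G; j \<in> J\<rbrakk> \<Longrightarrow> g <# X j \<in> F" "\<lbrakk>g \<in> carrier G; j \<in> J\<rbrakk> \<Longrightarrow> g <# (carrier G - X j) \<in> F"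
  by (auto simp: F_def translates_def)

lemma translates_tr:
  assumes "U \<in> F" and P: "\<And>j. j \<in> J \<Longrightarrow> P (X j)" "\<And>j. j \<in> J \<Longrightarrow> P (carrier G - X j)"
    and tr: "\<And>g V. g \<in> carrier G \<Longrightarrow> V \<subseteq> carrier G \<Longrightarrow> P V \<Longrightarrow> P (g <# V)"
  shows "P U"
proof -
  from assms(1) obtain g j where gj: "g \<in> carrier G" "j \<in> J" "U = g <# X j \<or> U = g <# (carrier G - X j)"
    by (rule translatesE)
  show ?thesis
    using gj(3)
  proof
    assume "U = g <# X j"
    then show ?thesis using tr[OF gj(1) ai_sub[OF ai[OF gj(2)]] P(1)[OF gj(2)]] by simp
  next
    assume "U = g <# (carrier G - X j)"
    then show ?thesis using tr[OF gj(1) Diff_subset P(2)[OF gj(2)]] by simp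
  qed
qed

lemma coarse_family_translates: "coarse_family G S F"
proof
  fix U assume U: "U \<in> F"
  show "U \<subseteq> carrier G"
  proof (rule translates_tr[OF U, of "\<lambda>U. U \<subseteq> carrier G"])
    show "X j \<subseteq> carrier G" if "j \<in> J" for j using ai_sub[OF ai[OF that]] .
  qed (rule Diff_subset, rule tr_sub)
  show "carrier G - U \<in> F"
  proof -
    from U obtain g j where g: "g \<in> carrier G" "j \<in> J" "U = g <# X j \<or> U = g <# (carrier G - X j)"
      by (rule translatesE)
    have "X j \<subseteq> carrier G" using ai_sub[OF ai] g by blast
    then have "carrier G - U = g <# (carrier G - X j) \<or> carrier G - U = g <# X j"
      using g tr_compl[of g "X j"] tr_compl[of g "carrier G - X j"] by (auto simp: double_diff)
    then show ?thesis using translatesI[OF g(1,2)] by auto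
  qed
  show "h <# U \<in> F" if h: "h \<in> carrier G" for h
  proof -
    from U obtain g j where g: "g \<in> carrier G" "j \<in> J" "U = g <# X j \<or> U = g <# (carrier G - X j)"
      by (rule translatesE)
    have "X j \<subseteq> carrier G" using ai_sub[OF ai] g by blast
    then have "h <# U = (h \<otimes> g) <# X j \<or> h <# U = (h \<otimes> g) <# (carrier G - X j)"
      using g h by (auto simp: lcos_m_assoc)
    then show ?thesis using translatesI[of "h \<otimes> g" j] g h by auto
  qed
  show "\<not> U \<subseteq> nb d U" for d
  proof (rule translates_tr[OF U])
    show "\<not> X j \<subseteq> nb d (X j)" if "j \<in> J" for j using ai_big(1)[OF ai[OF that]] .
    show "\<not> carrier G - X j \<subseteq> nb d (carrier G - X j)" if "j \<in> J" for j
      using ai_big(2)[OF ai[OF that]] by (simp add: nb_compl)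
    show "\<not> g <# V \<subseteq> nb d (g <# V)" if "g \<in> carrier G" "V \<subseteq> carrier G" "\<not> V \<subseteq> nb d V" for g V
      using that tr_mono_iff[of g V "nb d V"] nb_tr nb_sub by simp
  qed
  show "\<exists>A. finite A \<and> A \<subseteq> carrier G \<and> (\<forall>x\<in>bd U. \<exists>k\<in>Stab U. \<exists>a\<in>A. x = k \<otimes> a)"
  proof (rule translates_tr[OF U])
    show "\<exists>A. finite A \<and> A \<subseteq> carrier G \<and> (\<forall>x\<in>bd (X j). \<exists>k\<in>Stab (X j). \<exists>a\<in>A. x = k \<otimes> a)" if "j \<in> J" for j
      using ai_cofinite[OF ai[OF that]] .
    show "\<exists>A. finite A \<and> A \<subseteq> carrier G \<and> (\<forall>x\<in>bd (carrier G - X j). \<exists>k\<in>Stab (carrier G - X j). \<exists>a\<in>A. x = k \<otimes> a)" if "j \<in> J" for j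
      using ai_cofinite[OF nontrivial_ai_compl[OF ai[OF that]]] .
    fix g V assume g: "g \<in> carrier G" "V \<subseteq> carrier G"
      and "\<exists>A. finite A \<and> A \<subseteq> carrier G \<and> (\<forall>x\<in>bd V. \<exists>k\<in>Stab V. \<exists>a\<in>A. x = k \<otimes> a)"
    then obtain A where A: "finite A" "A \<subseteq> carrier G" "\<forall>x\<in>bd V. \<exists>k\<in>Stab V. \<exists>a\<in>A. x = k \<otimes> a"
      by (elim exE conjE)
    have "\<exists>k\<in>Stab (g <# V). \<exists>a\<in>(\<lambda>a. g \<otimes> a) ` A. x = k \<otimes> a" if x: "x \<in> bd (g <# V)" for x
    proof -
      obtain y where y: "y \<in> bd V" "x = g \<otimes> y" using x bd_tr[OF g] by (auto simp: l_coset_def)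
      from A(3)[rule_format, OF y(1)] obtain k a where k: "k \<in> Stab V" "a \<in> A" "y = k \<otimes> a" by blast
      have c: "k \<in> carrier G" "a \<in> carrier G" using k A(2) by (auto simp: Stab_def)
      have "x = (g \<otimes> k \<otimes> inv g) \<otimes> (g \<otimes> a)"
        using g(1) c y(2) k(3) by (simp add: m_assoc) (simp add: m_assoc[symmetric])
      then show ?thesis using Stab_tr[OF g k(1)] k(2) by blast
    qed
    moreover have "finite ((\<lambda>a. g \<otimes> a) ` A)" "(\<lambda>a. g \<otimes> a) ` A \<subseteq> carrier G" using A(1,2) g by auto
    ultimately show "\<exists>A. finite A \<and> A \<subseteq> carrier G \<and> (\<forall>x\<in>bd (g <# V). \<exists>k\<in>Stab (g <# V). \<exists>a\<in>A. x = k \<otimes> a)"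
      by (intro exI conjI ballI)
  qed
next
  let ?Y = "X ` J \<union> (\<lambda>j. carrier G - X j) ` J"
  have "?Y \<subseteq> F"
    using translatesI[OF one_closed] ai_sub[OF ai] by (auto simp: lcos_mult_one)
  moreover have "\<forall>U\<in>F. \<exists>g\<in>carrier G. \<exists>V\<in>?Y. U = g <# V"
  proof
    fix U assume "U \<in> F"
    then show "\<exists>g\<in>carrier G. \<exists>V\<in>?Y. U = g <# V" by (rule translatesE) blast
  qed
  moreover have "finite ?Y" using finite_J by simp
  ultimately show "\<exists>Y. finite Y \<and> Y \<subseteq> F \<and> (\<forall>U\<in>F. \<exists>g\<in>carrier G. \<exists>V\<in>Y. U = g <# V)" by blast
next
  let ?C = "\<lambda>n U. \<forall>W. W \<subseteq> carrier G \<longrightarrow> bd W \<inter> nb n U = {} \<longrightarrow> nb n U \<subseteq> W \<or> nb n U \<inter> W = {}"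
  have "\<forall>j\<in>J. \<exists>n0. \<forall>n\<ge>n0. ?C n (X j)" using ai_conn[OF ai fg] by blast
  then obtain m where m: "\<And>j n. j \<in> J \<Longrightarrow> n \<ge> m j \<Longrightarrow> ?C n (X j)" by metis
  \<comment> \<open>Connectedness holds for all sufficiently large radii, so one radius serves the
    finitely many sets.\<close>
  define N where "N = Max (insert 0 (m ` J))"
  have CN: "?C N (X j)" if "j \<in> J" for j
    using m[OF that, of N] that finite_J by (simp add: N_def)
  have "?C N U" if U: "U \<in> F" for U
  proof (rule translates_tr[OF U, of "\<lambda>U. ?C N U"])
    show "?C N (carrier G - X j)" if "j \<in> J" for j using CN[OF that] unfolding nb_compl .
    fix g V assume g: "g \<in> carrier G" "V \<subseteq> carrier G" and C: "?C N V"
    show "?C N (g <# V)"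
    proof (intro allI impI)
      fix W assume W: "W \<subseteq> carrier G" "bd W \<inter> nb N (g <# V) = {}"
      define W' where "W' = inv g <# W"
      have W': "W' \<subseteq> carrier G" "W = g <# W'" using g W tr_sub tr_inv(2) by (auto simp: W'_def)
      have "bd W' \<inter> nb N V = {}"
      proof (rule ccontr)
        assume "bd W' \<inter> nb N V \<noteq> {}"
        then obtain z where "z \<in> bd W'" "z \<in> nb N V" by blast
        then have "g \<otimes> z \<in> bd W" "g \<otimes> z \<in> nb N (g <# V)"
          using bd_tr[OF g(1) W'(1)] nb_tr[OF g] W'(2) by (auto simp: l_coset_def)
        then show False using W(2) by blast
      qed
      then have "nb N V \<subseteq> W' \<or> nb N V \<inter> W' = {}" using C W'(1) by blast
      then show "nb N (g <# V) \<subseteq> W \<or> nb N (g <# V) \<inter> W = {}"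
      proof
        assume "nb N V \<subseteq> W'"
        then show ?thesis using nb_tr[OF g, of N] W'(2) tr_mono by simp
      next
        assume e: "nb N V \<inter> W' = {}"
        have "nb N (g <# V) \<inter> W = {}"
        proof (rule ccontr)
          assume "nb N (g <# V) \<inter> W \<noteq> {}"
          then obtain z where "z \<in> g <# nb N V" "z \<in> g <# W'" using nb_tr[OF g, of N] W'(2) by auto
          then show False
            using e mem_tr[OF g(1) nb_sub] mem_tr[OF g(1) W'(1)] tr_sub[OF g(1) W'(1)] by blast
        qed
        then show ?thesis by blast
      qed
    qed
  qed (rule CN)
  then show "\<exists>n. \<forall>U\<in>F. ?C n U" by blast
qed

lemma small_inter_csub:
  assumes "small_inter G U (carrier G - W)" "U \<subseteq> carrier G"
  shows "csub U W"
proof -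
  obtain L M where L: "nontrivial_ai G L U" "H_finite G L (U \<inter> (carrier G - W))"
    using assms(1) unfolding small_inter_def by blast
  have "U \<inter> (carrier G - W) = U - W" using assms(2) by blast
  then show ?thesis using H_finite_nb[OF L] unfolding csub_def by simp
qed

lemma csub_small_inter:
  assumes "nontrivial_ai G L U" "nontrivial_ai G M W" "csub U W"
  shows "small_inter G U (carrier G - W)"
proof -
  obtain d where d: "U - W \<subseteq> nb d U" using assms(3) unfolding csub_def ..
  have "U \<inter> (carrier G - W) \<subseteq> nb d U" using d by blast
  from H_finite_subset[OF nb_H_finite[OF assms(1)] this]
  show ?thesis using assms(1) nontrivial_ai_compl[OF assms(2)] unfolding small_inter_def by blast
qed

context
  assumes an: "almost_nested G F"
begin

interpretation C: coarse_family G S F by (rule coarse_family_translates)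

text \<open>Read off from a small corner of \<open>U\<close> with itself, since smallness carries a
  subgroup for \<open>U\<close> or its complement with it.\<close>

lemma F_nontrivial_ai: "U \<in> F \<Longrightarrow> \<exists>L. nontrivial_ai G L U"
proof -
  assume U: "U \<in> F"
  then obtain c where "small_corner G U U c" using an unfolding almost_nested_def by blast
  then obtain L where "nontrivial_ai G L (side G (fst c) U)" by (auto simp: small_corner_def small_inter_def)
  then show ?thesis
    using nontrivial_ai_compl[of L "carrier G - U"] C.compl_compl[OF U] by (auto simp: side_def split: if_splits)
qed

lemma F_almost:
  assumes "U \<in> F" "W \<in> F"
  shows "csub U W \<or> csub U (carrier G - W) \<or> csub (carrier G - U) W \<or> csub (carrier G - U) (carrier G - W)"
proof -
  obtain d where d: "small_corner G U W d" using an assms unfolding almost_nested_def by blast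
  define b c where "b = fst d" and "c = snd d"
  have c: "small_inter G (side G b U) (side G c W)"
    using d unfolding small_corner_def b_def c_def .
  have "side G c W = carrier G - side G (\<not> c) W" using C.compl_compl[OF assms(2)] by (auto simp: side_def)
  then have "csub (side G b U) (side G (\<not> c) W)"
    using small_inter_csub c C.F_sub[OF assms(1)] by (auto simp: side_def)
  then show ?thesis by (auto simp: side_def split: if_splits)
qed

text \<open>Coarse containment in both directions makes two opposite corners small, and an empty one
  among them is an inclusion.\<close>

lemma F_good:
  assumes "U \<in> F" "W \<in> F" "two_small_imp_empty G U W" "csub U (side G b W)" "csub (side G b W) U"
  shows "U \<subseteq> side G b W \<or> side G b W \<subseteq> U"
proof -
  define Z where "Z = side G b W"
  have Z: "Z \<in> F" "carrier G - Z = side G (\<not> b) W"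
    using assms(2) C.F_compl C.compl_compl by (auto simp: Z_def side_def)
  obtain L M L' where L: "nontrivial_ai G L U" "nontrivial_ai G M Z" "nontrivial_ai G L' (carrier G - U)"
    using F_nontrivial_ai assms(1) Z(1) C.F_compl by metis
  have "small_inter G U (carrier G - Z)" using csub_small_inter L assms(4) Z_def by blast
  then have s1: "small_corner G U W (True, \<not> b)" using Z by (simp add: small_corner_def side_def)
  have "csub (carrier G - U) (carrier G - Z)" using C.csub_compl[OF Z(1) assms(1)] assms(5) Z_def by blast
  then have "small_inter G (carrier G - U) (carrier G - (carrier G - Z))"
    using csub_small_inter[OF L(3) nontrivial_ai_compl[OF L(2)]] by blast
  then have s2: "small_corner G U W (False, b)"
    using C.compl_compl[OF Z(1)] Z_def by (simp add: small_corner_def side_def)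
  have "(True, \<not> b) \<noteq> (False, b)" by simp
  with s1 s2 have "corner G U W (True, \<not> b) = {} \<or> corner G U W (False, b) = {}"
    using assms(3) unfolding two_small_imp_empty_def by blast
  then have "U \<inter> (carrier G - Z) = {} \<or> (carrier G - U) \<inter> Z = {}"
    using Z(2) Z_def by (simp add: corner_def side_def)
  then show ?thesis using C.F_sub[OF assms(1)] C.F_sub[OF Z(1)] Z_def by blast
qed

lemma nested_family_all_pairs:
  assumes "\<And>U W. \<lbrakk>U \<in> F; W \<in> F\<rbrakk> \<Longrightarrow> two_small_imp_empty G U W"
  shows "nested_family G S F"
proof
  show "U \<subseteq> W \<or> W \<subseteq> U" if "U \<in> F" "W \<in> F" "csub U W" "csub W U" for U W
    using F_good[OF that(1,2) assms[OF that(1,2)], of True] that by (simp add: side_def)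
qed (rule F_almost)

text \<open>The hypothesis speaks of pairs with first member \<open>X j\<close> only. A general pair
  is translated until its first member is \<open>X j\<close> or the complement; in the latter case
  both members are replaced by their complements.\<close>

lemma nested_family_one_orbit:
  assumes J: "J = {j}" and two: "\<And>g. g \<in> carrier G \<Longrightarrow> two_small_imp_empty G (X j) (g <# X j)"
  shows "nested_family G S F"
proof
  fix U W assume UW: "U \<in> F" "W \<in> F" "csub U W" "csub W U"
  have XF: "X j \<in> F" using translatesI(1)[OF one_closed, of j] ai_sub[OF ai] J by (simp add: lcos_mult_one)
  note X = C.F_sub[OF XF]
  have base: "X j \<subseteq> Z \<or> Z \<subseteq> X j" if Z: "Z \<in> F" "csub (X j) Z" "csub Z (X j)" for Z
  proof -
    obtain g where g: "g \<in> carrier G" "Z = g <# X j \<or> Z = g <# (carrier G - X j)"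
      using Z(1) J by (auto elim: translatesE)
    then obtain b where "Z = side G b (g <# X j)" using tr_compl[OF g(1) X] by (force simp: side_def)
    then show ?thesis using F_good[OF XF C.F_tr[OF g(1) XF] two[OF g(1)], of b] Z by simp
  qed
  obtain a where a: "a \<in> carrier G" "U = a <# X j \<or> U = a <# (carrier G - X j)"
    using UW(1) J by (auto elim: translatesE)
  define W' where "W' = inv a <# W"
  have W': "W' \<in> F" "W = a <# W'"
    using C.F_tr[OF inv_closed[OF a(1)] UW(2)] tr_inv(2)[OF a(1) C.F_sub[OF UW(2)]] by (simp_all add: W'_def)
  note W'c = C.F_sub[OF W'(1)]
  from a(2) show "U \<subseteq> W \<or> W \<subseteq> U"
  proof
    assume U: "U = a <# X j"
    then have "X j \<subseteq> W' \<or> W' \<subseteq> X j"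
      using base[OF W'(1)] UW(3,4) csub_tr[OF a(1) X W'c] csub_tr[OF a(1) W'c X] W'(2) by simp
    then show ?thesis using U W'(2) tr_mono by auto
  next
    assume U: "U = a <# (carrier G - X j)"
    have Xc: "carrier G - X j \<subseteq> carrier G" by blast
    have "csub (carrier G - X j) W'" "csub W' (carrier G - X j)"
      using UW(3,4) csub_tr[OF a(1) Xc W'c] csub_tr[OF a(1) W'c Xc] W'(2) U by simp_all
    then have "csub (carrier G - W') (X j)" "csub (X j) (carrier G - W')"
      using C.csub_compl[OF C.F_compl[OF XF] W'(1)] C.csub_compl[OF W'(1) C.F_compl[OF XF]] C.compl_compl[OF XF] by simp_all
    then have "X j \<subseteq> carrier G - W' \<or> carrier G - W' \<subseteq> X j" using base[OF C.F_compl[OF W'(1)]] by blast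
    then have "W' \<subseteq> carrier G - X j \<or> carrier G - X j \<subseteq> W'" using W'c by blast
    then show ?thesis using U W'(2) tr_mono by auto
  qed
qed (rule F_almost)

end

end

end

section \<open>Collapsing all edges but one\<close>

context tree_action
begin

lemma mem_conj_by:
  assumes "g \<in> carrier G" "K \<subseteq> carrier G" "h \<in> carrier G"
  shows "h \<in> conj_by G g ` K \<longleftrightarrow> inv g \<otimes> h \<otimes> g \<in> K"
proof
  assume "h \<in> conj_by G g ` K"
  then obtain k where k: "k \<in> K" "h = g \<otimes> k \<otimes> inv g" by (auto simp: conj_by_def)
  then have "k \<in> carrier G" using assms(2) by blast
  then have "inv g \<otimes> h \<otimes> g = k" using k(2) assms(1) by (simp add: m_assoc) (simp add: m_assoc[symmetric])
  then show "inv g \<otimes> h \<otimes> g \<in> K" using k(1) by simp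
next
  assume "inv g \<otimes> h \<otimes> g \<in> K"
  moreover have "h = conj_by G g (inv g \<otimes> h \<otimes> g)"
    using assms by (simp add: conj_by_def m_assoc) (simp add: m_assoc[symmetric])
  ultimately show "h \<in> conj_by G g ` K" by blast
qed

lemma conj_by_closed: "\<lbrakk>g \<in> carrier G; K \<subseteq> carrier G\<rbrakk> \<Longrightarrow> conj_by G g ` K \<subseteq> carrier G"
  by (auto simp: conj_by_def)

lemma conj_vstab:
  assumes "g \<in> carrier G" "w \<subseteq> E"
  shows "conj_by G g ` vstab w = vstab (vact g w)"
proof -
  have sub: "vstab v \<subseteq> carrier G" for v by (auto simp: vstab_def)
  have "h \<in> conj_by G g ` vstab w \<longleftrightarrow> h \<in> vstab (vact g w)" if "h \<in> carrier G" for h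
    using mem_conj_by[OF assms(1) sub that] mem_vstab_vact[OF assms that] by simp
  then show ?thesis using conj_by_closed[OF assms(1) sub] sub by blast
qed

lemma conj_estab:
  assumes "g \<in> carrier G" "e \<in> E"
  shows "conj_by G g ` estab e = estab (act g e)"
proof -
  have sub: "estab f \<subseteq> carrier G" for f by (auto simp: estab_def)
  have "h \<in> conj_by G g ` estab e \<longleftrightarrow> h \<in> estab (act g e)" if "h \<in> carrier G" for h
    using mem_conj_by[OF assms(1) sub that] mem_estab_act[OF assms that] by simp
  then show ?thesis using conj_by_closed[OF assms(1) sub] sub by blast
qed

lemma conj_inv_estab:
  assumes "g \<in> carrier G" "e \<in> E"
  shows "(\<lambda>h. inv g \<otimes> h \<otimes> g) ` estab e = estab (act (inv g) e)"
  using conj_estab[of "inv g" e] assms by (simp add: conj_by_def)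

text \<open>Every vertex is a translate of an end of some \<open>e0 i\<close>. \<open>xs\<close>
  lists these ends, and taking the first entry that lies in a given orbit makes representatives
  unique. An edge has to start exactly at a representative, so \<open>e0 i\<close> is replaced by
  its translate \<open>ed i\<close>.\<close>

lemma quotient_exists:
  fixes e0 :: "nat \<Rightarrow> 'e"
  assumes I: "finite I" "I \<noteq> {}" and e0: "\<And>i. i \<in> I \<Longrightarrow> e0 i \<in> E"
    and cover: "\<And>e. e \<in> E \<Longrightarrow> \<exists>i\<in>I. \<exists>g\<in>carrier G. e = act g (e0 i) \<or> e = act g (st (e0 i))"
    and unique: "\<And>i j g. \<lbrakk>i \<in> I; j \<in> I; g \<in> carrier G; act g (e0 i) = e0 j \<or> act g (e0 i) = st (e0 j)\<rbrakk> \<Longrightarrow> i = j"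
  shows "\<exists>V rep ed s0 s1 t a. tree_quotient G E le st act V rep I ed s0 s1 t \<and>
    (\<forall>i\<in>I. a i \<in> carrier G \<and> e0 i = act (a i) (ed i))"
proof -
  let ?Q = "(\<lambda>i. tau (e0 i)) ` I \<union> (\<lambda>i. tau (st (e0 i))) ` I"
  have "finite ?Q" using I(1) by simp
  from finite_list[OF this] obtain xs where xs: "set xs = ?Q" ..
  define rep where "rep j = xs ! j" for j
  define same where "same v j \<longleftrightarrow> j < length xs \<and> (\<exists>g\<in>carrier G. v = vact g (rep j))" for v j
  define index where "index v = (LEAST j. same v j)" for v
  define V where "V = index ` tau ` E"
  have repE: "\<exists>e\<in>E. rep j = tau e" if "j < length xs" for j
  proof -
    have "rep j \<in> ?Q" using nth_mem[OF that] unfolding rep_def xs .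
    then show ?thesis using e0 st_in by auto
  qed
  have repsub: "rep j \<subseteq> E" if "j < length xs" for j using repE[OF that] tau_sub by auto
  have ex: "\<exists>j. same (tau e) j" if e: "e \<in> E" for e
  proof -
    obtain i g where g: "i \<in> I" "g \<in> carrier G" "e = act g (e0 i) \<or> e = act g (st (e0 i))" using cover[OF e] by blast
    then have "tau e = vact g (tau (e0 i)) \<or> tau e = vact g (tau (st (e0 i)))"
      using vact_tau e0 st_in by auto
    then obtain q where q: "q \<in> ?Q" "tau e = vact g q" using g(1) by blast
    then obtain j where "j < length xs" "xs ! j = q" using xs by (metis in_set_conv_nth)
    then show ?thesis using q(2) g(2) by (auto simp: same_def rep_def)
  qed
  have ind: "same v (index v)" if v: "v \<in> tau ` E" for v
  proof -
    obtain e where "e \<in> E" "v = tau e" using v by blast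
    then show ?thesis unfolding index_def using ex[of e] by (auto intro: LeastI_ex)
  qed
  have same_vact: "same (vact g v) j \<longleftrightarrow> same v j" if g: "g \<in> carrier G" and v: "v \<subseteq> E" for g v j
  proof
    assume "same v j"
    then obtain h where h: "j < length xs" "h \<in> carrier G" "v = vact h (rep j)" by (auto simp: same_def)
    then have "vact g v = vact (g \<otimes> h) (rep j)" using vact_mult[OF g h(2) repsub[OF h(1)]] by simp
    then show "same (vact g v) j" unfolding same_def using h(1,2) g by (intro conjI bexI[of _ "g \<otimes> h"]) simp_all
  next
    assume "same (vact g v) j"
    then obtain h where h: "j < length xs" "h \<in> carrier G" "vact g v = vact h (rep j)" by (auto simp: same_def)
    have "vact (inv g \<otimes> h) (rep j) = v"
      using vact_mult[OF inv_closed[OF g] h(2) repsub[OF h(1)]] vact_inv(1)[OF g v] h(3) by simp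
    then show "same v j" unfolding same_def using h(1,2) g by (intro conjI bexI[of _ "inv g \<otimes> h"]) simp_all
  qed
  have index_vact: "index (vact g v) = index v" if "g \<in> carrier G" "v \<subseteq> E" for g v
  proof -
    have "same (vact g v) = same v" using same_vact[OF that] by blast
    then show ?thesis by (simp only: index_def)
  qed
  have index_rep: "j < length xs \<and> index (rep j) = j" if j: "j \<in> V" for j
  proof -
    obtain v where v: "v \<in> tau ` E" "index v = j" using j unfolding V_def by blast
    have "same v j" using ind[OF v(1)] v(2) by simp
    then obtain g where g: "j < length xs" "g \<in> carrier G" "v = vact g (rep j)" unfolding same_def by blast
    then show ?thesis using index_vact[OF g(2) repsub[OF g(1)]] v(2) by simp
  qed
  have in_V: "index (tau e) \<in> V" if "e \<in> E" for e using that by (simp add: V_def)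
  have pick: "\<exists>g\<in>carrier G. tau e = vact g (rep (index (tau e)))" if "e \<in> E" for e
    using ind[OF imageI[OF that]] unfolding same_def by (rule conjunct2)
  have "\<forall>i\<in>I. \<exists>a. a \<in> carrier G \<and> tau (st (e0 i)) = vact a (rep (index (tau (st (e0 i)))))"
    using pick[OF st_in[OF e0]] by blast
  then obtain a where a: "\<And>i. i \<in> I \<Longrightarrow> a i \<in> carrier G \<and> tau (st (e0 i)) = vact (a i) (rep (index (tau (st (e0 i)))))"
    by metis
  note aC = a[THEN conjunct1] and aT = a[THEN conjunct2]
  define ed where "ed i = act (inv (a i)) (e0 i)" for i
  have ed: "ed i \<in> E \<and> act (a i) (ed i) = e0 i" if "i \<in> I" for i
    using aC[OF that] e0[OF that] act_in act_inv by (simp add: ed_def)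
  note edE = ed[THEN conjunct1] and ed_e0 = ed[THEN conjunct2]
  have "\<forall>i\<in>I. \<exists>t. t \<in> carrier G \<and> tau (ed i) = vact t (rep (index (tau (ed i))))"
    using pick[OF edE] by blast
  then obtain t where t: "\<And>i. i \<in> I \<Longrightarrow> t i \<in> carrier G \<and> tau (ed i) = vact (t i) (rep (index (tau (ed i))))"
    by metis
  define s0 where "s0 i = index (tau (st (e0 i)))" for i
  define s1 where "s1 i = index (tau (ed i))" for i
  have "tree_quotient G E le st act V rep I ed s0 s1 t"
  proof unfold_locales
    have "V \<subseteq> {..<length xs}" using index_rep by auto
    then show "finite V" by (rule finite_subset) simp
    show "V \<noteq> {}"
    proof -
      obtain i where "i \<in> I" using I(2) by blast
      from in_V[OF e0[OF this]] show ?thesis by blast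
    qed
    show "rep v \<in> tau ` E" if "v \<in> V" for v
    proof -
      obtain e where "e \<in> E" "rep v = tau e" using repE[OF index_rep[OF \<open>v \<in> V\<close>, THEN conjunct1]] by (elim bexE)
      then show ?thesis by (rule image_eqI[rotated])
    qed
    show "v = w" if "v \<in> V" "w \<in> V" "g \<in> carrier G" "rep v = vact g (rep w)" for v w g
    proof -
      have "v = index (rep v)" using index_rep[OF that(1)] by simp
      also have "\<dots> = index (vact g (rep w))" by (rule arg_cong[OF that(4)])
      also have "\<dots> = w" using index_vact[OF that(3) repsub] index_rep[OF that(2)] by simp
      finally show ?thesis .
    qed
    show "s0 i \<in> V \<and> s1 i \<in> V" if "i \<in> I" for i
      using in_V e0[OF that] edE[OF that] st_in by (simp add: s0_def s1_def)
    show "tau (st (ed i)) = rep (s0 i)" if i: "i \<in> I" for i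
    proof -
      have "tau (st (ed i)) = vact (inv (a i)) (tau (st (e0 i)))"
        using aC[OF i] e0[OF i] st_in vact_tau act_st by (simp add: ed_def)
      also have "\<dots> = vact (inv (a i)) (vact (a i) (rep (s0 i)))"
        unfolding s0_def by (rule arg_cong[OF aT[OF i]])
      also have "\<dots> = rep (s0 i)"
        using vact_inv(1)[OF aC[OF i] repsub] index_rep[OF in_V[OF st_in[OF e0[OF i]]]] by (simp add: s0_def)
      finally show ?thesis .
    qed
    show "tau (ed i) = vact (t i) (rep (s1 i))" if "i \<in> I" for i
      unfolding s1_def by (rule t[OF that, THEN conjunct2])
    show "t i \<in> carrier G" if "i \<in> I" for i by (rule t[OF that, THEN conjunct1])
    show "\<exists>i\<in>I. \<exists>g\<in>carrier G. e = act g (ed i) \<or> e = act g (st (ed i))" if e: "e \<in> E" for e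
    proof -
      obtain i g where g: "i \<in> I" "g \<in> carrier G" "e = act g (e0 i) \<or> e = act g (st (e0 i))" using cover[OF e] by blast
      have "act g (e0 i) = act (g \<otimes> a i) (ed i)" "act g (st (e0 i)) = act (g \<otimes> a i) (st (ed i))"
        using act_mult[OF g(2) aC[OF g(1)] edE[OF g(1)]] act_mult[OF g(2) aC[OF g(1)] st_in[OF edE[OF g(1)]]]
          act_st[OF aC[OF g(1)] edE[OF g(1)]] ed_e0[OF g(1)] by simp_all
      moreover have "g \<otimes> a i \<in> carrier G" using g(2) aC[OF g(1)] by simp
      ultimately show ?thesis using g(1,3) by metis
    qed
    show "i = j" if ij: "i \<in> I" "j \<in> I" and g: "g \<in> carrier G" "act g (ed i) = ed j \<or> act g (ed i) = st (ed j)" for i j g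
    proof (rule unique[OF ij])
      let ?h = "a j \<otimes> g \<otimes> inv (a i)"
      show "?h \<in> carrier G" using aC[OF ij(1)] aC[OF ij(2)] g(1) by simp
      have ai: "a i \<in> carrier G" "a j \<in> carrier G" using aC ij by auto
      have "act ?h (e0 i) = act (a j) (act g (ed i))"
        using ai g(1) e0[OF ij(1)] act_in by (simp add: act_mult ed_def)
      then show "act ?h (e0 i) = e0 j \<or> act ?h (e0 i) = st (e0 j)"
        using g(2) ed_e0[OF ij(2)] act_st[OF ai(2) edE[OF ij(2)]] by auto
    qed
  qed (use I edE in auto)
  moreover have "\<forall>i\<in>I. a i \<in> carrier G \<and> e0 i = act (a i) (ed i)" using aC ed_e0 by simp
  ultimately show ?thesis by blast
qed

end

context tree_quotient
begin

section \<open>Keeping a single orbit of edges\<close>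

context
  fixes i assumes i: "i \<in> I"
begin

abbreviation Oi where "Oi \<equiv> ES {i}"

lemma O_sub: "Oi \<subseteq> E" "{i} \<subseteq> I"
  using ES_sub[of "{i}"] i by auto

lemma O_closed: "g \<in> carrier G \<Longrightarrow> f \<in> Oi \<Longrightarrow> act g f \<in> Oi"
  using act_mult[OF _ _ ed_in[OF i], symmetric] act_mult[OF _ _ st_in[OF ed_in[OF i]], symmetric]
  by (fastforce simp: ES_def)

lemma ES_rest: "ES (I - {i}) = E - Oi"
proof -
  have "f \<notin> ES (I - {i})" if f: "f \<in> Oi" for f
  proof
    assume "f \<in> ES (I - {i})"
    then obtain h j where h: "h \<in> carrier G" "j \<in> I" "j \<noteq> i" "f = act h (ed j) \<or> f = act h (st (ed j))"
      by (auto simp: ES_def)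
    obtain g where g: "g \<in> carrier G" "f = act g (ed i) \<or> f = act g (st (ed i))"
      using f by (auto simp: ES_def)
    have "act h (ed j) = act g (ed i) \<or> act h (ed j) = st (act g (ed i))"
      using h(4) g(2) act_st[OF h(1) ed_in[OF h(2)]] act_st[OF g(1) ed_in[OF i]]
        st_st act_in[OF h(1) ed_in[OF h(2)]] act_in[OF g(1) ed_in[OF i]] by metis
    then have "act (inv g \<otimes> h) (ed j) = ed i \<or> act (inv g \<otimes> h) (ed j) = st (ed i)"
      unfolding act_mult[OF inv_closed[OF g(1)] h(1) ed_in[OF h(2)]] act_st[OF g(1) ed_in[OF i], symmetric]
      using act_inv(1)[OF g(1) ed_in[OF i]] act_inv(1)[OF g(1) st_in[OF ed_in[OF i]]] by (elim disjE) simp_all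
    from ed_unique[OF h(2) i _ this] show False using g(1) h(1,3) by simp
  qed
  moreover have "f \<in> ES (I - {i}) \<or> f \<in> Oi" if "f \<in> E" for f
  proof -
    from ed_exists[OF that] obtain j g where j: "j \<in> I" "g \<in> carrier G" "f = act g (ed j) \<or> f = act g (st (ed j))"
      by (elim bexE)
    then have "f \<in> ES {j}" unfolding ES_def by blast
    then show ?thesis using j by (cases "j = i") (auto simp: ES_def)
  qed
  moreover have "ES (I - {i}) \<subseteq> E" using ES_sub by blast
  ultimately show ?thesis by blast
qed

text \<open>Vertices of the collapsed tree are traces of vertices on the remaining orbit, so paths
  avoiding the edge \<open>i\<close> join vertices with equal trace.\<close>

lemma agree_rest: "\<lbrakk>v \<subseteq> E; w \<subseteq> E\<rbrakk> \<Longrightarrow> agree (I - {i}) v w \<longleftrightarrow> v \<inter> Oi = w \<inter> Oi"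
  unfolding agree_def ES_rest by blast

lemma vact_O: "\<lbrakk>g \<in> carrier G; v \<subseteq> E\<rbrakk> \<Longrightarrow> vact g (v \<inter> Oi) = vact g v \<inter> Oi"
proof -
  assume g: "g \<in> carrier G" and v: "v \<subseteq> E"
  have "vact g Oi = Oi"
  proof
    show "vact g Oi \<subseteq> Oi" unfolding vact_def using O_closed[OF g] by blast
    show "Oi \<subseteq> vact g Oi"
    proof
      fix f assume f: "f \<in> Oi"
      then have "f = act g (act (inv g) f)" using act_inv(2)[OF g] O_sub by auto
      then show "f \<in> vact g Oi" unfolding vact_def by (rule image_eqI) (rule O_closed[OF inv_closed[OF g] f])
    qed
  qed
  then show ?thesis using vact_Int[OF g v O_sub(1)] by simp
qed

lemma O_action: "tree_action G Oi le st act"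
  using subset_action[OF O_sub(1) ES_st[OF O_sub(2)] O_closed] .

lemma O_one_edge:
  assumes "a \<in> carrier G"
  shows "one_edge G Oi le st act (act a (ed i))"
proof -
  interpret T: tree_action G Oi le st act by (rule O_action)
  have edO: "ed i \<in> Oi"
    unfolding ES_iff_D[OF O_sub(2)] using act_one[OF ed_in[OF i]]
    by (intro bexI[of _ \<one>] bexI[of _ i] exI[of _ True]) (simp_all add: D_def)
  show ?thesis
  proof
    show "act a (ed i) \<in> Oi" using O_closed assms edO by blast
    fix f assume "f \<in> Oi"
    then obtain g where g: "g \<in> carrier G" "f = act g (ed i) \<or> f = act g (st (ed i))" by (auto simp: ES_def)
    have "act (g \<otimes> inv a) (act a (ed i)) = act g (ed i)" "act (g \<otimes> inv a) (st (act a (ed i))) = act g (st (ed i))"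
      using g(1) assms ed_in[OF i] st_in act_in act_inv by (simp_all add: act_mult act_st[symmetric])
    then show "\<exists>g\<in>carrier G. f = act g (act a (ed i)) \<or> f = act g (st (act a (ed i)))"
      using g assms by (metis inv_closed m_closed)
  qed
qed

lemma tau_O: "treeset.tau Oi le st f = tau f \<inter> Oi"
proof -
  interpret T: tree_action G Oi le st act by (rule O_action)
  show ?thesis using O_sub by (auto simp: T.tau_def tau_def)
qed

text \<open>Up to one conjugation the groups of the collapsed graph are the stabilizers of
  \<open>e\<close> and of its ends in the collapsed tree. A path back that avoids \<open>i\<close>
  exists in the quotient exactly if these ends lie in one orbit, which decides between the two kinds
  of splittings.\<close>

lemma edge_splitting_of_orbit:
  assumes v: "v \<in> V" and a: "a \<in> carrier G"
  defines "e \<equiv> act a (ed i)"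
  defines "x \<equiv> tau (st e) \<inter> Oi" and "y \<equiv> tau e \<inter> Oi"
  shows "\<exists>\<sigma>. (\<exists>g\<in>carrier G. edge_splitting gg v (induced_map G val) i (conj_splitting G g \<sigma>)) \<and>
    ((\<forall>g\<in>carrier G. vact g x \<noteq> y) \<and> \<sigma> = Amalgam (vstab x) (vstab y) (estab e) \<or>
     (\<exists>s\<in>carrier G. vact s x = y \<and> \<sigma> = HNN (vstab x) (estab e) ((\<lambda>h. inv s \<otimes> h \<otimes> s) ` estab e) s))"
proof -
  let ?F = "path_group gg" and ?\<phi> = "induced_map G val" and ?S = "I - {i}" and ?x = "s0 i" and ?y = "s1 i"
  interpret F: group ?F unfolding path_group_def by (rule pres.presented_group_group)
  have hom: "?\<phi> \<in> hom ?F G" unfolding path_group_def by (rule pres.induced_map_hom)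
  interpret hom: group_hom ?F G ?\<phi> using hom by unfold_locales
  have S: "?S \<subseteq> I" by blast
  note xV = s_in[OF i, THEN conjunct1] and yV = s_in[OF i, THEN conjunct2]
  note xs = rep_sub[OF xV] and ys = rep_sub[OF yV]
  note edE = ed_in[OF i] and tc = t_in[OF i]
  let ?X = "rep ?x \<inter> Oi" and ?Y = "rep ?y \<inter> Oi"
  have XE: "?X \<subseteq> E" and YE: "?Y \<subseteq> E" using xs ys by auto
  have eE: "e \<in> E" using a edE act_in by (simp add: e_def)
  have x: "x = vact a ?X"
    using a edE st_in vact_tau[OF a st_in[OF edE]] ed_source[OF i] vact_O[OF a xs] by (simp add: x_def e_def act_st)
  have y: "y = vact (a \<otimes> t i) ?Y"
    using vact_tau[OF a edE] ed_target[OF i] vact_O[OF _ ys, of "a \<otimes> t i"] a tc ys by (simp add: y_def e_def vact_mult)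
  have xE: "x \<subseteq> E" "y \<subseteq> E" using tau_sub by (auto simp: x_def y_def)
  have img: "?\<phi> ` path_classes gg ?S w u = {c \<in> carrier G. vact c (rep u \<inter> Oi) = rep w \<inter> Oi}"
    if "w \<in> V" "u \<in> V" for w u
  proof -
    have "agree ?S (vact c (rep u)) (rep w) \<longleftrightarrow> vact c (rep u \<inter> Oi) = rep w \<inter> Oi" if c: "c \<in> carrier G" for c
      using agree_rest[OF vact_sub[OF c rep_sub[OF \<open>u \<in> V\<close>]] rep_sub[OF \<open>w \<in> V\<close>]] vact_O[OF c rep_sub[OF \<open>u \<in> V\<close>]] by simp
    then show ?thesis unfolding path_class_image[OF S that] by blast
  qed
  have Kx: "?\<phi> ` path_classes gg ?S ?x ?x = vstab ?X" using img[OF xV xV] by (simp add: vstab_def)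
  have Ky: "?\<phi> ` path_classes gg ?S ?y ?y = vstab ?Y" using img[OF yV yV] by (simp add: vstab_def)
  let ?E0 = "{gog_class gg [Vert ?x (inj_src gg i h)] | h. h \<in> carrier (egrp gg i)}"
  let ?E1 = "{gog_class gg [Vert ?y (inj_tgt gg i h)] | h. h \<in> carrier (egrp gg i)}"
  have Vl: "[Vert ?x h] \<in> lists L" "[Vert ?y (inv (t i) \<otimes> h \<otimes> t i)] \<in> lists L" if "h \<in> estab (ed i)" for h
    using that estab_source[OF i that] estab_target[OF i that] xV yV by (simp_all add: Vert_in_L)
  have E0: "?\<phi> (gog_class gg [Vert ?x h]) = h" "?\<phi> (gog_class gg [Vert ?y (inv (t i) \<otimes> h \<otimes> t i)]) = inv (t i) \<otimes> h \<otimes> t i"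
    if h: "h \<in> estab (ed i)" for h
    using pres.induced_map_class[OF Vl(1)[OF h]] pres.induced_map_class[OF Vl(2)[OF h]] estab_closed[OF h] tc
    by (simp_all add: gog_class_def word_eval_def)
  have E0c: "?E0 \<subseteq> carrier ?F" "?E1 \<subseteq> carrier ?F"
    using Vl pres.class_closed by (auto simp: gog_class_def path_group_def)
  have E0i: "?\<phi> ` ?E0 = estab (ed i)"
  proof -
    have "?E0 = (\<lambda>h. gog_class gg [Vert ?x h]) ` estab (ed i)" by auto
    then show ?thesis using E0(1) by (simp add: image_image)
  qed
  have E1i: "?\<phi> ` ?E1 = estab (act (inv (t i)) (ed i))"
  proof -
    have "?E1 = (\<lambda>h. gog_class gg [Vert ?y (inv (t i) \<otimes> h \<otimes> t i)]) ` estab (ed i)" by auto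
    then have "?\<phi> ` ?E1 = (\<lambda>h. inv (t i) \<otimes> h \<otimes> t i) ` estab (ed i)" using E0(2) by (simp add: image_image)
    then show ?thesis using conj_inv_estab[OF tc edE] by simp
  qed
  have conj: "?\<phi> (conj_by ?F p c) = conj_by G (?\<phi> p) (?\<phi> c)" if "p \<in> carrier ?F" "c \<in> carrier ?F" for p c
    using that by (simp add: conj_by_def)
  have conj_img: "?\<phi> ` conj_by ?F p ` C = conj_by G (?\<phi> p) ` ?\<phi> ` C" if "p \<in> carrier ?F" "C \<subseteq> carrier ?F" for p C
    using conj[OF that(1)] that(2) by (auto simp: image_image subset_iff intro!: image_cong)
  note Sc = path_classes_carrier[OF S]
  have "path_classes gg I v ?x \<noteq> {}"
    using graph_of_groups_gg v xV by (simp add: graph_of_groups_def)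
  then obtain p where p: "p \<in> path_classes gg I v ?x" by blast
  have pF: "p \<in> carrier ?F" using path_classes_carrier[OF subset_refl] p by blast
  define P where "P = ?\<phi> p"
  have P: "P \<in> carrier G" using pF by (simp add: P_def)
  let ?e = "gog_class gg [Edge i True]"
  have el: "[Edge i True] \<in> lists L" using i by (simp add: Edge_in_L)
  have eF: "?e \<in> carrier ?F" using pres.class_closed[OF el] by (simp add: gog_class_def path_group_def)
  have \<phi>e: "?\<phi> ?e = t i" using pres.induced_map_class[OF el] tc by (simp add: gog_class_def word_eval_def)
  \<comment> \<open>\<open>p\<close> leads to the representative \<open>ed i\<close>, whereas the
    data are those of its translate \<open>e\<close> by \<open>a\<close>; \<open>g\<close> compares
    the two positions.\<close>
  define g where "g = P \<otimes> inv a"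
  have g: "g \<in> carrier G" using P a by (simp add: g_def)
  have gx: "vact g x = vact P ?X" using P a XE vact_sub vact_inv by (simp add: x g_def vact_mult)
  have "g \<otimes> (a \<otimes> t i) = P \<otimes> t i"
    using P a tc by (simp add: g_def m_assoc) (simp add: m_assoc[symmetric])
  then have gy: "vact g y = vact (P \<otimes> t i) ?Y" using vact_mult[OF g _ YE, of "a \<otimes> t i"] a tc by (simp add: y)
  have ge: "act g e = act P (ed i)" using P a edE act_in act_inv by (simp add: g_def e_def act_mult)
  have A: "?\<phi> ` conj_by ?F p ` path_classes gg ?S ?x ?x = conj_by G g ` vstab x"
    using conj_img[OF pF Sc] Kx conj_vstab[OF P XE] conj_vstab[OF g xE(1)] gx P_def by simp
  have E0': "?\<phi> ` conj_by ?F p ` ?E0 = conj_by G g ` estab e"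
    unfolding conj_img[OF pF E0c(1)] E0i using conj_estab[OF P edE] conj_estab[OF g eE] ge P_def by simp
  have swap: "(\<exists>c\<in>carrier G. vact c ?X = ?Y) \<longleftrightarrow> (\<exists>s\<in>carrier G. vact s x = y)"
  proof
    assume "\<exists>c\<in>carrier G. vact c ?X = ?Y"
    then obtain c where c: "c \<in> carrier G" "vact c ?X = ?Y" by blast
    have "vact (a \<otimes> t i \<otimes> c \<otimes> inv a) x = y"
      using c a tc XE YE vact_sub vact_inv by (simp add: x y vact_mult)
    then show "\<exists>s\<in>carrier G. vact s x = y" by (rule bexI) (use c a tc in simp)
  next
    assume "\<exists>s\<in>carrier G. vact s x = y"
    then obtain s where s: "s \<in> carrier G" "vact s x = y" by blast
    have at: "a \<otimes> t i \<in> carrier G" using a tc by simp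
    have "vact (inv (a \<otimes> t i) \<otimes> s \<otimes> a) ?X = vact (inv (a \<otimes> t i)) (vact s x)"
      using s a at XE vact_sub by (simp add: x vact_mult)
    also have "\<dots> = ?Y" using s(2) vact_inv(1)[OF at YE] y by simp
    finally show "\<exists>c\<in>carrier G. vact c ?X = ?Y" by (rule bexI) (use s a at in simp)
  qed
  have empty: "path_classes gg ?S ?y ?x = {} \<longleftrightarrow> \<not> (\<exists>s\<in>carrier G. vact s x = y)"
  proof -
    have "path_classes gg ?S ?y ?x = {} \<longleftrightarrow> {c \<in> carrier G. vact c ?X = ?Y} = {}"
      unfolding img[OF yV xV, symmetric] by (rule image_is_empty[symmetric])
    then show ?thesis using swap by blast
  qed
  show ?thesis
  proof (cases "path_classes gg ?S ?y ?x = {}")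
    case True
    let ?\<sigma> = "Amalgam (vstab x) (vstab y) (estab e)"
    have B: "?\<phi> ` conj_by ?F (p \<otimes>\<^bsub>?F\<^esub> ?e) ` path_classes gg ?S ?y ?y = conj_by G g ` vstab y"
      using conj_img[OF _ Sc, of "p \<otimes>\<^bsub>?F\<^esub> ?e"] pF eF Ky conj_vstab[OF _ YE, of "P \<otimes> t i"] P tc
        conj_vstab[OF g xE(2)] gy P_def \<phi>e by simp
    have "edge_splitting gg v ?\<phi> i (conj_splitting G g ?\<sigma>)"
      unfolding edge_splitting_def Let_def
      by (rule bexI[of _ p]) (use True A B E0' p in simp_all)
    then show ?thesis using g True empty by (intro exI[of _ ?\<sigma>]) blast
  next
    case False
    then obtain q where q: "q \<in> path_classes gg ?S ?y ?x" by blast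
    have qF: "q \<in> carrier ?F" using Sc q by blast
    define c where "c = ?\<phi> q"
    have c: "c \<in> carrier G" "vact c ?X = ?Y" using img[OF yV xV] q by (auto simp: c_def)
    \<comment> \<open>The stable letter is the edge followed by the path back, with value
      \<open>t i \<otimes> c\<close>, conjugated by \<open>a\<close>.\<close>
    define s where "s = a \<otimes> t i \<otimes> c \<otimes> inv a"
    have s: "s \<in> carrier G" using a tc c by (simp add: s_def)
    have sx: "vact s x = y" using c a tc XE YE vact_sub vact_inv by (simp add: x y s_def vact_mult)
    let ?H1 = "(\<lambda>h. inv s \<otimes> h \<otimes> s) ` estab e"
    let ?\<sigma> = "HNN (vstab x) (estab e) ?H1 s"
    have "inv c \<otimes> inv (t i) \<otimes> inv a = inv a \<otimes> inv s"
      using a tc c by (simp add: s_def inv_mult_group m_assoc) (simp add: m_assoc[symmetric])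
    then have "(P \<otimes> inv c) \<otimes> inv (t i) = g \<otimes> inv s \<otimes> a"
      using a tc c s P by (simp add: g_def m_assoc) (metis inv_closed inv_solve_right m_assoc m_closed)
    then have "act (P \<otimes> inv c) (act (inv (t i)) (ed i)) = act g (act (inv s) e)"
      using P c tc g s a edE act_mult[of "P \<otimes> inv c" "inv (t i)" "ed i"] act_mult[of "g \<otimes> inv s" a "ed i"]
        act_mult[of g "inv s" e] eE by (simp add: e_def)
    then have H1: "?\<phi> ` conj_by ?F (p \<otimes>\<^bsub>?F\<^esub> inv\<^bsub>?F\<^esub> q) ` ?E1 = conj_by G g ` ?H1"
      unfolding conj_img[OF F.m_closed[OF pF F.inv_closed[OF qF]] E0c(2)] E1i conj_inv_estab[OF s eE]
      using pF qF conj_estab[of "P \<otimes> inv c" "act (inv (t i)) (ed i)"] conj_estab[of g "act (inv s) e"]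
        P c g s tc edE eE act_in by (simp add: P_def c_def)
    have "P \<otimes> (t i \<otimes> c) \<otimes> inv P = g \<otimes> s \<otimes> inv g"
      using P a tc c by (simp add: g_def s_def inv_mult_group m_assoc) (simp add: m_assoc[symmetric])
    then have S': "?\<phi> (conj_by ?F p (?e \<otimes>\<^bsub>?F\<^esub> q)) = conj_by G g s"
      using conj[OF pF F.m_closed[OF eF qF]] eF qF \<phi>e by (simp add: conj_by_def P_def c_def)
    have "edge_splitting gg v ?\<phi> i (conj_splitting G g ?\<sigma>)"
      unfolding edge_splitting_def Let_def
    proof (rule bexI[of _ p])
      show "if path_classes gg (edges gg - {i}) (tgt gg i) (src gg i) = {}
        then conj_splitting G g ?\<sigma> = Amalgam (?\<phi> ` conj_by ?F p ` path_classes gg (edges gg - {i}) (src gg i) (src gg i))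
               (?\<phi> ` conj_by ?F (p \<otimes>\<^bsub>?F\<^esub> ?e) ` path_classes gg (edges gg - {i}) (tgt gg i) (tgt gg i))
               (?\<phi> ` conj_by ?F p ` {gog_class gg [Vert (src gg i) (inj_src gg i h)] | h. h \<in> carrier (egrp gg i)})
        else \<exists>q\<in>path_classes gg (edges gg - {i}) (tgt gg i) (src gg i).
               conj_splitting G g ?\<sigma> = HNN (?\<phi> ` conj_by ?F p ` path_classes gg (edges gg - {i}) (src gg i) (src gg i))
                 (?\<phi> ` conj_by ?F p ` {gog_class gg [Vert (src gg i) (inj_src gg i h)] | h. h \<in> carrier (egrp gg i)})
                 (?\<phi> ` conj_by ?F (p \<otimes>\<^bsub>?F\<^esub> inv\<^bsub>?F\<^esub> q) ` {gog_class gg [Vert (tgt gg i) (inj_tgt gg i h)] | h. h \<in> carrier (egrp gg i)})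
                 (?\<phi> (conj_by ?F p (?e \<otimes>\<^bsub>?F\<^esub> q)))"
        unfolding gg_simps(2-4) if_not_P[OF False]
        by (rule bexI[OF _ q]) (simp only: conj_splitting.simps A E0' H1 S')
    qed (use p in simp)
    then show ?thesis using g s sx by (intro exI[of _ ?\<sigma>]) blast
  qed
qed

end

end

section \<open>The tree of a family of almost invariant sets\<close>

text \<open>
  The pair \<open>(W, n)\<close> is a copy of \<open>W\<close> that stands for a translate of the \<open>n\<close>-th set if
  \<open>n > 0\<close>, and of the complement of the \<open>(-n)\<close>-th set if \<open>n < 0\<close>.  The labels
  subdivide the edges when some translate of a set is its complement or a translate of another
  set, so that the action has no inversions and different indices give different orbits.
\<close>
locale labelled_family = nested_family G S F for G :: "'a monoid" (structure) and S and F +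
  fixes k :: nat and X :: "nat \<Rightarrow> 'a set"
  assumes X_in: "i \<in> {1..k} \<Longrightarrow> X i \<in> F"
begin

definition Xn :: "int \<Rightarrow> 'a set" where
  "Xn n = (if 0 < n then X (nat n) else carrier G - X (nat (- n)))"

definition N :: "int set" where "N = {n. n \<noteq> 0 \<and> \<bar>n\<bar> \<le> int k}"

definition E :: "('a set \<times> int) set" where
  "E = {(g <# Xn n, n) | g n. g \<in> carrier G \<and> n \<in> N}"

text \<open>Copies of the same set are ordered by their labels. The map \<open>st\<close> negates
  labels, so it reverses the order among copies as well.\<close>

definition le :: "'a set \<times> int \<Rightarrow> 'a set \<times> int \<Rightarrow> bool" where
  "le e f \<longleftrightarrow> (fst e \<noteq> fst f \<and> sle (fst e) (fst f)) \<or> (fst e = fst f \<and> snd e \<le> snd f)"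

definition st :: "'a set \<times> int \<Rightarrow> 'a set \<times> int" where
  "st e = (carrier G - fst e, - snd e)"

definition act :: "'a \<Rightarrow> 'a set \<times> int \<Rightarrow> 'a set \<times> int" where
  "act g e = (g <# fst e, snd e)"

lemma nat_label: "\<lbrakk>n \<in> N; 0 < n\<rbrakk> \<Longrightarrow> nat n \<in> {1..k}" "\<lbrakk>n \<in> N; \<not> 0 < n\<rbrakk> \<Longrightarrow> nat (- n) \<in> {1..k}"
  by (auto simp: N_def nat_le_iff Suc_le_eq)

lemma Xn_in: "n \<in> N \<Longrightarrow> Xn n \<in> F"
  using X_in[OF nat_label(1)] F_compl[OF X_in[OF nat_label(2)]] by (simp add: Xn_def)

lemma Xn_minus:
  assumes "n \<in> N"
  shows "Xn (- n) = carrier G - Xn n"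
proof (cases "0 < n")
  case True
  then show ?thesis by (simp add: Xn_def)
next
  case False
  then have "0 < - n" "carrier G - (carrier G - X (nat (- n))) = X (nat (- n))"
    using compl_compl[OF X_in[OF nat_label(2)[OF assms]]] assms by (auto simp: N_def)
  then show ?thesis using False by (simp add: Xn_def)
qed

lemma fst_in: "e \<in> E \<Longrightarrow> fst e \<in> F"
  using F_tr Xn_in by (auto simp: E_def)

lemma fst_sub: "e \<in> E \<Longrightarrow> fst e \<subseteq> carrier G"
  using F_sub fst_in by blast

lemma snd_in: "e \<in> E \<Longrightarrow> snd e \<in> N"
  by (auto simp: E_def)

lemma finite_N: "finite N"
  by (rule finite_subset[of _ "{- int k..int k}"]) (auto simp: N_def)

lemma sle_refl: "sle U U"
  by (simp add: sle_def)

lemma le_sle: "le e f \<Longrightarrow> sle (fst e) (fst f)"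
  using sle_refl by (auto simp: le_def)

lemma sle_le: "sle (fst e) (fst f) \<Longrightarrow> le e f \<or> le f e"
  by (auto simp: le_def)

lemma st_in: "e \<in> E \<Longrightarrow> st e \<in> E"
proof -
  assume "e \<in> E"
  then obtain g n where g: "g \<in> carrier G" "n \<in> N" "e = (g <# Xn n, n)" by (auto simp: E_def)
  have "st e = (g <# Xn (- n), - n)"
    using g Xn_minus tr_compl[OF g(1) F_sub[OF Xn_in[OF g(2)]]] by (simp add: st_def)
  moreover have "- n \<in> N" using g(2) by (simp add: N_def)
  ultimately show "st e \<in> E" using g(1) by (auto simp: E_def)
qed

lemma st_st: "e \<in> E \<Longrightarrow> st (st e) = e"
  using compl_compl[OF fst_in] by (simp add: st_def)

lemma le_st:
  assumes "e \<in> E" "f \<in> E" "le e f"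
  shows "le (st f) (st e)"
  using assms(3) sle_compl[OF fst_in[OF assms(1)] fst_in[OF assms(2)]]
    compl_compl[OF fst_in[OF assms(1)]] compl_compl[OF fst_in[OF assms(2)]]
  by (auto simp: le_def st_def)

lemma labelled_treeset: "treeset E le st"
proof
  show "le e f \<or> le e (st f) \<or> le (st e) f \<or> le (st e) (st f)" if "e \<in> E" "f \<in> E" for e f
  proof -
    have *: "sle (fst e) (fst f) \<or> sle (fst e) (fst (st f)) \<or> sle (fst (st e)) (fst f) \<or> sle (fst (st e)) (fst (st f))"
      using sle_nested[OF fst_in[OF that(1)] fst_in[OF that(2)]] by (simp add: st_def)
    note r = le_st[OF that(2,1)] le_st[OF st_in[OF that(2)] that(1)] le_st[OF that(2) st_in[OF that(1)]]
      le_st[OF st_in[OF that(2)] st_in[OF that(1)]] st_st[OF that(1)] st_st[OF that(2)]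
    show ?thesis
      using * sle_le[of e f] sle_le[of e "st f"] sle_le[of "st e" f] sle_le[of "st e" "st f"] r by metis
  qed
  show "\<not> le e (st f)" if "e \<in> E" "f \<in> E" "le e f" for e f
    using sle_excl[OF fst_in[OF that(1)] le_sle[OF that(3)]] le_sle[of e "st f"] by (auto simp: st_def)
  show "finite {f \<in> E. le e f \<and> le f g}" if "e \<in> E" "g \<in> E" for e g
  proof (rule finite_subset)
    show "{f \<in> E. le e f \<and> le f g} \<subseteq> {W \<in> F. sle (fst e) W \<and> sle W (fst g)} \<times> N"
    proof
      fix f assume "f \<in> {f \<in> E. le e f \<and> le f g}"
      then show "f \<in> {W \<in> F. sle (fst e) W \<and> sle W (fst g)} \<times> N"
        using fst_in[of f] snd_in[of f] le_sle[of e f] le_sle[of f g] by (simp add: mem_Times_iff)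
    qed
    show "finite ({W \<in> F. sle (fst e) W \<and> sle W (fst g)} \<times> N)"
      using sle_interval[OF fst_in[OF that(1)] fst_in[OF that(2)]] finite_N by simp
  qed
  show "e = f" if "e \<in> E" "f \<in> E" "le e f" "le f e" for e f
    using sle_antisym that(3,4) by (auto simp: le_def prod_eq_iff)
  show "le e g" if "e \<in> E" "f \<in> E" "g \<in> E" "le e f" "le f g" for e f g
  proof -
    have s: "sle (fst e) (fst g)"
      using sle_trans[OF fst_in[OF that(1)] fst_in[OF that(2)] fst_in[OF that(3)]] le_sle that(4,5) by blast
    show ?thesis
    proof (cases "fst e = fst g")
      case True
      then have "fst f = fst e" using sle_antisym le_sle[OF that(4)] le_sle[OF that(5)] by metis
      then show ?thesis using True that(4,5) by (auto simp: le_def)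
    next
      case False
      then show ?thesis using s by (simp add: le_def)
    qed
  qed
qed (auto simp: st_in st_st le_st, simp add: le_def)

sublocale tree: tree_action G E le st act
proof -
  interpret T: treeset E le st by (rule labelled_treeset)
  show "tree_action G E le st act"
  proof
    fix g e assume g: "g \<in> carrier G" and e: "e \<in> E"
    obtain h n where h: "h \<in> carrier G" "n \<in> N" "e = (h <# Xn n, n)" using e by (auto simp: E_def)
    have "act g e = ((g \<otimes> h) <# Xn n, n)"
      using lcos_m_assoc[OF F_sub[OF Xn_in[OF h(2)]] g h(1)] h(3) by (simp add: act_def)
    then show "act g e \<in> E" unfolding E_def using h(1,2) g by blast
    show "act g (st e) = st (act g e)" using tr_compl[OF g fst_sub[OF e]] by (simp add: act_def st_def)
    have "snd e \<noteq> 0" using snd_in[OF e] by (simp add: N_def)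
    then show "act g e \<noteq> st e" by (auto simp: act_def st_def)
  next
    show "act \<one> e = e" if "e \<in> E" for e using lcos_mult_one[OF fst_sub[OF that]] by (simp add: act_def)
    show "act (g \<otimes> h) e = act g (act h e)" if "g \<in> carrier G" "h \<in> carrier G" "e \<in> E" for g h e
      using lcos_m_assoc[OF fst_sub[OF that(3)] that(1,2)] by (simp add: act_def)
    show "le (act g e) (act g f)" if g: "g \<in> carrier G" and "e \<in> E" "f \<in> E" "le e f" for g e f
    proof -
      have "g <# fst e = g <# fst f \<longleftrightarrow> fst e = fst f"
        using tr_inv(1)[OF g fst_sub[OF that(2)]] tr_inv(1)[OF g fst_sub[OF that(3)]] by metis
      then show ?thesis
        using that(4) sle_tr[OF g fst_sub[OF that(2)] fst_sub[OF that(3)]] by (auto simp: le_def act_def)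
    qed
  qed
qed

definition e0 :: "nat \<Rightarrow> 'a set \<times> int" where "e0 i = (X i, int i)"

section \<open>The splitting determined by one set\<close>

context
  fixes i assumes i: "i \<in> {1..k}"
begin

lemma e0_in: "e0 i \<in> E"
proof -
  have "e0 i = (\<one> <# Xn (int i), int i)"
    using i lcos_mult_one[OF F_sub[OF X_in[OF i]]] by (simp add: e0_def Xn_def)
  moreover have "int i \<in> N" using i by (simp add: N_def)
  ultimately show ?thesis unfolding E_def using one_closed by blast
qed

lemma estab_e0: "tree.estab (e0 i) = Stab (X i)"
  by (simp add: tree.estab_def Stab_def act_def e0_def)

text \<open>\<open>Dpos\<close> consists of the \<open>g\<close> whose edge, in one of its
  directions, lies below that of \<open>X i\<close>, apart from the stabilizer; so it differs from
  \<open>X i\<close> only near the boundary. As \<open>X i\<close> and its complement reach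
  arbitrarily far from the boundary, both sides of the edge are nonempty, which the amalgam case
  requires.\<close>

lemma one_edge_splitting:
  assumes "one_edge G Oi le st act (e0 i)"
    and ai: "nontrivial_ai G H (X i)"
  defines "x \<equiv> treeset.tau Oi le st (st (e0 i))" and "y \<equiv> treeset.tau Oi le st (e0 i)"
  shows "(\<forall>g\<in>carrier G. tree.vact g x \<noteq> y) \<Longrightarrow> \<sigma> = Amalgam (tree.vstab x) (tree.vstab y) (Stab (X i)) \<Longrightarrow>
      splitting_over G \<sigma> (Stab (X i)) \<and> (\<exists>Y\<in>determined_sets G \<sigma>. H_almost_equal G H Y (X i))"
    and "\<lbrakk>s \<in> carrier G; tree.vact s x = y; \<sigma> = HNN (tree.vstab x) (Stab (X i)) ((\<lambda>h. inv s \<otimes> h \<otimes> s) ` Stab (X i)) s\<rbrakk> \<Longrightarrow>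
      splitting_over G \<sigma> (Stab (X i)) \<and> (\<exists>Y\<in>determined_sets G \<sigma>. H_almost_equal G H Y (X i))"
proof -
  interpret T: one_edge G Oi le st act "e0 i" by fact
  have xy: "x = T.x" "y = T.y" by (simp_all add: x_def y_def T.x_def T.y_def)
  have TH: "T.H = Stab (X i)" using estab_e0 by (simp add: T.H_def T.estab_def tree.estab_def)

  note XF = X_in[OF i]
  have "\<exists>D. sym_diff T.Dpos (X i) \<subseteq> nb D (X i)"
  proof (rule position_almost_equal[OF XF])
    show "T.Dpos \<subseteq> carrier G" by (auto simp: T.Dpos_def)
    fix g assume "g \<in> T.Dpos"
    then have g: "g \<in> carrier G" "g \<in> T.Dpos" by (simp_all add: T.Dpos_def)
    then have "le (act g (e0 i)) (e0 i) \<or> le (st (act g (e0 i))) (e0 i)" using T.Dpos_iff[OF g(1)] by blast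
    then have "sle (g <# X i) (X i) \<or> sle (carrier G - (g <# X i)) (X i)"
      using le_sle[of "act g (e0 i)" "e0 i"] le_sle[of "st (act g (e0 i))" "e0 i"]
      by (simp add: act_def st_def e0_def) blast
    then show "sle (g <# X i) (X i) \<or> sle (g <# (carrier G - X i)) (X i)"
      using tr_compl[OF g(1) F_sub[OF XF]] by simp
  next
    fix g assume g: "g \<in> carrier G" "sle (g <# X i) (X i) \<or> sle (g <# (carrier G - X i)) (X i)"
      "g <# X i \<noteq> X i" "g <# X i \<noteq> carrier G - X i"
    have gX: "g <# (carrier G - X i) = carrier G - (g <# X i)" using tr_compl[OF g(1) F_sub[OF XF]] .
    have "carrier G - (g <# X i) \<noteq> X i" using g(4) compl_compl[OF F_tr[OF g(1) XF]] by auto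
    then have "le (act g (e0 i)) (e0 i) \<and> act g (e0 i) \<noteq> e0 i \<or> le (st (act g (e0 i))) (e0 i)"
      using g(2,3) gX by (auto simp: le_def act_def st_def e0_def)
    then show "g \<in> T.Dpos" using T.Dpos_iff[OF g(1)] by blast
  qed
  then obtain D where D: "sym_diff T.Dpos (X i) \<subseteq> nb D (X i)" ..
  have eq: "H_almost_equal G H T.Dpos (X i)"
    unfolding H_almost_equal_def by (rule H_finite_subset[OF nb_H_finite[OF ai] D])
  show "splitting_over G \<sigma> (Stab (X i)) \<and> (\<exists>Y\<in>determined_sets G \<sigma>. H_almost_equal G H Y (X i))"
    if ns: "\<forall>g\<in>carrier G. tree.vact g x \<noteq> y" and \<sigma>: "\<sigma> = Amalgam (tree.vstab x) (tree.vstab y) (Stab (X i))"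
  proof -
    have "T.Dpos \<noteq> {}"
    proof
      assume "T.Dpos = {}"
      then show False using D big[OF XF, of D] by auto
    qed
    moreover have "T.Dneg \<noteq> {}"
    proof -
      obtain x0 where x0: "x0 \<in> bd (X i)" "x0 \<in> carrier G" using F_bd_nonempty[OF XF] by blast
      obtain D' where D': "inv x0 \<in> ball D'" using ball_exhaust x0 by blast
      \<comment> \<open>Outside \<open>X i\<close> and far from its boundary, hence neither in
        \<open>Dpos\<close> nor in the stabilizer.\<close>
      obtain g where g: "g \<in> carrier G" "g \<notin> X i" "g \<notin> nb (max D D') (X i)"
        using big[OF F_compl[OF XF], of "max D D'"] by (auto simp: nb_compl)
      have far: "g \<notin> nb D (X i)" "g \<notin> nb D' (X i)"
        using g(3) nb_mono[of D "max D D'" "X i"] nb_mono[of D' "max D D'" "X i"] by auto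
      have "g \<notin> T.Dpos" using D g(2) far(1) by blast
      moreover have "g \<notin> T.H"
      proof
        assume "g \<in> T.H"
        then have "g \<otimes> x0 \<in> bd (X i)" using Stab_bd[OF ai _ x0(1)] TH by simp
        then have "g \<otimes> x0 \<otimes> inv x0 \<in> nb D' (X i)" using nbI D' by blast
        then show False using far(2) g(1) x0(2) by (simp add: m_assoc)
      qed
      ultimately show ?thesis using T.side_cases[OF g(1)] by blast
    qed
    moreover have "T.vact g T.x \<noteq> T.y" if "g \<in> carrier G" for g using ns that unfolding xy by blast
    ultimately interpret A: amalgam_edge G Oi le st act "e0 i" by unfold_locales
    have \<sigma>': "\<sigma> = Amalgam (T.vstab T.x) (T.vstab T.y) T.H" using \<sigma> unfolding xy TH .
    have "splitting_over G \<sigma> (Stab (X i))"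
      unfolding splitting_over_def \<sigma>' edge_subgroup.simps using A.amalgam_is_splitting TH by blast
    moreover have "T.Dpos \<in> determined_sets G \<sigma>" unfolding \<sigma>' by (rule A.amalgam_determined)
    ultimately show ?thesis using eq by blast
  qed
  show "splitting_over G \<sigma> (Stab (X i)) \<and> (\<exists>Y\<in>determined_sets G \<sigma>. H_almost_equal G H Y (X i))"
    if s: "s \<in> carrier G" "tree.vact s x = y"
      and \<sigma>: "\<sigma> = HNN (tree.vstab x) (Stab (X i)) ((\<lambda>h. inv s \<otimes> h \<otimes> s) ` Stab (X i)) s"
  proof -
    interpret A: hnn_edge G Oi le st act "e0 i" s
      by unfold_locales (use s in \<open>simp_all only: xy\<close>)
    have \<sigma>': "\<sigma> = HNN (T.vstab T.x) T.H A.H1 s" using \<sigma> unfolding xy TH A.H1_def .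
    have "splitting_over G \<sigma> (Stab (X i))"
      unfolding splitting_over_def \<sigma>' edge_subgroup.simps using A.hnn_is_splitting TH by blast
    moreover have "T.Dpos \<in> determined_sets G \<sigma>" unfolding \<sigma>' by (rule A.hnn_determined)
    ultimately show ?thesis using eq by blast
  qed
qed

end

text \<open>All splittings come from one tree. The splitting for \<open>i\<close> is based at the
  edge \<open>e0 i\<close> of \<open>X i\<close> itself and not at its representative
  \<open>ed i\<close>, so that its edge group is the stabilizer of \<open>X i\<close>; this is why
  it agrees with the edge of the graph only up to conjugation.\<close>

lemma graph_of_groups_decomposition:
  assumes k: "1 \<le> k" and FE: "F = (\<Union>i\<in>{1..k}. translates G (X i))"
    and ai: "\<And>i. i \<in> {1..k} \<Longrightarrow> nontrivial_ai G (H i) (X i)"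
  shows "\<exists>(\<G> :: (nat, nat, 'a) gog) v \<phi> \<sigma>.
    graph_of_groups \<G> \<and> edges \<G> = {1..k} \<and> v \<in> verts \<G> \<and> \<phi> \<in> iso (fundamental_group \<G> v) G \<and>
    (\<forall>i\<in>{1..k}. splitting_over G (\<sigma> i) (Stab (X i)) \<and>
       (\<exists>g\<in>carrier G. edge_splitting \<G> v \<phi> i (conj_splitting G g (\<sigma> i))) \<and>
       (\<exists>Y\<in>determined_sets G (\<sigma> i). H_almost_equal G (H i) Y (X i)))"
proof -
  have "\<exists>V rep ed s0 s1 t a. tree_quotient G E le st act V rep {1..k} ed s0 s1 t \<and>
    (\<forall>i\<in>{1..k}. a i \<in> carrier G \<and> e0 i = act (a i) (ed i))"
  proof (rule tree.quotient_exists)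
    fix e assume "e \<in> E"
    then obtain g n where g: "g \<in> carrier G" "n \<in> N" "e = (g <# Xn n, n)" by (auto simp: E_def)
    show "\<exists>i\<in>{1..k}. \<exists>g\<in>carrier G. e = act g (e0 i) \<or> e = act g (st (e0 i))"
    proof (intro bexI)
      show "e = act g (e0 (nat \<bar>n\<bar>)) \<or> e = act g (st (e0 (nat \<bar>n\<bar>)))"
        using g(2,3) by (cases "0 < n") (auto simp: act_def st_def e0_def Xn_def N_def)
      show "nat \<bar>n\<bar> \<in> {1..k}" using g(2) by (auto simp: N_def)
    qed (rule g(1))
  next
    fix i j g assume "i \<in> {1..k}" "j \<in> {1..k}" "act g (e0 i) = e0 j \<or> act g (e0 i) = st (e0 j)"
    then show "i = j" by (auto simp: act_def st_def e0_def)
  qed (use k e0_in in auto)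
  then obtain V rep ed s0 s1 t a where Q: "tree_quotient G E le st act V rep {1..k} ed s0 s1 t"
    and a: "\<forall>i\<in>{1..k}. a i \<in> carrier G \<and> e0 i = act (a i) (ed i)" by (elim exE conjE)
  interpret Q: tree_quotient G E le st act V rep "{1..k}" ed s0 s1 t by (rule Q)
  obtain v where v: "v \<in> V" using Q.V_nonempty by blast
  let ?\<phi> = "induced_map G Q.val"
  have "\<exists>\<sigma>. splitting_over G \<sigma> (Stab (X i)) \<and>
       (\<exists>g\<in>carrier G. edge_splitting Q.gg v ?\<phi> i (conj_splitting G g \<sigma>)) \<and>
       (\<exists>Y\<in>determined_sets G \<sigma>. H_almost_equal G (H i) Y (X i))" if i: "i \<in> {1..k}" for i
  proof -
    let ?O = "Q.ES {i}"
    note ai' = a[rule_format, OF i, THEN conjunct1]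
    note e = a[rule_format, OF i, THEN conjunct2, symmetric]
    have one: "one_edge G ?O le st act (e0 i)" using Q.O_one_edge[OF i ai'] unfolding e .
    note es = Q.edge_splitting_of_orbit[OF i v, of "a i", unfolded e estab_e0[OF i]]
    note tau = Q.tau_O[OF i]
    note split = one_edge_splitting[OF i one ai[OF i], unfolded tau]
    obtain \<sigma> g where g: "g \<in> carrier G" "edge_splitting Q.gg v ?\<phi> i (conj_splitting G g \<sigma>)"
      and \<sigma>: "(\<forall>g\<in>carrier G. tree.vact g (tree.tau (st (e0 i)) \<inter> ?O) \<noteq> tree.tau (e0 i) \<inter> ?O) \<and>
          \<sigma> = Amalgam (tree.vstab (tree.tau (st (e0 i)) \<inter> ?O)) (tree.vstab (tree.tau (e0 i) \<inter> ?O)) (Stab (X i)) \<or>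
        (\<exists>s\<in>carrier G. tree.vact s (tree.tau (st (e0 i)) \<inter> ?O) = tree.tau (e0 i) \<inter> ?O \<and>
          \<sigma> = HNN (tree.vstab (tree.tau (st (e0 i)) \<inter> ?O)) (Stab (X i)) ((\<lambda>h. inv s \<otimes> h \<otimes> s) ` Stab (X i)) s)"
      using es[OF ai'] by (elim exE conjE bexE)
    from \<sigma> have "splitting_over G \<sigma> (Stab (X i)) \<and> (\<exists>Y\<in>determined_sets G \<sigma>. H_almost_equal G (H i) Y (X i))"
    proof (elim disjE conjE bexE)
      show "?thesis" if "\<forall>g\<in>carrier G. tree.vact g (tree.tau (st (e0 i)) \<inter> ?O) \<noteq> tree.tau (e0 i) \<inter> ?O"
        "\<sigma> = Amalgam (tree.vstab (tree.tau (st (e0 i)) \<inter> ?O)) (tree.vstab (tree.tau (e0 i) \<inter> ?O)) (Stab (X i))"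
        by (rule split(1)[OF that])
      show ?thesis if "s \<in> carrier G" "tree.vact s (tree.tau (st (e0 i)) \<inter> ?O) = tree.tau (e0 i) \<inter> ?O"
        "\<sigma> = HNN (tree.vstab (tree.tau (st (e0 i)) \<inter> ?O)) (Stab (X i)) ((\<lambda>h. inv s \<otimes> h \<otimes> s) ` Stab (X i)) s" for s
        by (rule split(2)[OF that])
    qed
    then show ?thesis using g by blast
  qed
  then obtain \<sigma> where \<sigma>: "\<And>i. i \<in> {1..k} \<Longrightarrow> splitting_over G (\<sigma> i) (Stab (X i)) \<and>
       (\<exists>g\<in>carrier G. edge_splitting Q.gg v ?\<phi> i (conj_splitting G g (\<sigma> i))) \<and>
       (\<exists>Y\<in>determined_sets G (\<sigma> i). H_almost_equal G (H i) Y (X i))" by metis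
  show ?thesis
    by (intro exI[of _ Q.gg] exI[of _ v] exI[of _ ?\<phi>] exI[of _ \<sigma>] conjI ballI Q.graph_of_groups_gg
        Q.induced_map_fundamental_group_iso[OF v] \<sigma>[THEN conjunct1] \<sigma>[THEN conjunct2, THEN conjunct1]
        \<sigma>[THEN conjunct2, THEN conjunct2]) (simp_all only: Q.gg_simps v)
qed

end

text \<open>Inverses are added to the generators so that the Cayley graph is undirected.\<close>

lemma fin_gen_generators:
  fixes G :: "'a monoid" (structure)
  assumes "group G" "fin_gen G (carrier G)"
  shows "\<exists>S. fg_group G S"
proof -
  interpret group G by fact
  obtain T where T: "finite T" "T \<subseteq> carrier G" "generate G T = carrier G" using assms by (auto simp: fin_gen_def)
  let ?S = "T \<union> (\<lambda>t. inv t) ` T"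
  have "fg_group G ?S"
  proof
    show "finite ?S" using T by simp
    show "?S \<subseteq> carrier G" using T by auto
    then show "generate G ?S = carrier G"
      using mono_generate[of T ?S] generate_in_carrier[of ?S] T by blast
    show "inv s \<in> ?S" if "s \<in> ?S" for s using that T by auto
  qed
  then show ?thesis by blast
qed

theorem theorem1p12:
  fixes G :: "'a monoid"
  assumes "group G" and "fin_gen G (carrier G)"
  shows
    "(\<forall>H X.
        subgroup H G \<and> fin_gen G H \<and> nontrivial_ai G H X \<and>
        almost_nested G (translates G X) \<and>
        (\<forall>g\<in>carrier G. two_small_imp_empty G X (g <#\<^bsub>G\<^esub> X)) \<longrightarrow>
        (\<exists>\<sigma>. splitting_over G \<sigma> (set_stabilizer G X) \<and>
             subgroup H (G\<lparr>carrier := set_stabilizer G X\<rparr>) \<and>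
             finite (rcosets\<^bsub>G\<lparr>carrier := set_stabilizer G X\<rparr>\<^esub> H) \<and>
             (\<exists>Y\<in>determined_sets G \<sigma>. H_almost_equal G H Y X)))
     \<and>
     (\<forall>(k::nat) H X.
        1 \<le> k \<and>
        (\<forall>i\<in>{1..k}. subgroup (H i) G \<and> fin_gen G (H i) \<and> nontrivial_ai G (H i) (X i)) \<and>
        almost_nested G (\<Union>i\<in>{1..k}. translates G (X i)) \<and>
        (\<forall>U\<in>(\<Union>i\<in>{1..k}. translates G (X i)). \<forall>V\<in>(\<Union>i\<in>{1..k}. translates G (X i)).
           two_small_imp_empty G U V) \<longrightarrow>
        (\<exists>(\<G> :: (nat, nat, 'a) gog) v \<phi> \<sigma>.
           graph_of_groups \<G> \<and> edges \<G> = {1..k} \<and> v \<in> verts \<G> \<and>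
           \<phi> \<in> iso (fundamental_group \<G> v) G \<and>
           (\<forall>i\<in>{1..k}.
              splitting_over G (\<sigma> i) (set_stabilizer G (X i)) \<and>
              (\<exists>g\<in>carrier G. edge_splitting \<G> v \<phi> i (conj_splitting G g (\<sigma> i))) \<and>
              subgroup (H i) (G\<lparr>carrier := set_stabilizer G (X i)\<rparr>) \<and>
              finite (rcosets\<^bsub>G\<lparr>carrier := set_stabilizer G (X i)\<rparr>\<^esub> (H i)) \<and>
              (\<exists>Y\<in>determined_sets G (\<sigma> i). H_almost_equal G (H i) Y (X i)))))"
proof -
  obtain S where "fg_group G S" using fin_gen_generators[OF assms] by blast
  then interpret fg_group G S .
  have X_in: "X i \<in> (\<Union>i\<in>J. translates G (X i))" if "i \<in> J" "nontrivial_ai G H (X i)" for J H i and X :: "nat \<Rightarrow> 'a set"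
    using that lcos_mult_one[OF ai_sub[OF that(2)]] one_closed by (fastforce simp: translates_def)
  show ?thesis
  proof (intro conjI allI impI, goal_cases)
    case (1 H X)
    \<comment> \<open>A family with one member. Only the passage from the pairs of \<open>X\<close>
      with its translates to all pairs of the family differs from the second part.\<close>
    let ?F = "\<Union>i\<in>{1::nat..1}. translates G X"
    have ai: "nontrivial_ai G H X" and fg: "fin_gen G H" and an: "almost_nested G ?F"
      and two: "\<And>g. g \<in> carrier G \<Longrightarrow> two_small_imp_empty G X (g <#\<^bsub>G\<^esub> X)" using 1 by auto
    have "nested_family G S ?F"
      by (rule nested_family_one_orbit[of "{1::nat..1}" "\<lambda>_. H" "\<lambda>_. X" ?F 1]) (use ai fg an two in auto)
    then interpret nested_family G S ?F .
    interpret labelled_family G S ?F 1 "\<lambda>_. X"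
      by unfold_locales (use X_in[OF _ ai, of _ "{1::nat..1}"] in auto)
    show ?case
      using graph_of_groups_decomposition[OF order_refl HOL.refl, of "\<lambda>_. H"] ai finite_index_Stab[OF ai]
      unfolding set_stabilizer_Stab by auto
  next
    case (2 k H X)
    let ?F = "\<Union>i\<in>{1..k}. translates G (X i)"
    have k: "1 \<le> k" and ai: "\<And>i. i \<in> {1..k} \<Longrightarrow> nontrivial_ai G (H i) (X i)"
      and fg: "\<And>i. i \<in> {1..k} \<Longrightarrow> fin_gen G (H i)" and an: "almost_nested G ?F"
      and two: "\<And>U V. U \<in> ?F \<Longrightarrow> V \<in> ?F \<Longrightarrow> two_small_imp_empty G U V" using 2 by blast+
    have "nested_family G S ?F"
      by (rule nested_family_all_pairs[of "{1..k}" H X ?F]) (use ai fg an two in blast)+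
    then interpret nested_family G S ?F .
    interpret labelled_family G S ?F k X
      by unfold_locales (rule X_in[OF _ ai])
    from graph_of_groups_decomposition[OF k HOL.refl ai] show ?case
      using finite_index_Stab[OF ai] unfolding set_stabilizer_Stab by meson
  qed
qed

end
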